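(* Let $n$ be a positive integer and $K$ an algebraic number field. Suppose $K$ admits an $n$-universal positive definite classic integral $\mathcal{O}_K$-lattice $L$ of rank $m\ge n+3$ such that, for each dyadic prime $\mathfrak{p}$ of $K$, $L_\mathfrak{p}\cong\prec a_1(\mathfrak{p}),\ldots,a_m(\mathfrak{p})\succ$ with $d_\mathfrak{p}(a_i(\mathfrak{p})a_{i+1}(\mathfrak{p}))>1$ (for $1\le i\le m-1$). Then $2$ is unramified in $K$, i.e. the discriminant of $K$ is odd.
   Context: A positive definite classic integral $\mathcal{O}_K$-lattice (finitely generated $\mathcal{O}_K$-module $L$ in a quadratic space over $K$ whose bilinear form takes values in $\mathcal{O}_K$ on $L$) is $n$-universal if it represents every positive definite classic integral $\mathcal{O}_K$-lattice of rank $n$. $L_\mathfrak{p}$ is the completion at $\mathfrak{p}$. For a dyadic completion $F=K_\mathfrak{p}$ with valuation $\operatorname{ord}$, $d_\mathfrak{p}(c)=\operatorname{ord}(c^{-1}\mathfrak{d}(c))$ where $\mathfrak{d}(c)=\bigcap_{x\in F}(c-x^2)\mathcal{O}_F$. For an $\mathcal{O}_F$-lattice $L$ with $Q(x)=B(x,x)$ and norm $\mathfrak{n}L$ (ideal generated by $Q(L)$), a BONG is a sequence $x_1,\ldots,x_m\in FL$ with $x_1\in L$, $Q(x_1)\mathcal{O}_F=\mathfrak{n}L$ and $x_2,\ldots,x_m$ a BONG of the projection of $L$ onto $(Fx_1)^\perp$; $L\cong\prec a_1,\ldots,a_m\succ$ means $L$ has a BONG with $Q(x_i)=a_i$. *)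

theory Defs
  imports
    "Jordan_Normal_Form.Determinant"
    "HOL-Library.Extended_Real"
    "HOL-Algebra.Ideal_Product"
    "HOL-Algebra.QuotRing"
    "HOL-Algebra.Algebraic_Closure_Type"
begin

section \<open>Number fields\<close>

text \<open>
  The number field is the type \<^typ>\<open>'k\<close>. Its completions depend on a prime ideal, so they
  cannot be types; they are ring records, and the theory of quadratic lattices below is
  stated over a field record \<^term>\<open>F\<close> so that it applies both to \<^typ>\<open>'k\<close> (through
  \<^const>\<open>ring_of_type_algebra\<close>) and to the completions.
\<close>

abbreviation rat_scale :: "rat \<Rightarrow> 'k \<Rightarrow> 'k::field_char_0" where
  "rat_scale q x \<equiv> of_rat q * x"

definition number_field :: "'k::field_char_0 itself \<Rightarrow> bool" where
  "number_field _ \<longleftrightarrow> (\<exists>B::'k set. finite_dimensional_vector_space rat_scale B)"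

abbreviation field_rec :: "'k::field ring" where
  "field_rec \<equiv> ring_of_type_algebra"

abbreviation ring_of_integers :: "'k::field set" where
  "ring_of_integers \<equiv> {x. algebraic_int x}"

abbreviation integers_rec :: "'k::field ring" where
  "integers_rec \<equiv> field_rec\<lparr>carrier := ring_of_integers\<rparr>"

text \<open>The trace of \<^term>\<open>x\<close> is the trace of the rational linear map given by multiplication by
  \<^term>\<open>x\<close>; it does not depend on the chosen basis.\<close>

definition field_trace :: "'k::field_char_0 \<Rightarrow> rat" where
  "field_trace x =
    (let B = (SOME B::'k set. finite_dimensional_vector_space rat_scale B)
     in \<Sum>b\<in>B. module.representation rat_scale B (x * b) b)"

definition integral_basis :: "'k::field_char_0 list \<Rightarrow> bool" where
  "integral_basis ws \<longleftrightarrow> set ws \<subseteq> ring_of_integers \<and>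
    (\<forall>x\<in>ring_of_integers. \<exists>!cs::int list. length cs = length ws \<and>
        x = (\<Sum>i<length ws. of_int (cs ! i) * ws ! i))"

definition discriminant :: "'k::field_char_0 itself \<Rightarrow> int" where
  "discriminant _ = (THE d. \<exists>ws::'k list. integral_basis ws \<and>
     of_int d = det (mat (length ws) (length ws) (\<lambda>(i, j). field_trace (ws ! i * ws ! j))))"

definition finite_prime :: "'k::field set \<Rightarrow> bool" where
  "finite_prime P \<longleftrightarrow> primeideal P integers_rec \<and> P \<noteq> {0}"

definition dyadic_prime :: "'k::field set \<Rightarrow> bool" where
  "dyadic_prime P \<longleftrightarrow> finite_prime P \<and> 2 \<in> P"

text \<open>The exponent of \<^term>\<open>P\<close> in the principal ideal generated by a nonzero integer.\<close>

definition ord_integer :: "'k::field set \<Rightarrow> 'k \<Rightarrow> nat" where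
  "ord_integer P a = (GREATEST k::nat. a \<in> P [^]\<^bsub>ideals_set integers_rec\<^esub> k)"

definition ord_at :: "'k::field set \<Rightarrow> 'k \<Rightarrow> ereal" where
  "ord_at P x = (if x = 0 then \<infinity> else
     THE v. \<exists>a\<in>ring_of_integers - {0}. \<exists>b\<in>ring_of_integers - {0}. x = a / b \<and>
       v = ereal (real (ord_integer P a) - real (ord_integer P b)))"

text \<open>Residue field extensions are extensions of finite fields, hence separable; so being
  unramified means that all ramification indices are 1.\<close>

definition unramified_in :: "nat \<Rightarrow> 'k::field itself \<Rightarrow> bool" where
  "unramified_in p _ \<longleftrightarrow>
     (\<forall>P::'k set. finite_prime P \<and> of_nat p \<in> P \<longrightarrow> ord_at P (of_nat p) = 1)"

section \<open>Completion at a prime\<close>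

definition cauchy_seqs :: "'k::field set \<Rightarrow> (nat \<Rightarrow> 'k) set" where
  "cauchy_seqs P = {s. \<forall>N::nat. \<exists>M. \<forall>i\<ge>M. \<forall>j\<ge>M. ereal (real N) \<le> ord_at P (s i - s j)}"

definition cauchy_rec :: "'k::field set \<Rightarrow> (nat \<Rightarrow> 'k) ring" where
  "cauchy_rec P = \<lparr>carrier = cauchy_seqs P, mult = (\<lambda>s t i. s i * t i), one = (\<lambda>_. 1),
                    zero = (\<lambda>_. 0), add = (\<lambda>s t i. s i + t i)\<rparr>"

definition null_seqs :: "'k::field set \<Rightarrow> (nat \<Rightarrow> 'k) set" where
  "null_seqs P = {s. (\<lambda>i. ord_at P (s i)) \<longlonglongrightarrow> \<infinity>}"

definition completion :: "'k::field set \<Rightarrow> (nat \<Rightarrow> 'k) set ring" where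
  "completion P = cauchy_rec P Quot null_seqs P"

definition to_completion :: "'k::field set \<Rightarrow> 'k \<Rightarrow> (nat \<Rightarrow> 'k) set" where
  "to_completion P x = null_seqs P +>\<^bsub>cauchy_rec P\<^esub> (\<lambda>_. x)"

definition ord_completion :: "'k::field set \<Rightarrow> (nat \<Rightarrow> 'k) set \<Rightarrow> ereal" where
  "ord_completion P \<xi> = (THE v. \<forall>s\<in>\<xi>. (\<lambda>i. ord_at P (s i)) \<longlonglongrightarrow> v)"

definition completion_integers :: "'k::field set \<Rightarrow> (nat \<Rightarrow> 'k) set set" where
  "completion_integers P = {\<xi> \<in> carrier (completion P). 0 \<le> ord_completion P \<xi>}"

text \<open>The order of a fractional ideal of the completion; the zero ideal has order \<open>\<infinity>\<close>.\<close>

definition ord_ideal :: "'k::field set \<Rightarrow> (nat \<Rightarrow> 'k) set set \<Rightarrow> ereal" where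
  "ord_ideal P I = (INF \<xi>\<in>I. ord_completion P \<xi>)"

definition quadratic_defect :: "'k::field set \<Rightarrow> (nat \<Rightarrow> 'k) set \<Rightarrow> (nat \<Rightarrow> 'k) set set" where
  "quadratic_defect P c =
     (\<Inter>x\<in>carrier (completion P).
        {(c \<ominus>\<^bsub>completion P\<^esub> (x \<otimes>\<^bsub>completion P\<^esub> x)) \<otimes>\<^bsub>completion P\<^esub> y | y. y \<in> completion_integers P})"

definition relative_defect :: "'k::field set \<Rightarrow> (nat \<Rightarrow> 'k) set \<Rightarrow> ereal" where
  "relative_defect P c =
     ord_ideal P ((\<lambda>y. inv\<^bsub>completion P\<^esub> c \<otimes>\<^bsub>completion P\<^esub> y) ` quadratic_defect P c)"

section \<open>Quadratic spaces and lattices\<close>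

text \<open>
  A quadratic space of dimension \<^term>\<open>m\<close> over the field record \<^term>\<open>F\<close> is given in coordinates:
  it is the space of \<^term>\<open>m\<close>-tuples over \<^term>\<open>F\<close> (extensional functions on \<open>{..<m}\<close>) together with
  a symmetric Gram matrix, of which only the entries with indices below \<^term>\<open>m\<close> matter.
  Lattices are not assumed to be free. The ambient space of a lattice is the space it spans,
  so that the rank of the lattice is the dimension of the space. The ring components
  \<open>mult\<close> and \<open>one\<close> of a module record play no role.
\<close>

definition coord_space :: "'f ring \<Rightarrow> nat \<Rightarrow> ('f, nat \<Rightarrow> 'f) module" where
  "coord_space F m = \<lparr>carrier = {..<m} \<rightarrow>\<^sub>E carrier F, mult = undefined, one = undefined,
     zero = (\<lambda>i\<in>{..<m}. \<zero>\<^bsub>F\<^esub>), add = (\<lambda>x y. \<lambda>i\<in>{..<m}. x i \<oplus>\<^bsub>F\<^esub> y i),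
     module.smult = (\<lambda>c x. \<lambda>i\<in>{..<m}. c \<otimes>\<^bsub>F\<^esub> x i)\<rparr>"

definition lin_span :: "'f set \<Rightarrow> ('f, 'v) module \<Rightarrow> 'v set \<Rightarrow> 'v set" where
  "lin_span A V S = {\<Oplus>\<^bsub>V\<^esub>s\<in>T. c s \<odot>\<^bsub>V\<^esub> s | c T. finite T \<and> T \<subseteq> S \<and> c \<in> T \<rightarrow> A}"

definition gram_matrix :: "'f ring \<Rightarrow> nat \<Rightarrow> (nat \<Rightarrow> nat \<Rightarrow> 'f) \<Rightarrow> bool" where
  "gram_matrix F m G \<longleftrightarrow> (\<forall>i<m. \<forall>j<m. G i j \<in> carrier F \<and> G i j = G j i)"

definition bform ::
    "'f ring \<Rightarrow> nat \<Rightarrow> (nat \<Rightarrow> nat \<Rightarrow> 'f) \<Rightarrow> (nat \<Rightarrow> 'f) \<Rightarrow> (nat \<Rightarrow> 'f) \<Rightarrow> 'f" where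
  "bform F m G x y =
     (\<Oplus>\<^bsub>F\<^esub>i\<in>{..<m}. \<Oplus>\<^bsub>F\<^esub>j\<in>{..<m}. x i \<otimes>\<^bsub>F\<^esub> G i j \<otimes>\<^bsub>F\<^esub> y j)"

abbreviation qform :: "'f ring \<Rightarrow> nat \<Rightarrow> (nat \<Rightarrow> nat \<Rightarrow> 'f) \<Rightarrow> (nat \<Rightarrow> 'f) \<Rightarrow> 'f" where
  "qform F m G x \<equiv> bform F m G x x"

text \<open>Lattices over a subring \<^term>\<open>A\<close> of \<^term>\<open>F\<close>, of full rank in the space.\<close>

definition full_lattice :: "'f ring \<Rightarrow> 'f set \<Rightarrow> nat \<Rightarrow> (nat \<Rightarrow> 'f) set \<Rightarrow> bool" where
  "full_lattice F A m L \<longleftrightarrow>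
     (\<exists>S. finite S \<and> S \<subseteq> carrier (coord_space F m) \<and> L = lin_span A (coord_space F m) S) \<and>
     lin_span (carrier F) (coord_space F m) L = carrier (coord_space F m)"

text \<open>All values at nonzero vectors are positive reals under every embedding of the field into
  the complex numbers. For \<open>m > 0\<close> this forces the field to be totally real.\<close>

definition positive_definite :: "nat \<Rightarrow> (nat \<Rightarrow> nat \<Rightarrow> 'k::field_char_0) \<Rightarrow> bool" where
  "positive_definite m G \<longleftrightarrow>
     (\<forall>\<sigma>::'k \<Rightarrow> complex. \<sigma> \<in> ring_hom field_rec field_rec \<longrightarrow>
       (\<forall>x \<in> carrier (coord_space field_rec m) - {\<zero>\<^bsub>coord_space field_rec m\<^esub>}.
          \<sigma> (qform field_rec m G x) \<in> \<real> \<and> 0 < Re (\<sigma> (qform field_rec m G x))))"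

definition posdef_classic_lattice ::
    "nat \<Rightarrow> (nat \<Rightarrow> nat \<Rightarrow> 'k::field_char_0) \<Rightarrow> (nat \<Rightarrow> 'k) set \<Rightarrow> bool" where
  "posdef_classic_lattice m G L \<longleftrightarrow>
     gram_matrix field_rec m G \<and> positive_definite m G \<and>
     full_lattice field_rec ring_of_integers m L \<and>
     (\<forall>x\<in>L. \<forall>y\<in>L. bform field_rec m G x y \<in> ring_of_integers)"

definition represents ::
    "nat \<Rightarrow> (nat \<Rightarrow> nat \<Rightarrow> 'k::field) \<Rightarrow> (nat \<Rightarrow> 'k) set \<Rightarrow>
     nat \<Rightarrow> (nat \<Rightarrow> nat \<Rightarrow> 'k) \<Rightarrow> (nat \<Rightarrow> 'k) set \<Rightarrow> bool" where
  "represents m G L n H M \<longleftrightarrow>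
     (let V = coord_space field_rec n; W = coord_space field_rec m in
      \<exists>f \<in> carrier V \<rightarrow> carrier W.
        (\<forall>x\<in>carrier V. \<forall>y\<in>carrier V. f (x \<oplus>\<^bsub>V\<^esub> y) = f x \<oplus>\<^bsub>W\<^esub> f y) \<and>
        (\<forall>c. \<forall>x\<in>carrier V. f (c \<odot>\<^bsub>V\<^esub> x) = c \<odot>\<^bsub>W\<^esub> f x) \<and>
        (\<forall>x\<in>carrier V. \<forall>y\<in>carrier V.
           bform field_rec m G (f x) (f y) = bform field_rec n H x y) \<and>
        f ` M \<subseteq> L)"

definition n_universal ::
    "nat \<Rightarrow> nat \<Rightarrow> (nat \<Rightarrow> nat \<Rightarrow> 'k::field_char_0) \<Rightarrow> (nat \<Rightarrow> 'k) set \<Rightarrow> bool" where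
  "n_universal n m G L \<longleftrightarrow>
     (\<forall>H M. posdef_classic_lattice n H M \<longrightarrow> represents m G L n H M)"

definition local_gram ::
    "'k::field set \<Rightarrow> (nat \<Rightarrow> nat \<Rightarrow> 'k) \<Rightarrow> nat \<Rightarrow> nat \<Rightarrow> (nat \<Rightarrow> 'k) set" where
  "local_gram P G i j = to_completion P (G i j)"

text \<open>The completion of a lattice is the module it generates over the completed integers.\<close>

definition local_lattice ::
    "'k::field set \<Rightarrow> nat \<Rightarrow> (nat \<Rightarrow> 'k) set \<Rightarrow> (nat \<Rightarrow> (nat \<Rightarrow> 'k) set) set" where
  "local_lattice P m L = lin_span (completion_integers P) (coord_space (completion P) m)
     ((\<lambda>x. \<lambda>i\<in>{..<m}. to_completion P (x i)) ` L)"

section \<open>BONGs\<close>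

definition lattice_norm ::
    "'f ring \<Rightarrow> 'f set \<Rightarrow> nat \<Rightarrow> (nat \<Rightarrow> nat \<Rightarrow> 'f) \<Rightarrow> (nat \<Rightarrow> 'f) set \<Rightarrow> 'f set" where
  "lattice_norm F A m G L =
     {\<Oplus>\<^bsub>F\<^esub>q\<in>T. c q \<otimes>\<^bsub>F\<^esub> q | c T. finite T \<and> T \<subseteq> qform F m G ` L \<and> c \<in> T \<rightarrow> A}"

definition proj_orth ::
    "'f ring \<Rightarrow> nat \<Rightarrow> (nat \<Rightarrow> nat \<Rightarrow> 'f) \<Rightarrow> (nat \<Rightarrow> 'f) \<Rightarrow> (nat \<Rightarrow> 'f) \<Rightarrow> nat \<Rightarrow> 'f" where
  "proj_orth F m G x y = y \<ominus>\<^bsub>coord_space F m\<^esub>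
     (bform F m G y x \<otimes>\<^bsub>F\<^esub> inv\<^bsub>F\<^esub> (qform F m G x)) \<odot>\<^bsub>coord_space F m\<^esub> x"

text \<open>The recursion stops at the zero lattice. The condition that \<^term>\<open>x\<close> be anisotropic holds
  automatically when \<^term>\<open>L\<close> is a nonzero lattice in a nondegenerate space; it only excludes
  appending zero vectors once the zero lattice is reached.\<close>

primrec is_bong ::
    "'f ring \<Rightarrow> 'f set \<Rightarrow> nat \<Rightarrow> (nat \<Rightarrow> nat \<Rightarrow> 'f) \<Rightarrow> (nat \<Rightarrow> 'f) list \<Rightarrow>
     (nat \<Rightarrow> 'f) set \<Rightarrow> bool" where
  "is_bong F A m G [] L \<longleftrightarrow> L = {\<zero>\<^bsub>coord_space F m\<^esub>}"
| "is_bong F A m G (x # xs) L \<longleftrightarrow>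
     x \<in> L \<and> qform F m G x \<noteq> \<zero>\<^bsub>F\<^esub> \<and>
     {c \<otimes>\<^bsub>F\<^esub> qform F m G x | c. c \<in> A} = lattice_norm F A m G L \<and>
     is_bong F A m G xs (proj_orth F m G x ` L)"

definition has_bong_values ::
    "'f ring \<Rightarrow> 'f set \<Rightarrow> nat \<Rightarrow> (nat \<Rightarrow> nat \<Rightarrow> 'f) \<Rightarrow> (nat \<Rightarrow> 'f) set \<Rightarrow> 'f list \<Rightarrow> bool" where
  "has_bong_values F A m G L as \<longleftrightarrow>
     (\<exists>xs. is_bong F A m G xs L \<and> as = map (qform F m G) xs)"

end

(*
  Suppose that a dyadic prime P has ramification index e >= 2. As L is integral and represents 1,
  the first BONG value a_1 is a unit at P. The condition d(a_i a_{i+1}) > 1 says that a_i a_{i+1} is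
  a square up to relative precision P^2; by induction along the BONG all values Q(y) are congruent
  to a_1 t^2 modulo P^2, so no value has order 1. But an n-universal L represents the lattice
  <c,...,c> for c = p + 2N with ord_P p = 1 and N large enough to make c totally positive (K is
  totally real because L is positive definite), and ord_P c = 1. Hence 2 is unramified.

  Write O for the ring of integers. If the discriminant were even, some y in O - 2O would have
  Tr(yO) even. A multiple of y whose class generates a minimal ideal of O/2O is annihilated by a
  dyadic prime P; as 2 is unramified, it can be scaled to an e with e = 1 mod P and eP <= 2O. With
  k = O/P and T the sum of the Frobenius powers, z = sum over u in k* of u T(z/u) is a decomposition
  of the identity of k into rank one maps. It gives Tr(xe) = T(x) mod P, so T would vanish on k,
  contradicting this decomposition.
*)
theory Submission
  imports
    Defs
    "Jordan_Normal_Form.Char_Poly"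
    "HOL-Library.Z2"
begin

section \<open>Algebraic integers\<close>

text \<open>The local obstruction is one of parity: \<open>a_1 t^2\<close> has even order when a_1
  is a unit, and an error term in P^2 cannot turn it into a value of order 1. The precision P^2 is
  what the two inputs provide: d > 1 means at least 2 because orders are integers, and the cross
  term 2tsu that appears on completing squares along the BONG lies in P^2 when the ramification
  index is at least 2. For the discriminant, eP <= 2O means that multiplication by xe modulo 2
  factors through the residue field, so its trace can be computed there. Two finiteness facts carry
  the arithmetic. A subgroup of K that embeds additively into integer vectors has a finite basis;
  this yields integral bases, integrality of traces, and integrality of every g all of whose powers
  map one nonzero element into O. And O/2O is finite; this yields inverses modulo P, minimal ideals,
  and an element g outside O with gP <= O, from which a local generator of P and hence the order at
  P are built.\<close>

global_interpretation zmod: Modules.module "\<lambda>(n::int) (x::'k::field_char_0). of_int n * x"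
  defines zspan = zmod.span
  by unfold_locales (simp_all add: algebra_simps)

lemma zspan_finite:
  fixes S :: "'k::field_char_0 set"
  assumes "finite S" "x \<in> zspan S"
  obtains u where "x = (\<Sum>v\<in>S. of_int (u v) * v)"
  using zmod.span_finite[OF assms(1)] assms(2) by auto

lemma zspan_mult_right:
  assumes "a \<in> zspan A" "\<And>s. s \<in> A \<Longrightarrow> s * y \<in> zspan B"
  shows "a * y \<in> zspan (B :: 'k::field_char_0 set)"
  using assms(1)
proof (induction rule: zmod.span_induct_alt)
  case base
  show ?case by (simp add: zmod.span_zero)
next
  case (step c x y')
  have "(of_int c * x + y') * y = of_int c * (x * y) + y' * y"
    by (simp add: algebra_simps)
  with step assms(2)[of x] show ?case
    by (metis zmod.span_add zmod.span_scale)
qed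

text \<open>The determinant trick: multiplication by \<open>g\<close> acts on the generators through
  an integer matrix, and the vector of generators is an eigenvector for \<open>g\<close>. So
  \<open>g\<close> is a root of a characteristic polynomial, which is monic with integer
  coefficients. The generator \<open>s0\<close> keeps the eigenvector from being zero.\<close>

lemma algebraic_int_if_stable:
  fixes g :: "'k::field_char_0"
  assumes fin: "finite S" and s0: "s0 \<in> S" "s0 \<noteq> 0"
    and stable: "\<And>s. s \<in> S \<Longrightarrow> g * s \<in> zspan S"
  shows "algebraic_int g"
proof -
  define n where "n = card S"
  obtain f where f: "bij_betw f {..<n} S"
    using fin unfolding n_def by (metis bij_betw_from_nat_into_finite)
  have "\<forall>i. \<exists>c. i < n \<longrightarrow> g * f i = (\<Sum>j<n. of_int (c j) * f j)"
  proof
    fix i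
    show "\<exists>c. i < n \<longrightarrow> g * f i = (\<Sum>j<n. of_int (c j) * f j)"
    proof (cases "i < n")
      case True
      then have "f i \<in> S" using f by (auto simp: bij_betw_def)
      then obtain u where u: "g * f i = (\<Sum>v\<in>S. of_int (u v) * v)"
        using stable zspan_finite[OF fin] by metis
      also have "\<dots> = (\<Sum>j<n. of_int (u (f j)) * f j)"
        using sum.reindex_bij_betw[OF f, of "\<lambda>v. of_int (u v) * v"] by simp
      finally show ?thesis by (intro exI[of _ "\<lambda>j. u (f j)"]) simp
    qed simp
  qed
  then obtain c where c: "\<And>i. i < n \<Longrightarrow> g * f i = (\<Sum>j<n. of_int (c i j) * f j)"
    by metis
  define A where "A = mat n n (\<lambda>(i,j). c i j)"
  define A' :: "'k mat" where "A' = map_mat of_int A"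
  have A: "A \<in> carrier_mat n n" and A': "A' \<in> carrier_mat n n"
    by (auto simp: A_def A'_def)
  define v where "v = vec n f"
  have "eigenvector A' v g"
    unfolding eigenvector_def
  proof (intro conjI)
    show "v \<in> carrier_vec (dim_row A')" using A' by (simp add: v_def)
    obtain i where "i < n" "f i = s0" using f s0 by (auto simp: bij_betw_def)
    then show "v \<noteq> 0\<^sub>v (dim_row A')"
      using s0 A' by (auto simp: v_def dest!: arg_cong[of _ _ "\<lambda>v. Matrix.vec_index v i"])
    show "A' *\<^sub>v v = g \<cdot>\<^sub>v v"
      by (rule eq_vecI)
        (use A A' in \<open>auto simp: v_def A'_def A_def scalar_prod_def c atLeast0LessThan\<close>)
  qed
  then have "poly (char_poly A') g = 0"
    using eigenvalue_root_char_poly[OF A'] by (auto simp: eigenvalue_def)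
  moreover have "char_poly A' = map_poly of_int (char_poly A)"
    unfolding A'_def by (rule of_int_hom.char_poly_hom[OF A])
  moreover have "Polynomial.lead_coeff (char_poly A) = 1"
    using degree_monic_char_poly[OF A] by auto
  ultimately show ?thesis by (auto simp: algebraic_int_altdef_ipoly)
qed

section \<open>Closure of the algebraic integers under sums and products\<close>

lemma algebraic_int_power_zspan:
  fixes x :: "'k::field_char_0"
  assumes "algebraic_int x"
  obtains n where "0 < n" "x ^ n \<in> zspan ((^) x ` {..<n})"
proof -
  obtain p where p: "poly (map_poly of_int p) x = 0" "Polynomial.lead_coeff p = 1"
    using assms by (auto simp: algebraic_int_altdef_ipoly)
  define n where "n = Polynomial.degree p"
  have "n \<noteq> 0"
  proof
    assume "n = 0"
    then obtain a where "p = [:a:]" using n_def by (metis degree_eq_zeroE)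
    with p show False by simp
  qed
  have "0 = (\<Sum>i\<le>n. of_int (poly.coeff p i) * x ^ i)"
    using p by (simp add: poly_altdef n_def)
  also have "\<dots> = (\<Sum>i<n. of_int (poly.coeff p i) * x ^ i) + x ^ n"
    using p by (simp add: n_def flip: lessThan_Suc_atMost)
  finally have "x ^ n = - (\<Sum>i<n. of_int (poly.coeff p i) * x ^ i)"
    by (simp add: eq_neg_iff_add_eq_0 add.commute)
  also have "\<dots> \<in> zspan ((^) x ` {..<n})"
    by (intro zmod.span_neg zmod.span_sum zmod.span_scale zmod.span_base) auto
  finally show ?thesis using that \<open>n \<noteq> 0\<close> by auto
qed

lemma power_mult_zspan:
  fixes x :: "'k::field_char_0"
  assumes "x ^ n \<in> zspan ((^) x ` {..<n})" "s \<in> (^) x ` {..<n}"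
  shows "x * s \<in> zspan ((^) x ` {..<n})"
proof -
  from assms(2) obtain i where i: "i < n" "s = x ^ i" by auto
  show ?thesis
  proof (cases "Suc i = n")
    case True
    then show ?thesis using assms(1) i by auto
  next
    case False
    then have "x * s = x ^ Suc i" "Suc i < n" using i by auto
    then show ?thesis by (metis image_eqI lessThan_iff zmod.span_base)
  qed
qed

text \<open>The products of powers of \<open>x\<close> and \<open>y\<close> below the respective
  degrees span a group stable under both elements, hence under their sum and product. Both closure
  properties thus reduce to the determinant trick, with 1 as the nonzero generator.\<close>

lemma algebraic_int_common_module:
  fixes x y :: "'k::field_char_0"
  assumes "algebraic_int x" "algebraic_int y"
  obtains S where "finite S" "1 \<in> S" "\<And>s. s \<in> S \<Longrightarrow> x * s \<in> zspan S" "\<And>s. s \<in> S \<Longrightarrow> y * s \<in> zspan S"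
proof -
  obtain n where n: "0 < n" "x ^ n \<in> zspan ((^) x ` {..<n})"
    using algebraic_int_power_zspan[OF assms(1)] .
  obtain m where m: "0 < m" "y ^ m \<in> zspan ((^) y ` {..<m})"
    using algebraic_int_power_zspan[OF assms(2)] .
  define A where "A = (^) x ` {..<n}"
  define B where "B = (^) y ` {..<m}"
  define S where "S = {a * b | a b. a \<in> A \<and> b \<in> B}"
  show thesis
  proof
    show "finite S" unfolding S_def by (rule finite_image_set2) (simp_all add: A_def B_def)
    have "1 \<in> A" "1 \<in> B" unfolding A_def B_def using n m by (auto intro!: image_eqI[of _ _ 0])
    then show "1 \<in> S" unfolding S_def by (intro CollectI exI[of _ 1]) simp
    fix s assume "s \<in> S"
    then obtain a b where ab: "a \<in> A" "b \<in> B" "s = a * b" by (auto simp: S_def)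
    have base: "a * b \<in> zspan S" if "a \<in> A" "b \<in> B" for a b
      using that by (auto intro!: zmod.span_base simp: S_def)
    have "x * a * b \<in> zspan S"
      by (rule zspan_mult_right[of _ A]) (use power_mult_zspan[OF n(2)] ab base in \<open>auto simp: A_def\<close>)
    then show "x * s \<in> zspan S" using ab by (simp add: mult.assoc)
    have "y * b * a \<in> zspan S"
      by (rule zspan_mult_right[of _ B])
        (use power_mult_zspan[OF m(2)] ab base[OF ab(1)] in \<open>auto simp: B_def mult.commute\<close>)
    then show "y * s \<in> zspan S" using ab by (simp add: mult_ac)
  qed
qed

lemma algebraic_int_add [intro]:
  fixes x y :: "'k::field_char_0"
  assumes "algebraic_int x" "algebraic_int y"
  shows "algebraic_int (x + y)"
proof -
  obtain S where S: "finite S" "1 \<in> S" "\<And>s. s \<in> S \<Longrightarrow> x * s \<in> zspan S" "\<And>s. s \<in> S \<Longrightarrow> y * s \<in> zspan S"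
    using algebraic_int_common_module[OF assms] by blast
  show ?thesis
    by (rule algebraic_int_if_stable[of S 1]) (use S in \<open>auto simp: distrib_right intro: zmod.span_add\<close>)
qed

lemma algebraic_int_mult [intro]:
  fixes x y :: "'k::field_char_0"
  assumes "algebraic_int x" "algebraic_int y"
  shows "algebraic_int (x * y)"
proof -
  obtain S where S: "finite S" "1 \<in> S" "\<And>s. s \<in> S \<Longrightarrow> x * s \<in> zspan S" "\<And>s. s \<in> S \<Longrightarrow> y * s \<in> zspan S"
    using algebraic_int_common_module[OF assms] by blast
  show ?thesis
  proof (rule algebraic_int_if_stable[of S 1])
    fix s assume "s \<in> S"
    have "(y * s) * x \<in> zspan S"
      by (rule zspan_mult_right[OF S(4)]) (use S \<open>s \<in> S\<close> in \<open>auto simp: mult.commute\<close>)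
    then show "x * y * s \<in> zspan S" by (simp add: mult_ac)
  qed (use S in auto)
qed

lemma algebraic_int_diff [intro]:
  fixes x y :: "'k::field_char_0"
  shows "algebraic_int x \<Longrightarrow> algebraic_int y \<Longrightarrow> algebraic_int (x - y)"
  using algebraic_int_add[of x "- y"] by auto

lemma algebraic_int_power [intro]:
  "algebraic_int x \<Longrightarrow> algebraic_int (x ^ n :: 'k::field_char_0)"
  by (induction n) auto

lemma algebraic_int_sum [intro]:
  "(\<And>i. i \<in> I \<Longrightarrow> algebraic_int (f i)) \<Longrightarrow> algebraic_int (\<Sum>i\<in>I. f i :: 'k::field_char_0)"
  by (induction I rule: infinite_finite_induct) auto

section \<open>Free subgroups\<close>

text \<open>Bases are index functions, so that a basis is extended by a function update; only the
  values at indices below \<open>n\<close> enter.\<close>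

definition zfree :: "'k::field_char_0 set \<Rightarrow> nat \<Rightarrow> (nat \<Rightarrow> 'k) \<Rightarrow> bool" where
  "zfree \<Gamma> n w \<longleftrightarrow>
     (\<forall>c::nat \<Rightarrow> int. (\<Sum>i<n. of_int (c i) * w i) = 0 \<longrightarrow> (\<forall>i<n. c i = 0)) \<and>
     \<Gamma> = {\<Sum>i<n. of_int (c i) * w i | c::nat \<Rightarrow> int. True}"

text \<open>Division with remainder by the least positive element. The trivial subgroup gives
  \<open>g = 0\<close>, a case that the extension of bases below treats separately.\<close>

lemma int_subgroup_cyclic:
  fixes I :: "int set"
  assumes "0 \<in> I" "\<And>x y. x \<in> I \<Longrightarrow> y \<in> I \<Longrightarrow> x - y \<in> I"
  obtains g where "g \<in> I" "\<And>x. x \<in> I \<Longrightarrow> g dvd x"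
proof (cases "I = {0}")
  case True
  then show ?thesis using that[of 0] by auto
next
  case False
  have neg: "- x \<in> I" if "x \<in> I" for x using assms(2)[OF assms(1) that] by simp
  have add: "x + y \<in> I" if "x \<in> I" "y \<in> I" for x y
    using assms(2)[OF that(1) neg[OF that(2)]] by simp
  have mult: "of_nat k * x \<in> I" if "x \<in> I" for x k
    by (induction k) (simp_all add: assms(1) add that distrib_right)
  have multi: "k * x \<in> I" if "x \<in> I" for x k
  proof (cases k)
    case (nonneg n)
    then show ?thesis using mult[OF that, of n] by simp
  next
    case (neg n)
    have "- (of_nat (Suc n) * x) \<in> I"
      using \<open>\<And>x. x \<in> I \<Longrightarrow> - x \<in> I\<close>[OF mult[OF that]] .
    then show ?thesis unfolding neg by (simp add: algebra_simps)
  qed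
  have ex: "\<exists>n::nat. 0 < n \<and> int n \<in> I"
  proof -
    obtain x where x: "x \<in> I" "x \<noteq> 0" using False assms(1) by auto
    then have "\<bar>x\<bar> \<in> I" using neg by (auto simp: abs_if)
    then show ?thesis using x by (intro exI[of _ "nat \<bar>x\<bar>"]) auto
  qed
  define g where "g = (LEAST n::nat. 0 < n \<and> int n \<in> I)"
  have g: "0 < g" "int g \<in> I" using LeastI_ex[OF ex] by (auto simp: g_def)
  have "int g dvd x" if x: "x \<in> I" for x
  proof (rule ccontr)
    assume "\<not> int g dvd x"
    then have pos: "0 < x mod int g" using g pos_mod_sign[of "int g" x]
      by (metis dvd_eq_mod_eq_0 of_nat_0_less_iff order_less_le)
    have "x mod int g \<in> I"
      using assms(2)[OF x multi[OF g(2), of "x div int g"]] by (simp add: minus_div_mult_eq_mod)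
    then have "g \<le> nat (x mod int g)"
      using Least_le[of "\<lambda>n. 0 < n \<and> int n \<in> I" "nat (x mod int g)"] pos
      unfolding g_def[symmetric] by simp
    then have "int g \<le> x mod int g" using pos by (simp only: le_nat_iff)
    moreover have "x mod int g < int g" by (rule pos_mod_bound) (use g in simp)
    ultimately show False by (rule leD[THEN notE])
  qed
  then show ?thesis using that g by blast
qed

text \<open>Induction on the number of coordinates. The kernel of the last coordinate embeds by the
  remaining ones, the image of the last coordinate is generated by some \<open>g\<close>, and a
  preimage \<open>u\<close> of \<open>g\<close> completes a basis of the kernel. Additivity is
  demanded on \<Gamma> only, so that rounded rational functionals that are integral on \<Gamma> can
  serve as coordinates.\<close>

lemma zfree_of_additive_embedding:
  fixes \<Gamma> :: "'k::field_char_0 set" and \<phi> :: "nat \<Rightarrow> 'k \<Rightarrow> int"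
  assumes "0 \<in> \<Gamma>" "\<And>x y. x \<in> \<Gamma> \<Longrightarrow> y \<in> \<Gamma> \<Longrightarrow> x - y \<in> \<Gamma>"
    and "\<And>j x y. j < d \<Longrightarrow> x \<in> \<Gamma> \<Longrightarrow> y \<in> \<Gamma> \<Longrightarrow> \<phi> j (x - y) = \<phi> j x - \<phi> j y"
    and "\<And>x. x \<in> \<Gamma> \<Longrightarrow> (\<And>j. j < d \<Longrightarrow> \<phi> j x = 0) \<Longrightarrow> x = 0"
  shows "\<exists>n w. zfree \<Gamma> n w"
  using assms
proof (induction d arbitrary: \<Gamma>)
  case 0
  then have "\<Gamma> = {0}" by auto
  then have "zfree \<Gamma> 0 (\<lambda>_. 0)" by (auto simp: zfree_def)
  then show ?case by blast
next
  case (Suc d)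
  have phi0: "\<phi> j 0 = 0" if "j < Suc d" for j
    using Suc.prems(3)[OF that Suc.prems(1,1)] by simp
  have neg: "- x \<in> \<Gamma>" if "x \<in> \<Gamma>" for x using Suc.prems(2)[OF Suc.prems(1) that] by simp
  have add: "x + y \<in> \<Gamma>" if "x \<in> \<Gamma>" "y \<in> \<Gamma>" for x y
    using Suc.prems(2)[OF that(1) neg[OF that(2)]] by simp
  have phineg: "\<phi> j (- x) = - \<phi> j x" if "j < Suc d" "x \<in> \<Gamma>" for x j
    using Suc.prems(3)[OF that(1) Suc.prems(1) that(2)] phi0[OF that(1)] by simp
  have phiadd: "\<phi> j (x + y) = \<phi> j x + \<phi> j y" if "j < Suc d" "x \<in> \<Gamma>" "y \<in> \<Gamma>" for x y j
    using Suc.prems(3)[OF that(1,2) neg[OF that(3)]] phineg[OF that(1,3)] by simp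
  have nmult: "of_nat k * x \<in> \<Gamma> \<and> (\<forall>j<Suc d. \<phi> j (of_nat k * x) = int k * \<phi> j x)" if "x \<in> \<Gamma>" for x k
    by (induction k) (simp_all add: Suc.prems(1) phi0 phiadd that add distrib_right)
  have imult: "of_int k * x \<in> \<Gamma> \<and> (\<forall>j<Suc d. \<phi> j (of_int k * x) = k * \<phi> j x)" if "x \<in> \<Gamma>" for x k
  proof (cases k)
    case (nonneg n)
    then show ?thesis using nmult[OF that, of n] by simp
  next
    case (neg n)
    have "- (of_nat (Suc n) * x) \<in> \<Gamma>"
      "\<forall>j<Suc d. \<phi> j (- (of_nat (Suc n) * x)) = - (int (Suc n) * \<phi> j x)"
      using nmult[OF that, of "Suc n"] \<open>\<And>x. x \<in> \<Gamma> \<Longrightarrow> - x \<in> \<Gamma>\<close> phineg by auto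
    then show ?thesis unfolding neg by (simp add: algebra_simps)
  qed
  define \<Gamma>' where "\<Gamma>' = {x \<in> \<Gamma>. \<phi> d x = 0}"
  have "\<exists>n w. zfree \<Gamma>' n w"
  proof (rule Suc.IH)
    fix x assume x: "x \<in> \<Gamma>'" and z: "\<And>j. j < d \<Longrightarrow> \<phi> j x = 0"
    show "x = 0"
    proof (rule Suc.prems(4))
      fix j assume "j < Suc d"
      then show "\<phi> j x = 0" using x z by (cases "j = d") (auto simp: \<Gamma>'_def)
    qed (use x in \<open>simp add: \<Gamma>'_def\<close>)
  qed (use Suc.prems phi0 in \<open>auto simp: \<Gamma>'_def\<close>)
  then obtain n w where w: "zfree \<Gamma>' n w" by blast
  obtain g where g: "g \<in> \<phi> d ` \<Gamma>" "\<And>x. x \<in> \<phi> d ` \<Gamma> \<Longrightarrow> g dvd x"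
  proof (rule int_subgroup_cyclic[of "\<phi> d ` \<Gamma>"])
    show "0 \<in> \<phi> d ` \<Gamma>" using Suc.prems(1) phi0[of d] by (auto intro!: image_eqI[of _ _ 0])
    show "x - y \<in> \<phi> d ` \<Gamma>" if xy: "x \<in> \<phi> d ` \<Gamma>" "y \<in> \<phi> d ` \<Gamma>" for x y
    proof -
      obtain a b where ab: "a \<in> \<Gamma>" "b \<in> \<Gamma>" "x = \<phi> d a" "y = \<phi> d b" using xy by blast
      then have "x - y = \<phi> d (a - b)" using Suc.prems(3)[of d a b] by simp
      then show ?thesis using Suc.prems(2)[OF ab(1,2)] by blast
    qed
  qed auto
  show ?case
  proof (cases "g = 0")
    case True
    then have "\<Gamma>' = \<Gamma>" using g by (auto simp: \<Gamma>'_def)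
    then show ?thesis using w by blast
  next
    case False
    obtain u where u: "u \<in> \<Gamma>" "\<phi> d u = g" using g(1) by auto
    define w' where "w' = w(n := u)"
    have sumw: "(\<Sum>i<Suc n. of_int (c i) * w' i) = (\<Sum>i<n. of_int (c i) * w i) + of_int (c n) * u" for c :: "nat \<Rightarrow> int"
      by (simp add: w'_def)
    have in': "(\<Sum>i<n. of_int (c i) * w i) \<in> \<Gamma>'" for c
      using w unfolding zfree_def by blast
    have phis: "\<phi> d (\<Sum>i<Suc n. of_int (c i) * w' i) = c n * g" 
         and ins: "(\<Sum>i<Suc n. of_int (c i) * w' i) \<in> \<Gamma>" for c
      using in'[of c] imult[OF u(1), of "c n"] u phiadd[of d] add unfolding sumw \<Gamma>'_def by auto
    have "zfree \<Gamma> (Suc n) w'"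
      unfolding zfree_def
    proof (intro conjI allI impI)
      fix c :: "nat \<Rightarrow> int" and i
      assume 0: "(\<Sum>i<Suc n. of_int (c i) * w' i) = 0" and i: "i < Suc n"
      have "c n * g = 0" using phis[of c] 0 phi0[of d] by simp
      then have "c n = 0" using False by simp
      moreover from this have "(\<Sum>i<n. of_int (c i) * w i) = 0" using 0 unfolding sumw by simp
      then have "\<forall>i<n. c i = 0" using w unfolding zfree_def by blast
      ultimately show "c i = 0" using i by (cases "i = n") auto
    next
      show "\<Gamma> = {\<Sum>i<Suc n. of_int (c i) * w' i | c::nat \<Rightarrow> int. True}"
      proof (intro equalityI subsetI)
        fix x assume x: "x \<in> \<Gamma>"
        then obtain k where k: "\<phi> d x = g * k" using g(2)[of "\<phi> d x"] by (auto elim: dvdE)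
        have "x - of_int k * u \<in> \<Gamma>'"
          using Suc.prems(2)[OF x] Suc.prems(3)[of d x] imult[OF u(1), of k] k u x
          by (auto simp: \<Gamma>'_def)
        then obtain c where c: "x - of_int k * u = (\<Sum>i<n. of_int (c i) * w i)"
          using w unfolding zfree_def by blast
        have "x = (\<Sum>i<Suc n. of_int ((c(n := k)) i) * w' i)"
          using c unfolding sumw by (simp add: algebra_simps)
        then show "x \<in> {\<Sum>i<Suc n. of_int (c i) * w' i | c::nat \<Rightarrow> int. True}" by blast
      qed (use ins in auto)
    qed
    then show ?thesis by blast
  qed
qed

section \<open>Traces and integral bases\<close>

text \<open>The \<kappa> are the coordinate functionals of the rational basis \<open>w\<close>;
  duality is meant in this sense and not for the trace form. In these terms the trace of
  multiplication by \<open>x\<close> is the sum of the \<open>\<kappa> i (x * w i)\<close>.\<close>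

definition dual_basis :: "nat \<Rightarrow> (nat \<Rightarrow> 'k::field_char_0) \<Rightarrow> (nat \<Rightarrow> 'k \<Rightarrow> rat) \<Rightarrow> bool" where
  "dual_basis n w \<kappa> \<longleftrightarrow>
     (\<forall>i<n. (\<forall>x y. \<kappa> i (x + y) = \<kappa> i x + \<kappa> i y) \<and> (\<forall>q x. \<kappa> i (of_rat q * x) = q * \<kappa> i x)) \<and>
     (\<forall>x. x = (\<Sum>i<n. of_rat (\<kappa> i x) * w i)) \<and>
     (\<forall>i<n. \<forall>j<n. \<kappa> i (w j) = of_bool (i = j))"

lemma dual_basis_add: "dual_basis n w \<kappa> \<Longrightarrow> i < n \<Longrightarrow> \<kappa> i (x + y) = \<kappa> i x + \<kappa> i y"
  and dual_basis_scale: "dual_basis n w \<kappa> \<Longrightarrow> i < n \<Longrightarrow> \<kappa> i (of_rat q * x) = q * \<kappa> i x"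
  and dual_basis_expand: "dual_basis n w \<kappa> \<Longrightarrow> x = (\<Sum>i<n. of_rat (\<kappa> i x) * w i)"
  and dual_basis_delta: "dual_basis n w \<kappa> \<Longrightarrow> i < n \<Longrightarrow> j < n \<Longrightarrow> \<kappa> i (w j) = of_bool (i = j)"
  by (auto simp: dual_basis_def)

lemma dual_basis_zero: "dual_basis n w \<kappa> \<Longrightarrow> i < n \<Longrightarrow> \<kappa> i 0 = 0"
  using dual_basis_scale[of n w \<kappa> i 0 0] by simp

lemma dual_basis_sum:
  assumes "dual_basis n w \<kappa>" "i < n"
  shows "\<kappa> i (\<Sum>j\<in>J. f j) = (\<Sum>j\<in>J. \<kappa> i (f j))"
  by (induction J rule: infinite_finite_induct)
    (simp_all add: dual_basis_zero[OF assms] dual_basis_add[OF assms])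

lemma dual_basis_int_scale:
  assumes "dual_basis n w \<kappa>" "i < n"
  shows "\<kappa> i (of_int c * x) = of_int c * \<kappa> i x"
  using dual_basis_scale[OF assms, of "of_int c" x] by simp

lemma dual_basis_diff:
  assumes "dual_basis n w \<kappa>" "i < n"
  shows "\<kappa> i (x - y) = \<kappa> i x - \<kappa> i y"
  using dual_basis_add[OF assms, of "x - y" y] by simp

text \<open>This is tr(AB) = tr(BA) for the matrices with entries
  \<open>\<kappa>' j (x * w i)\<close> and \<open>\<kappa> i (w' j)\<close>: expanding each side in
  the other basis leads to the same double sum.\<close>

lemma dual_basis_trace_indep:
  assumes 1: "dual_basis n w \<kappa>" and 2: "dual_basis n' w' \<kappa>'"
  shows "(\<Sum>i<n. \<kappa> i (x * w i)) = (\<Sum>i<n'. \<kappa>' i (x * w' i))"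
proof -
  have "(\<Sum>i<n. \<kappa> i (x * w i)) = (\<Sum>i<n. \<Sum>j<n'. \<kappa>' j (x * w i) * \<kappa> i (w' j))"
  proof (rule sum.cong[OF refl])
    fix i assume "i \<in> {..<n}"
    then have i: "i < n" by simp
    have "\<kappa> i (x * w i) = \<kappa> i (\<Sum>j<n'. of_rat (\<kappa>' j (x * w i)) * w' j)"
      using dual_basis_expand[OF 2, of "x * w i"] by simp
    then show "\<kappa> i (x * w i) = (\<Sum>j<n'. \<kappa>' j (x * w i) * \<kappa> i (w' j))"
      by (simp add: dual_basis_sum[OF 1 i] dual_basis_scale[OF 1 i])
  qed
  also have "\<dots> = (\<Sum>j<n'. \<Sum>i<n. \<kappa>' j (x * w i) * \<kappa> i (w' j))"
    by (rule sum.swap)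
  also have "\<dots> = (\<Sum>j<n'. \<kappa>' j (x * w' j))"
  proof (rule sum.cong[OF refl])
    fix j assume "j \<in> {..<n'}"
    then have j: "j < n'" by simp
    have "x * w' j = x * (\<Sum>i<n. of_rat (\<kappa> i (w' j)) * w i)"
      using dual_basis_expand[OF 1, of "w' j"] by simp
    also have "\<dots> = (\<Sum>i<n. of_rat (\<kappa> i (w' j)) * (x * w i))"
      by (simp add: sum_distrib_left mult_ac)
    finally have "\<kappa>' j (x * w' j) = (\<Sum>i<n. \<kappa> i (w' j) * \<kappa>' j (x * w i))"
      by (simp add: dual_basis_sum[OF 2 j] dual_basis_scale[OF 2 j])
    then show "(\<Sum>i<n. \<kappa>' j (x * w i) * \<kappa> i (w' j)) = \<kappa>' j (x * w' j)"
      by (simp add: mult.commute)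
  qed
  finally show ?thesis .
qed

lemma dual_basis_of_vector_space:
  fixes B :: "'k::field_char_0 set"
  assumes "finite_dimensional_vector_space rat_scale B"
  shows "\<exists>n w \<kappa>. dual_basis n w \<kappa> \<and>
    (\<forall>x. (\<Sum>b\<in>B. module.representation rat_scale B (x * b) b) = (\<Sum>i<n. \<kappa> i (x * w i)))"
proof -
  interpret V: finite_dimensional_vector_space rat_scale B by fact
  obtain w where w: "bij_betw w {..<card B} B"
    using V.finite_Basis by (metis bij_betw_from_nat_into_finite)
  define \<kappa> where "\<kappa> i x = V.representation B x (w i)" for i x
  have "dual_basis (card B) w \<kappa>"
    unfolding dual_basis_def
  proof (intro conjI allI impI)
    fix i x y q
    show "\<kappa> i (x + y) = \<kappa> i x + \<kappa> i y"
      using V.representation_add[OF V.independent_Basis] by (simp add: \<kappa>_def V.span_Basis)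
    show "\<kappa> i (of_rat q * x) = q * \<kappa> i x"
      using V.representation_scale[OF V.independent_Basis] by (simp add: \<kappa>_def V.span_Basis)
    show "x = (\<Sum>i<card B. of_rat (\<kappa> i x) * w i)"
      using V.sum_representation_eq[OF V.independent_Basis, of x B]
        sum.reindex_bij_betw[OF w, of "\<lambda>b. of_rat (V.representation B x b) * b"]
      by (simp add: \<kappa>_def V.span_Basis V.finite_Basis)
    fix j assume "i < card B" "j < card B"
    then show "\<kappa> i (w j) = of_bool (i = j)"
      using w unfolding \<kappa>_def bij_betw_def inj_on_def
      by (subst V.representation_basis[OF V.independent_Basis]) auto
  qed
  moreover have "(\<Sum>b\<in>B. V.representation B (x * b) b) = (\<Sum>i<card B. \<kappa> i (x * w i))" for x
    using sum.reindex_bij_betw[OF w, of "\<lambda>b. V.representation B (x * b) b"] by (simp add: \<kappa>_def)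
  ultimately show ?thesis by blast
qed

text \<open>The basis picked by the choice operator in \<open>field_trace\<close> can be exchanged
  for any other, in particular for one adapted to a given lattice.\<close>

lemma field_trace_eq:
  fixes w :: "nat \<Rightarrow> 'k::field_char_0"
  assumes "number_field TYPE('k)" "dual_basis n w \<kappa>"
  shows "field_trace x = (\<Sum>i<n. \<kappa> i (x * w i))"
proof -
  define B where "B = (SOME B::'k set. finite_dimensional_vector_space rat_scale B)"
  have "finite_dimensional_vector_space rat_scale B"
    using assms(1) unfolding number_field_def B_def by (rule someI_ex)
  from dual_basis_of_vector_space[OF this] obtain n' w' \<kappa>' where
    "dual_basis n' w' \<kappa>'"
    "(\<Sum>b\<in>B. module.representation rat_scale B (x * b) b) = (\<Sum>i<n'. \<kappa>' i (x * w' i))"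
    by blast
  then show ?thesis
    using dual_basis_trace_indep[OF assms(2)] by (simp add: field_trace_def flip: B_def)
qed

lemma number_field_dual_basis:
  assumes "number_field TYPE('k::field_char_0)"
  obtains n and w :: "nat \<Rightarrow> 'k::field_char_0" and \<kappa> where "dual_basis n w \<kappa>"
  using assms dual_basis_of_vector_space unfolding number_field_def by metis

lemma
  assumes nf: "number_field TYPE('k::field_char_0)"
  shows field_trace_add: "field_trace (x + y :: 'k) = field_trace x + field_trace y"
    and field_trace_rat: "field_trace (of_rat q * x :: 'k) = q * field_trace x"
proof -
  obtain n and w :: "nat \<Rightarrow> 'k" and \<kappa> where d: "dual_basis n w \<kappa>"
    using number_field_dual_basis[OF nf] by blast
  show "field_trace (x + y) = field_trace x + field_trace y"
    unfolding field_trace_eq[OF nf d]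
    by (simp add: distrib_right dual_basis_add[OF d] sum.distrib)
  show "field_trace (of_rat q * x) = q * field_trace x"
    unfolding field_trace_eq[OF nf d]
    by (simp add: mult.assoc dual_basis_scale[OF d] sum_distrib_left)
qed

lemma field_trace_int:
  assumes nf: "number_field TYPE('k::field_char_0)"
  shows "field_trace (of_int c * x :: 'k) = of_int c * field_trace x"
  using field_trace_rat[OF nf, of "of_int c"] by simp

lemma field_trace_sum:
  assumes nf: "number_field TYPE('k::field_char_0)"
  shows "field_trace (\<Sum>j\<in>J. f j :: 'k) = (\<Sum>j\<in>J. field_trace (f j))"
proof -
  have "field_trace (0::'k) = 0" using field_trace_rat[OF nf, of 0 0] by simp
  then show ?thesis
    by (induction J rule: infinite_finite_induct) (simp_all add: field_trace_add[OF nf])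
qed

text \<open>The degree of the field as a trace. Being nonzero, it makes the trace form
  nondegenerate; depending on the field alone, it forces all integral bases to have the same
  length.\<close>

lemma field_trace_one:
  assumes nf: "number_field TYPE('k::field_char_0)" and d: "dual_basis n (w :: nat \<Rightarrow> 'k) \<kappa>"
  shows "field_trace (1::'k) = of_nat n"
  unfolding field_trace_eq[OF nf d] by (simp add: dual_basis_delta[OF d])

lemma dual_basis_pos:
  assumes "dual_basis n (w :: nat \<Rightarrow> 'k::field_char_0) \<kappa>"
  shows "0 < n"
  using dual_basis_expand[OF assms, of 1] by (cases n) auto

section \<open>Denominators and integral coordinates\<close>

lemma floor_Ints: "q \<in> \<int> \<Longrightarrow> of_int \<lfloor>q :: rat\<rfloor> = q"
  by (auto elim: Ints_cases)

lemma floor_diff_Ints: "p \<in> \<int> \<Longrightarrow> q \<in> \<int> \<Longrightarrow> \<lfloor>p - q :: rat\<rfloor> = \<lfloor>p\<rfloor> - \<lfloor>q\<rfloor>"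
  by (auto elim: Ints_cases)

lemma common_denominator:
  fixes q :: "'i \<Rightarrow> rat"
  assumes "finite I"
  shows "\<exists>N::int. N \<noteq> 0 \<and> (\<forall>i\<in>I. of_int N * q i \<in> \<int>)"
  using assms
proof induction
  case empty
  show ?case by (intro exI[of _ 1]) simp
next
  case (insert i I)
  then obtain N where N: "N \<noteq> 0" "\<forall>i\<in>I. of_int N * q i \<in> \<int>" by blast
  obtain a b where "quotient_of (q i) = (a, b)" by (cases "quotient_of (q i)")
  then have ab: "q i = of_int a / of_int b" "b > 0"
    using quotient_of_div quotient_of_denom_pos by auto
  have "of_int (N * b) * q i = of_int (N * a)" using ab by simp
  moreover have "of_int (N * b) * q j \<in> \<int>" if "j \<in> I" for j
  proof -
    have "of_int (N * b) * q j = of_int b * (of_int N * q j)" by simp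
    also have "\<dots> \<in> \<int>" by (rule Ints_mult[OF Ints_of_int]) (rule N(2)[rule_format, OF that])
    finally show ?thesis .
  qed
  ultimately have "\<forall>j\<in>insert i I. of_int (N * b) * q j \<in> \<int>" by (auto simp del: of_int_mult)
  then show ?case using N ab by (intro exI[of _ "N * b"]) auto
qed

lemma zfree_iff: "zfree \<Gamma> n w \<Longrightarrow> x \<in> \<Gamma> \<longleftrightarrow> (\<exists>c::nat \<Rightarrow> int. x = (\<Sum>i<n. of_int (c i) * w i))"
  by (auto simp: zfree_def)

lemma zfree_indep: "zfree \<Gamma> n w \<Longrightarrow> (\<Sum>i<n. of_int (c i) * w i) = 0 \<Longrightarrow> i < n \<Longrightarrow> c i = 0"
  by (auto simp: zfree_def)

lemma zfree_generator:
  assumes "zfree \<Gamma> n w" "i < n"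
  shows "w i \<in> \<Gamma>"
proof -
  have "w i = (\<Sum>j<n. of_int (of_bool (j = i)) * w j)"
    using assms(2) by (simp add: of_bool_def if_distrib[of "\<lambda>b. of_int b * _"] cong: if_cong)
  then show ?thesis unfolding zfree_iff[OF assms(1)] by (rule exI[of _ "\<lambda>j. of_bool (j = i)"])
qed

text \<open>Clearing denominators turns a rational relation into an integral one, so independence
  over the integers gives independence over the rationals, and \<open>full\<close> gives spanning.
  An element of \<Gamma> has an integral expansion, which by uniqueness is also its rational
  one.\<close>

lemma zfree_dual_basis:
  fixes w :: "nat \<Rightarrow> 'k::field_char_0"
  assumes free: "zfree \<Gamma> n w" and full: "\<And>x. \<exists>N::int. N \<noteq> 0 \<and> of_int N * x \<in> \<Gamma>"
  shows "\<exists>\<kappa>. dual_basis n w \<kappa> \<and> (\<forall>x\<in>\<Gamma>. \<forall>i<n. \<kappa> i x \<in> \<int>)"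
proof -
  have indep: "\<forall>i<n. q i = 0" if "(\<Sum>i<n. of_rat (q i) * w i) = 0" for q
  proof -
    obtain N :: int where N: "N \<noteq> 0" "\<forall>i\<in>{..<n}. of_int N * q i \<in> \<int>"
      using common_denominator[of "{..<n}" q] by auto
    define c where "c i = \<lfloor>of_int N * q i\<rfloor>" for i
    have c: "of_int N * q i = of_int (c i)" if "i < n" for i
      using N(2) that unfolding c_def by (simp add: floor_Ints)
    have "(\<Sum>i<n. of_int (c i) * w i) = (\<Sum>i<n. of_rat (of_int N * q i) * w i)"
      by (simp add: c)
    also have "\<dots> = of_int N * (\<Sum>i<n. of_rat (q i) * w i)"
      by (simp add: sum_distrib_left of_rat_mult mult.assoc)
    finally have "(\<Sum>i<n. of_int (c i) * w i) = 0" using that by simp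
    then have "\<forall>i<n. c i = 0" using zfree_indep[OF free, of c] by blast
    then show ?thesis using c N(1) by auto
  qed
  have uniq: "\<forall>i<n. q i = q' i" 
    if "(\<Sum>i<n. of_rat (q i) * w i) = (\<Sum>i<n. of_rat (q' i) * w i)" for q q'
    using indep[of "\<lambda>i. q i - q' i"] that
    by (simp add: of_rat_diff left_diff_distrib sum_subtractf)
  have "\<exists>q. x = (\<Sum>i<n. of_rat (q i) * w i)" for x
  proof -
    obtain N :: int where N: "N \<noteq> 0" "of_int N * x \<in> \<Gamma>" using full by blast
    then obtain c where c: "of_int N * x = (\<Sum>i<n. of_int (c i) * w i)"
      using N(2) unfolding zfree_iff[OF free] by blast
    have "x = (of_int N * x) / of_int N" using N by simp
    also have "\<dots> = (\<Sum>i<n. of_rat (of_int (c i) / of_int N) * w i)"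
      unfolding c by (simp add: sum_divide_distrib of_rat_divide)
    finally show ?thesis by (rule exI[of _ "\<lambda>i. of_int (c i) / of_int N"])
  qed
  then have "\<forall>x. \<exists>q. x = (\<Sum>i<n. of_rat (q i) * w i)" by blast
  from choice[OF this] obtain q where q: "\<And>x. x = (\<Sum>i<n. of_rat (q x i) * w i)" by blast
  have "dual_basis n w (\<lambda>i x. q x i)"
    unfolding dual_basis_def
  proof (intro conjI allI impI)
    fix i x y r
    assume i: "i < n"
    have "(\<Sum>i<n. of_rat (q (x + y) i) * w i) = (\<Sum>i<n. of_rat (q x i + q y i) * w i)"
      using q[of x] q[of y] q[of "x + y"] by (simp add: of_rat_add distrib_right sum.distrib)
    from uniq[OF this] show "q (x + y) i = q x i + q y i" using i by blast
    have "(\<Sum>i<n. of_rat (q (of_rat r * x) i) * w i) = (\<Sum>i<n. of_rat (r * q x i) * w i)"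
      using arg_cong[OF q[of x], of "\<lambda>z. of_rat r * z"] q[of "of_rat r * x"]
      by (simp add: of_rat_mult mult.assoc flip: sum_distrib_left)
    from uniq[OF this] show "q (of_rat r * x) i = r * q x i" using i by blast
  next
    fix i j assume ij: "i < n" "j < n"
    have "(\<Sum>i<n. of_rat (q (w j) i) * w i) = (\<Sum>i<n. of_rat (of_bool (i = j)) * w i)"
      using ij q[of "w j"] by (simp add: of_bool_def if_distrib[of "\<lambda>b. of_rat b * _"] cong: if_cong)
    from uniq[OF this] show "q (w j) i = of_bool (i = j)" using ij by blast
  qed (rule q)
  moreover have "q x i \<in> \<int>" if x: "x \<in> \<Gamma>" and i: "i < n" for x i
  proof -
    obtain c where c: "x = (\<Sum>i<n. of_int (c i) * w i)"
      using x unfolding zfree_iff[OF free] by blast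
    then have "(\<Sum>i<n. of_rat (q x i) * w i) = (\<Sum>i<n. of_rat (of_int (c i)) * w i)"
      using q[of x] by simp
    from uniq[OF this] have "q x i = of_int (c i)" using i by blast
    then show ?thesis by simp
  qed
  ultimately show ?thesis by blast
qed

text \<open>\<open>N\<close> is a common denominator of the matrix of multiplication by
  \<open>x\<close>. Then \<open>N\<close> times \<open>x\<close> maps the group spanned by the basis
  into itself, and the determinant trick applies.\<close>

lemma integral_multiple:
  fixes x :: "'k::field_char_0"
  assumes nf: "number_field TYPE('k)"
  shows "\<exists>N::int. N \<noteq> 0 \<and> algebraic_int (of_int N * x)"
proof -
  obtain n and w :: "nat \<Rightarrow> 'k" and \<kappa> where d: "dual_basis n w \<kappa>"
    using number_field_dual_basis[OF nf] by blast
  obtain N :: int where N: "N \<noteq> 0" "\<forall>p\<in>Sigma {..<n} (\<lambda>_. {..<n}). of_int N * \<kappa> (fst p) (x * w (snd p)) \<in> \<int>"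
    using common_denominator[of "Sigma {..<n} (\<lambda>_. {..<n})" "\<lambda>p. \<kappa> (fst p) (x * w (snd p))"] by auto
  have w0: "w 0 \<noteq> 0"
    using dual_basis_delta[OF d dual_basis_pos[OF d] dual_basis_pos[OF d]] 
      dual_basis_zero[OF d dual_basis_pos[OF d]] by auto
  have "algebraic_int (of_int N * x)"
  proof (rule algebraic_int_if_stable[of "w ` {..<n}" "w 0"])
    fix s assume "s \<in> w ` {..<n}"
    then obtain i where i: "i < n" "s = w i" by blast
    have "of_int N * x * s = of_int N * (\<Sum>j<n. of_rat (\<kappa> j (x * w i)) * w j)"
      using dual_basis_expand[OF d, of "x * w i"] i by simp
    also have "\<dots> = (\<Sum>j<n. of_rat (of_int N * \<kappa> j (x * w i)) * w j)"
      by (simp add: sum_distrib_left of_rat_mult mult.assoc)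
    also have "\<dots> \<in> zspan (w ` {..<n})"
    proof (rule zmod.span_sum)
      fix j assume j: "j \<in> {..<n}"
      then have "of_int N * \<kappa> j (x * w i) \<in> \<int>" using N(2) i by auto
      then obtain c where "of_int N * \<kappa> j (x * w i) = of_int c" by (auto elim: Ints_cases)
      then show "of_rat (of_int N * \<kappa> j (x * w i)) * w j \<in> zspan (w ` {..<n})"
        using j by (simp, intro zmod.span_scale zmod.span_base) auto
    qed
    finally show "of_int N * x * s \<in> zspan (w ` {..<n})" .
  qed (use w0 dual_basis_pos[OF d] in auto)
  then show ?thesis using N by blast
qed

text \<open>The Z[x]-module spanned by a rational basis is a finitely generated group of full rank
  and stable under \<open>x\<close>. In a basis of this group multiplication by \<open>x\<close> has
  an integer matrix, so its trace is an integer.\<close>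

lemma field_trace_algebraic_int:
  fixes x :: "'k::field_char_0"
  assumes nf: "number_field TYPE('k)" and x: "algebraic_int x"
  shows "field_trace x \<in> \<int>"
proof -
  obtain n where n: "0 < n" "x ^ n \<in> zspan ((^) x ` {..<n})"
    using algebraic_int_power_zspan[OF x] .
  define A where "A = (^) x ` {..<n}"
  obtain d and w :: "nat \<Rightarrow> 'k" and \<kappa> where d: "dual_basis d w \<kappa>"
    using number_field_dual_basis[OF nf] by blast
  define S where "S = {a * b | a b. a \<in> A \<and> b \<in> w ` {..<d}}"
  have finS: "finite S" unfolding S_def by (rule finite_image_set2) (simp_all add: A_def)
  have one: "1 \<in> A" unfolding A_def using n by (auto intro!: image_eqI[of _ _ 0])
  have wS: "w i \<in> S" if "i < d" for i
    unfolding S_def using that one by (intro CollectI exI[of _ 1] exI[of _ "w i"]) simp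
  \<comment> \<open>A common denominator for the coordinates of all generators embeds their span
    into integer vectors of length \<open>d\<close>; this is what provides a basis of the
    span.\<close>
  obtain D :: int where D: "D \<noteq> 0" "\<forall>p\<in>Sigma {..<d} (\<lambda>_. S). of_int D * \<kappa> (fst p) (snd p) \<in> \<int>"
    using common_denominator[of "Sigma {..<d} (\<lambda>_. S)" "\<lambda>p. \<kappa> (fst p) (snd p)"] finS by auto
  have Dint: "of_int D * \<kappa> j y \<in> \<int>" if j: "j < d" and y: "y \<in> zspan S" for j y
    using y
  proof (induction rule: zmod.span_induct_alt)
    case base
    show ?case by (simp add: dual_basis_zero[OF d j])
  next
    case (step c s z)
    have "of_int D * \<kappa> j s \<in> \<int>" using D(2)[rule_format, of "(j, s)"] j step by simp
    then have "of_int c * (of_int D * \<kappa> j s) + of_int D * \<kappa> j z \<in> \<int>"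
      by (rule Ints_add[OF Ints_mult[OF Ints_of_int]]) (use step in simp_all)
    moreover have "of_int D * \<kappa> j (of_int c * s + z) = of_int c * (of_int D * \<kappa> j s) + of_int D * \<kappa> j z"
      by (simp add: dual_basis_add[OF d j] dual_basis_int_scale[OF d j] distrib_left mult.left_commute)
    ultimately show ?case by (simp only:)
  qed
  have "\<exists>n w. zfree (zspan S) n w"
  proof (rule zfree_of_additive_embedding[where d = d and \<phi> = "\<lambda>j y. \<lfloor>of_int D * \<kappa> j y\<rfloor>"])
    fix j a b assume j: "j < d" and ab: "a \<in> zspan S" "b \<in> zspan S"
    have "of_int D * \<kappa> j (a - b) = of_int D * \<kappa> j a - of_int D * \<kappa> j b"
      by (simp add: dual_basis_diff[OF d j] algebra_simps)
    then show "\<lfloor>of_int D * \<kappa> j (a - b)\<rfloor> = \<lfloor>of_int D * \<kappa> j a\<rfloor> - \<lfloor>of_int D * \<kappa> j b\<rfloor>"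
      using floor_diff_Ints[OF Dint[OF j ab(1)] Dint[OF j ab(2)]] by simp
  next
    fix y assume y: "y \<in> zspan S" "\<And>j. j < d \<Longrightarrow> \<lfloor>of_int D * \<kappa> j y\<rfloor> = 0"
    have 0: "\<kappa> j y = 0" if j: "j < d" for j
      using floor_Ints[OF Dint[OF j y(1)]] y(2)[OF j] D(1) by simp
    have "y = (\<Sum>i<d. of_rat (\<kappa> i y) * w i)" by (rule dual_basis_expand[OF d])
    also have "\<dots> = 0" by (rule sum.neutral) (simp add: 0)
    finally show "y = 0" .
  qed (auto intro: zmod.span_zero zmod.span_diff)
  then obtain n' w' where w': "zfree (zspan S) n' w'" by blast
  have "\<exists>N::int. N \<noteq> 0 \<and> of_int N * y \<in> zspan S" for y
  proof -
    obtain N :: int where N: "N \<noteq> 0" "\<forall>j\<in>{..<d}. of_int N * \<kappa> j y \<in> \<int>"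
      using common_denominator[of "{..<d}" "\<lambda>j. \<kappa> j y"] by auto
    have "of_int N * y = of_int N * (\<Sum>j<d. of_rat (\<kappa> j y) * w j)"
      using arg_cong[OF dual_basis_expand[OF d, of y], of "\<lambda>z. of_int N * z"] .
    also have "\<dots> = (\<Sum>j<d. of_rat (of_int N * \<kappa> j y) * w j)"
      by (simp add: sum_distrib_left of_rat_mult mult.assoc)
    also have "\<dots> \<in> zspan S"
    proof (rule zmod.span_sum)
      fix j assume j: "j \<in> {..<d}"
      then have "of_int N * \<kappa> j y \<in> \<int>" using N(2) by blast
      then obtain c where "of_int N * \<kappa> j y = of_int c" by (auto elim: Ints_cases)
      then show "of_rat (of_int N * \<kappa> j y) * w j \<in> zspan S"
        using j wS by (simp, intro zmod.span_scale zmod.span_base) auto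
    qed
    finally show ?thesis using N by blast
  qed
  then obtain \<kappa>' where \<kappa>': "dual_basis n' w' \<kappa>'" "\<forall>x\<in>zspan S. \<forall>i<n'. \<kappa>' i x \<in> \<int>"
    using zfree_dual_basis[OF w'] by blast
  have xS: "x * y \<in> zspan S" if "y \<in> zspan S" for y
  proof -
    have "x * s \<in> zspan S" if s: "s \<in> S" for s
    proof -
      obtain a b where ab: "a \<in> A" "b \<in> w ` {..<d}" "s = a * b" using s by (auto simp: S_def)
      have "x * a \<in> zspan A" using power_mult_zspan[OF n(2)] ab(1) unfolding A_def .
      then have "(x * a) * b \<in> zspan S"
      proof (rule zspan_mult_right)
        fix t assume "t \<in> A"
        then have "t * b \<in> S" using ab(2) unfolding S_def by blast
        then show "t * b \<in> zspan S" by (rule zmod.span_base)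
      qed
      then show ?thesis using ab by (simp add: mult.assoc)
    qed
    then have "y * x \<in> zspan S" by (intro zspan_mult_right[OF that]) (simp add: mult.commute)
    then show ?thesis by (simp add: mult.commute)
  qed
  show ?thesis
    unfolding field_trace_eq[OF nf \<kappa>'(1)]
    using \<kappa>'(2) xS[OF zfree_generator[OF w']] by (intro Ints_sum) simp
qed

text \<open>Traces against integral multiples of a rational basis map the integers of the field to
  integer vectors. The map is injective because the trace form is nondegenerate.\<close>

lemma ring_of_integers_free:
  assumes nf: "number_field TYPE('k::field_char_0)"
  shows "\<exists>n w. zfree (ring_of_integers :: 'k set) n w"
proof -
  obtain d and w :: "nat \<Rightarrow> 'k" and \<kappa> where d: "dual_basis d w \<kappa>"
    using number_field_dual_basis[OF nf] by blast
  obtain N where N: "\<And>j. N j \<noteq> 0" "\<And>j. algebraic_int (of_int (N j) * w j)"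
  proof -
    have "\<forall>j. \<exists>N::int. N \<noteq> 0 \<and> algebraic_int (of_int N * w j)" using integral_multiple[OF nf] by blast
    from choice[OF this] show ?thesis using that by blast
  qed
  have tr: "field_trace (x * (of_int (N j) * w j)) \<in> \<int>" if "algebraic_int x" for x j
    using field_trace_algebraic_int[OF nf] that N(2) by blast
  show ?thesis
  proof (rule zfree_of_additive_embedding[where d = d and \<phi> = "\<lambda>j y. \<lfloor>field_trace (y * (of_int (N j) * w j))\<rfloor>"])
    fix j x y assume xy: "x \<in> (ring_of_integers :: 'k set)" "y \<in> (ring_of_integers :: 'k set)"
    have "field_trace (x * (of_int (N j) * w j)) =
        field_trace ((x - y) * (of_int (N j) * w j)) + field_trace (y * (of_int (N j) * w j))"
      by (simp add: left_diff_distrib flip: field_trace_add[OF nf])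
    then have "field_trace ((x - y) * (of_int (N j) * w j)) = 
        field_trace (x * (of_int (N j) * w j)) - field_trace (y * (of_int (N j) * w j))"
      by simp
    then show "\<lfloor>field_trace ((x - y) * (of_int (N j) * w j))\<rfloor> = 
        \<lfloor>field_trace (x * (of_int (N j) * w j))\<rfloor> - \<lfloor>field_trace (y * (of_int (N j) * w j))\<rfloor>"
      using floor_diff_Ints[of "field_trace (x * (of_int (N j) * w j))" "field_trace (y * (of_int (N j) * w j))"]
        tr[of x j] tr[of y j] xy by simp
  next
    fix x assume x: "x \<in> (ring_of_integers :: 'k set)"
      and 0: "\<And>j. j < d \<Longrightarrow> \<lfloor>field_trace (x * (of_int (N j) * w j))\<rfloor> = 0"
    have z: "field_trace (x * w j) = 0" if "j < d" for j
    proof -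
      have "field_trace (x * (of_int (N j) * w j)) = 0"
        using floor_Ints[OF tr[of x j]] 0[OF that] x by simp
      moreover have "x * (of_int (N j) * w j) = of_int (N j) * (x * w j)" by (simp add: mult_ac)
      ultimately show ?thesis using N(1)[of j] by (simp add: field_trace_int[OF nf])
    qed
    have "field_trace (x * y) = 0" for y
    proof -
      have "x * y = x * (\<Sum>j<d. of_rat (\<kappa> j y) * w j)"
        using arg_cong[OF dual_basis_expand[OF d, of y], of "\<lambda>z. x * z"] .
      also have "\<dots> = (\<Sum>j<d. of_rat (\<kappa> j y) * (x * w j))"
        by (simp add: sum_distrib_left mult_ac)
      finally show ?thesis by (simp add: field_trace_sum[OF nf] field_trace_rat[OF nf] z)
    qed
    \<comment> \<open>For nonzero \<open>x\<close>, orthogonality to its inverse would make the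
      trace of 1 vanish, which is the degree.\<close>
    from this[of "inverse x"] show "x = 0"
      using field_trace_one[OF nf d] dual_basis_pos[OF d] by (cases "x = 0") auto
  qed auto
qed

lemma integral_dual_basis:
  fixes w :: "nat \<Rightarrow> 'k::field_char_0"
  assumes nf: "number_field TYPE('k)" and "zfree (ring_of_integers :: 'k set) n w"
  shows "\<exists>\<kappa>. dual_basis n w \<kappa> \<and> (\<forall>x. algebraic_int x \<longrightarrow> (\<forall>i<n. \<kappa> i x \<in> \<int>))"
  using zfree_dual_basis[OF assms(2)] integral_multiple[OF nf] by auto

section \<open>The discriminant\<close>

text \<open>Uniqueness of the expansion of 0 is independence; conversely the difference of two
  expansions of one element is an expansion of 0.\<close>

lemma integral_basis_zfree:
  fixes ws :: "'k::field_char_0 list"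
  shows "integral_basis ws \<longleftrightarrow> zfree ring_of_integers (length ws) ((!) ws)"
proof
  assume ib: "integral_basis ws"
  define n where "n = length ws"
  have ws: "algebraic_int (ws ! i)" if "i < n" for i
    using ib nth_mem[of i ws] that unfolding integral_basis_def n_def by blast
  have ex1: "\<exists>!cs::int list. length cs = n \<and> x = (\<Sum>i<n. of_int (cs ! i) * ws ! i)"
    if "algebraic_int x" for x
    using ib that unfolding integral_basis_def n_def by blast
  show "zfree ring_of_integers (length ws) ((!) ws)"
    unfolding zfree_def n_def[symmetric]
  proof (intro conjI allI impI)
    fix c :: "nat \<Rightarrow> int" and i
    assume 0: "(\<Sum>i<n. of_int (c i) * ws ! i) = 0" and i: "i < n"
    have "length (map c [0..<n]) = n \<and> 0 = (\<Sum>i<n. of_int (map c [0..<n] ! i) * ws ! i)"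
      using 0 by simp
    moreover have "length (replicate n (0::int)) = n \<and> 0 = (\<Sum>i<n. of_int (replicate n 0 ! i) * ws ! i)"
      by simp
    ultimately have "map c [0..<n] = replicate n 0"
      using ex1[of 0] by blast
    then have "map c [0..<n] ! i = replicate n 0 ! i" by (rule arg_cong)
    then show "c i = 0" using i by simp
  next
    show "ring_of_integers = {\<Sum>i<n. of_int (c i) * ws ! i | c::nat \<Rightarrow> int. True}"
    proof (intro equalityI subsetI)
      fix x :: 'k assume "x \<in> ring_of_integers"
      then obtain cs :: "int list" where "x = (\<Sum>i<n. of_int (cs ! i) * ws ! i)"
        using ex1 by blast
      then show "x \<in> {\<Sum>i<n. of_int (c i) * ws ! i | c::nat \<Rightarrow> int. True}"
        by (intro CollectI exI[of _ "(!) cs"]) simp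
    next
      fix x :: 'k assume "x \<in> {\<Sum>i<n. of_int (c i) * ws ! i | c::nat \<Rightarrow> int. True}"
      then obtain c :: "nat \<Rightarrow> int" where "x = (\<Sum>i<n. of_int (c i) * ws ! i)" by blast
      then show "x \<in> ring_of_integers"
        using ws by (auto intro!: algebraic_int_sum algebraic_int_mult)
    qed
  qed
next
  assume free: "zfree ring_of_integers (length ws) ((!) ws)"
  define n where "n = length ws"
  note free = free[folded n_def]
  show "integral_basis ws"
    unfolding integral_basis_def n_def[symmetric]
  proof (intro conjI ballI)
    show "set ws \<subseteq> ring_of_integers"
      using zfree_generator[OF free] by (auto simp: in_set_conv_nth n_def)
    fix x assume "x \<in> (ring_of_integers :: 'k set)"
    then obtain c where c: "x = (\<Sum>i<n. of_int (c i) * ws ! i)"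
      unfolding zfree_iff[OF free] by blast
    show "\<exists>!cs::int list. length cs = n \<and> x = (\<Sum>i<n. of_int (cs ! i) * ws ! i)"
    proof (rule ex1I[of _ "map c [0..<n]"])
      show "length (map c [0..<n]) = n \<and> x = (\<Sum>i<n. of_int (map c [0..<n] ! i) * ws ! i)"
        using c by simp
      fix cs :: "int list"
      assume cs: "length cs = n \<and> x = (\<Sum>i<n. of_int (cs ! i) * ws ! i)"
      have "(\<Sum>i<n. of_int (cs ! i - c i) * ws ! i) =
          (\<Sum>i<n. of_int (cs ! i) * ws ! i) - (\<Sum>i<n. of_int (c i) * ws ! i)"
        by (simp add: left_diff_distrib sum_subtractf)
      also have "\<dots> = 0" using c cs by simp
      finally have "cs ! i = c i" if "i < n" for i
        using zfree_indep[OF free, of "\<lambda>i. cs ! i - c i"] that by simp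
      then show "cs = map c [0..<n]" using cs by (simp add: list_eq_iff_nth_eq)
    qed
  qed
qed

lemma integral_basis_algebraic_int:
  fixes ws :: "'k::field_char_0 list"
  assumes "integral_basis ws" "i < length ws"
  shows "algebraic_int (ws ! i)"
proof -
  have "set ws \<subseteq> ring_of_integers" using assms(1) unfolding integral_basis_def by (rule conjunct1)
  then show ?thesis using nth_mem[OF assms(2)] by blast
qed

text \<open>The floor only changes the type: for an integral basis the traces are integers already.
  An integer matrix is wanted because it will be reduced modulo 2.\<close>

definition trace_gram :: "'k::field_char_0 list \<Rightarrow> int mat" where
  "trace_gram ws = mat (length ws) (length ws) (\<lambda>(i, j). \<lfloor>field_trace (ws ! i * ws ! j)\<rfloor>)"

lemma integral_basis_trace_Ints:
  fixes ws :: "'k::field_char_0 list"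
  assumes nf: "number_field TYPE('k)" and ib: "integral_basis ws"
    and "i < length ws" "j < length ws"
  shows "field_trace (ws ! i * ws ! j) \<in> \<int>"
proof -
  show ?thesis
    by (intro field_trace_algebraic_int[OF nf] algebraic_int_mult integral_basis_algebraic_int[OF ib] assms)
qed

lemma trace_gram_det:
  fixes ws :: "'k::field_char_0 list"
  assumes nf: "number_field TYPE('k)" and ib: "integral_basis ws"
  shows "det (mat (length ws) (length ws) (\<lambda>(i, j). field_trace (ws ! i * ws ! j))) =
    of_int (det (trace_gram ws))"
proof -
  have "mat (length ws) (length ws) (\<lambda>(i, j). field_trace (ws ! i * ws ! j)) =
      map_mat of_int (trace_gram ws)"
    by (rule eq_matI) (simp_all add: trace_gram_def floor_Ints integral_basis_trace_Ints[OF assms])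
  then show ?thesis by (simp add: of_int_hom.hom_det)
qed

text \<open>An integer matrix A expressing the second basis in the first turns the Gram matrix N
  into A N A^T, and \<open>a\<close> is the determinant of A. That A is square follows from the
  trace of 1, which equals both lengths.\<close>

lemma trace_gram_base_change:
  fixes ws ws' :: "'k::field_char_0 list"
  assumes nf: "number_field TYPE('k)" and ib: "integral_basis ws" "integral_basis ws'"
  shows "\<exists>a. det (trace_gram ws') = a * a * det (trace_gram ws)"
proof -
  obtain \<kappa> \<kappa>' where d: "dual_basis (length ws) ((!) ws) \<kappa>" "dual_basis (length ws') ((!) ws') \<kappa>'"
    using integral_dual_basis[OF nf ib(1)[unfolded integral_basis_zfree]]
      integral_dual_basis[OF nf ib(2)[unfolded integral_basis_zfree]] by blast
  have "(of_nat (length ws) :: rat) = of_nat (length ws')"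
    using field_trace_one[OF nf d(1)] field_trace_one[OF nf d(2)] by (rule trans[OF sym])
  then have len: "length ws' = length ws" by simp
  define n where "n = length ws"
  note free = ib(1)[unfolded integral_basis_zfree, folded n_def]
  have "\<exists>c. i < n \<longrightarrow> ws' ! i = (\<Sum>k<n. of_int (c k) * ws ! k)" for i
  proof (cases "i < n")
    case True
    then have "ws' ! i \<in> ring_of_integers"
      using integral_basis_algebraic_int[OF ib(2), of i] len unfolding n_def by simp
    then show ?thesis unfolding zfree_iff[OF free] by blast
  qed simp
  then have "\<forall>i. \<exists>c. i < n \<longrightarrow> ws' ! i = (\<Sum>k<n. of_int (c k) * ws ! k)" by blast
  from choice[OF this] obtain c where
    c: "\<And>i. i < n \<Longrightarrow> ws' ! i = (\<Sum>k<n. of_int (c i k) * ws ! k)" by blast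
  define A where "A = mat n n (\<lambda>(i, k). c i k)"
  have A: "A \<in> carrier_mat n n" and G: "trace_gram ws \<in> carrier_mat n n"
    by (simp_all add: A_def trace_gram_def n_def)
  have "trace_gram ws' = A * trace_gram ws * transpose_mat A"
  proof (rule eq_matI)
    fix i j assume "i < dim_row (A * trace_gram ws * transpose_mat A)"
      "j < dim_col (A * trace_gram ws * transpose_mat A)"
    then have ij: "i < n" "j < n" by (simp_all add: A_def)
    have "ws' ! i * ws' ! j = (\<Sum>k<n. \<Sum>l<n. of_int (c i k * c j l) * (ws ! k * ws ! l))"
      unfolding c[OF ij(1)] c[OF ij(2)] sum_product
      by (intro sum.cong refl) (simp only: of_int_mult mult_ac)
    then have "field_trace (ws' ! i * ws' ! j) =
        (\<Sum>k<n. \<Sum>l<n. of_int (c i k * c j l) * field_trace (ws ! k * ws ! l))"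
      by (simp only: field_trace_sum[OF nf] field_trace_int[OF nf])
    also have "\<dots> = (\<Sum>k<n. \<Sum>l<n. of_int (c i k * c j l * \<lfloor>field_trace (ws ! k * ws ! l)\<rfloor>))"
      by (intro sum.cong refl)
        (simp add: floor_Ints integral_basis_trace_Ints[OF nf ib(1)] n_def)
    also have "\<dots> = of_int (\<Sum>k<n. \<Sum>l<n. c i k * c j l * \<lfloor>field_trace (ws ! k * ws ! l)\<rfloor>)"
      by (simp only: of_int_sum)
    finally have tr: "field_trace (ws' ! i * ws' ! j) =
      of_int (\<Sum>k<n. \<Sum>l<n. c i k * c j l * \<lfloor>field_trace (ws ! k * ws ! l)\<rfloor>)" .
    have "trace_gram ws' $$ (i, j) = \<lfloor>field_trace (ws' ! i * ws' ! j)\<rfloor>"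
      using ij len by (simp add: trace_gram_def n_def)
    also have "\<dots> = (\<Sum>k<n. \<Sum>l<n. c i k * c j l * \<lfloor>field_trace (ws ! k * ws ! l)\<rfloor>)"
      by (simp only: tr floor_of_int)
    also have "\<dots> = (\<Sum>l<n. \<Sum>k<n. c i k * c j l * \<lfloor>field_trace (ws ! k * ws ! l)\<rfloor>)"
      by (rule sum.swap)
    also have "\<dots> = (\<Sum>l<n. (\<Sum>k<n. c i k * \<lfloor>field_trace (ws ! k * ws ! l)\<rfloor>) * c j l)"
      unfolding sum_distrib_right by (intro sum.cong refl) (simp only: mult_ac)
    also have "\<dots> = (A * trace_gram ws * transpose_mat A) $$ (i, j)"
    proof -
      have N: "trace_gram ws $$ (k, l) = \<lfloor>field_trace (ws ! k * ws ! l)\<rfloor>" if "k < n" "l < n" for k l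
        using that by (simp add: trace_gram_def n_def)
      have "(A * trace_gram ws) $$ (i, l) = (\<Sum>k<n. c i k * trace_gram ws $$ (k, l))" if "l < n" for l
        using that ij G by (simp add: A_def scalar_prod_def atLeast0LessThan)
      then have "(A * trace_gram ws * transpose_mat A) $$ (i, j) =
          (\<Sum>l<n. (\<Sum>k<n. c i k * trace_gram ws $$ (k, l)) * c j l)"
        using ij A G by (simp add: scalar_prod_def atLeast0LessThan)
          (simp add: A_def sum_distrib_left sum_distrib_right mult.assoc, rule sum.swap)
      then show ?thesis by (simp add: N)
    qed
    finally show "trace_gram ws' $$ (i, j) = (A * trace_gram ws * transpose_mat A) $$ (i, j)" .
  qed (simp_all add: A_def trace_gram_def n_def len)
  then have "det (trace_gram ws') = det (A * trace_gram ws * transpose_mat A)" by (rule arg_cong)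
  also have "\<dots> = det A * det (trace_gram ws) * det A"
    unfolding det_mult[OF mult_carrier_mat[OF A G] transpose_carrier_mat[THEN iffD2, OF A]]
      det_mult[OF A G] det_transpose[OF A] ..
  finally show ?thesis by (intro exI[of _ "det A"]) (simp only: mult_ac)
qed

text \<open>Base change there and back multiplies a nonzero determinant by a product of two integral
  squares, which must be 1; so each square is 1.\<close>

lemma trace_gram_det_unique:
  fixes ws ws' :: "'k::field_char_0 list"
  assumes nf: "number_field TYPE('k)" and ib: "integral_basis ws" "integral_basis ws'"
  shows "det (trace_gram ws') = det (trace_gram ws)"
proof -
  obtain a where a: "det (trace_gram ws') = a * a * det (trace_gram ws)"
    using trace_gram_base_change[OF nf ib] by blast
  obtain b where b: "det (trace_gram ws) = b * b * det (trace_gram ws')"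
    using trace_gram_base_change[OF nf ib(2,1)] by blast
  show ?thesis
  proof (cases "det (trace_gram ws) = 0")
    case False
    have "det (trace_gram ws) = (b * b) * (a * a) * det (trace_gram ws)"
      using a b by (simp add: mult.assoc)
    then have "(b * b) * (a * a) = 1" using False by simp
    then have "a * a = 1 \<or> a * a = -1" using zmult_eq_1_iff[of "b * b" "a * a"] by blast
    moreover have "a * a \<ge> 0" by simp
    ultimately show ?thesis using a by auto
  qed (use a in simp)
qed

section \<open>The discriminant as a Gram determinant, and its parity\<close>

lemma ex_integral_basis:
  assumes nf: "number_field TYPE('k::field_char_0)"
  shows "\<exists>ws::'k list. integral_basis ws"
proof -
  obtain n and w :: "nat \<Rightarrow> 'k" where w: "zfree ring_of_integers n w"
    using ring_of_integers_free[OF nf] by blast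
  have "zfree ring_of_integers (length (map w [0..<n])) ((!) (map w [0..<n]))"
    using w by (simp add: zfree_def)
  then show ?thesis unfolding integral_basis_zfree[symmetric] by blast
qed

lemma discriminant_eq:
  fixes ws :: "'k::field_char_0 list"
  assumes nf: "number_field TYPE('k)" and ib: "integral_basis ws"
  shows "discriminant TYPE('k) = det (trace_gram ws)"
  unfolding discriminant_def
proof (rule the_equality)
  show "\<exists>ws'::'k list. integral_basis ws' \<and> of_int (det (trace_gram ws)) =
      det (mat (length ws') (length ws') (\<lambda>(i, j). field_trace (ws' ! i * ws' ! j)))"
    by (rule exI[of _ ws]) (simp add: ib trace_gram_det[OF nf ib])
  fix d
  assume "\<exists>ws'::'k list. integral_basis ws' \<and> of_int d =
      det (mat (length ws') (length ws') (\<lambda>(i, j). field_trace (ws' ! i * ws' ! j)))"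
  then obtain ws' :: "'k list" where ws': "integral_basis ws'" "of_int d =
      det (mat (length ws') (length ws') (\<lambda>(i, j). field_trace (ws' ! i * ws' ! j)))" by blast
  then have "(of_int d :: rat) = of_int (det (trace_gram ws'))"
    using trace_gram_det[OF nf ws'(1)] by simp
  then show "d = det (trace_gram ws)"
    using trace_gram_det_unique[OF nf ib ws'(1)] by simp
qed

lemma of_int_bit_eq_0: "(of_int k :: bit) = 0 \<longleftrightarrow> even k"
proof (cases "even k")
  case True
  then obtain q where "k = 2 * q" by (rule evenE)
  then have "(of_int k :: bit) = 2 * of_int q" by (simp only: of_int_mult of_int_numeral)
  then have "(of_int k :: bit) = 0" by (simp only: bit_2_eq_0 mult_zero_left)
  then show ?thesis using True by blast
next
  case False
  then obtain q where "k = 2 * q + 1" by (rule oddE)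
  then have "(of_int k :: bit) = 2 * of_int q + 1" by (simp only: of_int_mult of_int_numeral of_int_add of_int_1)
  also have "\<dots> = 1" by (simp only: bit_2_eq_0 mult_zero_left add_0_left)
  finally show ?thesis using False by simp
qed

text \<open>The Gram matrix is singular over the field with two elements. A kernel vector, lifted to
  coefficients 0 and 1, gives \<open>y\<close>: it is not divisible by 2 because the vector is
  nonzero, and its traces against a basis are even because the vector lies in the kernel.\<close>

lemma even_discriminant:
  assumes nf: "number_field TYPE('k::field_char_0)" and even: "even (discriminant TYPE('k))"
  shows "\<exists>y::'k. algebraic_int y \<and> \<not> algebraic_int (y / 2) \<and>
    (\<forall>x. algebraic_int x \<longrightarrow> field_trace (x * y / 2) \<in> \<int>)"
proof -
  obtain ws :: "'k list" where ib: "integral_basis ws" using ex_integral_basis[OF nf] by blast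
  define n where "n = length ws"
  note free = ib[unfolded integral_basis_zfree, folded n_def]
  define N where "N = trace_gram ws"
  have N: "N \<in> carrier_mat n n" by (simp add: N_def trace_gram_def n_def)
  have "even (det N)" using even discriminant_eq[OF nf ib] by (simp add: N_def)
  then have "det (map_mat of_int N :: bit mat) = 0"
    using of_int_bit_eq_0 by (simp add: of_int_hom.hom_det)
  moreover have N': "(map_mat of_int N :: bit mat) \<in> carrier_mat n n" using N by simp
  ultimately obtain v where v: "v \<in> carrier_vec n" "v \<noteq> 0\<^sub>v n"
      "(map_mat of_int N :: bit mat) *\<^sub>v v = 0\<^sub>v n"
    using det_0_iff_vec_prod_zero_field[OF N'] by blast
  define c :: "nat \<Rightarrow> int" where "c j = (if Matrix.vec_index v j = 0 then 0 else 1)" for j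
  have cv: "of_int (c j) = Matrix.vec_index v j" for j
    by (cases "Matrix.vec_index v j") (simp_all add: c_def)
  have evenN: "even (\<Sum>j<n. N $$ (i, j) * c j)" if i: "i < n" for i
  proof -
    have "(of_int (\<Sum>j<n. N $$ (i, j) * c j) :: bit) = (\<Sum>j<n. of_int (N $$ (i, j)) * Matrix.vec_index v j)"
      by (simp only: of_int_sum of_int_mult cv)
    also have "\<dots> = Matrix.vec_index ((map_mat of_int N :: bit mat) *\<^sub>v v) i"
      using i N v(1) by (simp add: scalar_prod_def atLeast0LessThan del: mult_bit_eq_and add_bit_eq_xor)
    also have "\<dots> = 0" using i v(3) by simp
    finally show ?thesis by (simp only: of_int_bit_eq_0)
  qed
  define y where "y = (\<Sum>j<n. of_int (c j) * ws ! j)"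
  have y: "algebraic_int y"
    using zfree_iff[OF free, of y] y_def by blast
  have "\<not> algebraic_int (y / 2)"
  proof
    assume "algebraic_int (y / 2)"
    then obtain b where b: "y / 2 = (\<Sum>j<n. of_int (b j) * ws ! j)"
      using zfree_iff[OF free, of "y / 2"] by blast
    have "(\<Sum>j<n. of_int (c j - 2 * b j) * ws ! j) =
        (\<Sum>j<n. of_int (c j) * ws ! j) - 2 * (\<Sum>j<n. of_int (b j) * ws ! j)"
      by (simp add: left_diff_distrib sum_subtractf sum_distrib_left mult.assoc)
    also have "\<dots> = 0" unfolding b[symmetric] y_def[symmetric] by simp
    finally have cb: "c j - 2 * b j = 0" if "j < n" for j
      by (rule zfree_indep[OF free _ that])
    have "Matrix.vec_index v j = 0" if "j < n" for j
    proof -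
      have "even (c j)" using cb[OF that] by simp
      then show ?thesis by (simp add: c_def split: if_splits)
    qed
    then have "v = 0\<^sub>v n" using v(1) by (intro eq_vecI) auto
    then show False using v(2) by blast
  qed
  moreover have "field_trace (x * y / 2) \<in> \<int>" if x: "algebraic_int x" for x
  proof -
    obtain a where a: "x = (\<Sum>i<n. of_int (a i) * ws ! i)"
      using zfree_iff[OF free, of x] x by blast
    have t: "field_trace (ws ! i * y / 2) \<in> \<int>" if i: "i < n" for i
    proof -
      obtain q where q: "(\<Sum>j<n. N $$ (i, j) * c j) = 2 * q" using evenN[OF i] by (rule evenE)
      have "ws ! i * y = (\<Sum>j<n. of_int (c j) * (ws ! i * ws ! j))"
        by (simp add: y_def sum_distrib_left mult_ac)
      then have "field_trace (ws ! i * y) = (\<Sum>j<n. of_int (c j) * field_trace (ws ! i * ws ! j))"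
        by (simp only: field_trace_sum[OF nf] field_trace_int[OF nf])
      also have "\<dots> = (\<Sum>j<n. of_int (N $$ (i, j) * c j))"
        using i by (intro sum.cong refl)
          (simp add: N_def trace_gram_def floor_Ints integral_basis_trace_Ints[OF nf ib] n_def)
      also have "\<dots> = of_int (\<Sum>j<n. N $$ (i, j) * c j)" by (simp only: of_int_sum)
      also have "\<dots> = 2 * of_int q" unfolding q by simp
      finally have "field_trace (ws ! i * y) = 2 * of_int q" .
      moreover have "field_trace (ws ! i * y) = 2 * field_trace (ws ! i * y / 2)"
        using field_trace_int[OF nf, of 2 "ws ! i * y / 2"] by simp
      ultimately show ?thesis by simp
    qed
    have "x * y / 2 = (\<Sum>i<n. of_int (a i) * (ws ! i * y / 2))"
      by (simp add: a sum_distrib_right sum_divide_distrib mult.assoc)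
    then have "field_trace (x * y / 2) = (\<Sum>i<n. of_int (a i) * field_trace (ws ! i * y / 2))"
      by (simp only: field_trace_sum[OF nf] field_trace_int[OF nf])
    then show ?thesis using t by (auto intro!: Ints_sum Ints_mult)
  qed
  ultimately show ?thesis using y by blast
qed

section \<open>Integers modulo 2\<close>

text \<open>The class modulo 2 is encoded by the set of indices whose coordinate in an integral
  basis is odd. This makes O/2O available as the values of an ordinary function with finite range,
  ready for pigeonhole and counting arguments.\<close>

lemma finite_residues_mod_2:
  assumes nf: "number_field TYPE('k::field_char_0)"
  shows "\<exists>f::'k \<Rightarrow> nat set. finite (range f) \<and>
    (\<forall>x y. algebraic_int x \<longrightarrow> algebraic_int y \<longrightarrow> (f x = f y \<longleftrightarrow> algebraic_int ((x - y) / 2)))"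
proof -
  obtain n and w :: "nat \<Rightarrow> 'k" where w: "zfree ring_of_integers n w"
    using ring_of_integers_free[OF nf] by blast
  obtain \<kappa> where \<kappa>: "dual_basis n w \<kappa>" "\<And>x i. algebraic_int x \<Longrightarrow> i < n \<Longrightarrow> \<kappa> i x \<in> \<int>"
    using integral_dual_basis[OF nf w] by blast
  define f where "f x = {i. i < n \<and> odd \<lfloor>\<kappa> i x\<rfloor>}" for x
  have "range f \<subseteq> Pow {..<n}" by (auto simp: f_def)
  then have "finite (range f)" by (rule finite_subset) simp
  moreover have "f x = f y \<longleftrightarrow> algebraic_int ((x - y) / 2)"
    if xy: "algebraic_int x" "algebraic_int y" for x y
  proof
    assume eq: "f x = f y"
    have "\<forall>i. \<exists>k. i < n \<longrightarrow> \<kappa> i x - \<kappa> i y = 2 * of_int k"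
    proof
      fix i
      show "\<exists>k. i < n \<longrightarrow> \<kappa> i x - \<kappa> i y = 2 * of_int k"
      proof (cases "i < n")
        case True
        have "odd \<lfloor>\<kappa> i x\<rfloor> \<longleftrightarrow> odd \<lfloor>\<kappa> i y\<rfloor>" using eq True unfolding f_def by blast
        then have "even (\<lfloor>\<kappa> i x\<rfloor> - \<lfloor>\<kappa> i y\<rfloor>)" by simp
        then obtain k where k: "\<lfloor>\<kappa> i x\<rfloor> - \<lfloor>\<kappa> i y\<rfloor> = 2 * k" by (rule evenE)
        have "\<kappa> i x - \<kappa> i y = of_int (\<lfloor>\<kappa> i x\<rfloor> - \<lfloor>\<kappa> i y\<rfloor>)"
          by (simp only: of_int_diff floor_Ints \<kappa>(2)[OF xy(1) True] \<kappa>(2)[OF xy(2) True])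
        then show ?thesis unfolding k by (intro exI[of _ k]) simp
      qed simp
    qed
    from choice[OF this] obtain k where k: "\<And>i. i < n \<Longrightarrow> \<kappa> i x - \<kappa> i y = 2 * of_int (k i)" by blast
    have "x - y = (\<Sum>i<n. of_rat (\<kappa> i (x - y)) * w i)" by (rule dual_basis_expand[OF \<kappa>(1)])
    also have "\<dots> = (\<Sum>i<n. of_rat (2 * of_int (k i)) * w i)"
      by (intro sum.cong refl) (simp only: dual_basis_diff[OF \<kappa>(1)] k lessThan_iff)
    also have "\<dots> = 2 * (\<Sum>i<n. of_int (k i) * w i)"
      by (simp add: sum_distrib_left of_rat_mult mult.assoc)
    finally have "(x - y) / 2 = (\<Sum>i<n. of_int (k i) * w i)" by simp
    then have "(x - y) / 2 \<in> ring_of_integers" using zfree_iff[OF w] by blast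
    then show "algebraic_int ((x - y) / 2)" by simp
  next
    assume alg: "algebraic_int ((x - y) / 2)"
    have "odd \<lfloor>\<kappa> i x\<rfloor> \<longleftrightarrow> odd \<lfloor>\<kappa> i y\<rfloor>" if i: "i < n" for i
    proof -
      have "x = y + of_int 2 * ((x - y) / 2)" by (simp add: field_simps)
      then have "\<kappa> i x = \<kappa> i (y + of_int 2 * ((x - y) / 2))" by (rule arg_cong)
      also have "\<dots> = \<kappa> i y + of_int 2 * \<kappa> i ((x - y) / 2)"
        by (simp only: dual_basis_add[OF \<kappa>(1) i] dual_basis_int_scale[OF \<kappa>(1) i])
      finally have "of_int \<lfloor>\<kappa> i x\<rfloor> = (of_int (\<lfloor>\<kappa> i y\<rfloor> + (2::int) * \<lfloor>\<kappa> i ((x - y) / 2)\<rfloor>) :: rat)"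
        unfolding of_int_add of_int_mult floor_Ints[OF \<kappa>(2)[OF xy(1) i]]
          floor_Ints[OF \<kappa>(2)[OF xy(2) i]] floor_Ints[OF \<kappa>(2)[OF alg i]] .
      then have "\<lfloor>\<kappa> i x\<rfloor> = \<lfloor>\<kappa> i y\<rfloor> + 2 * \<lfloor>\<kappa> i ((x - y) / 2)\<rfloor>" by (simp only: of_int_eq_iff)
      then show ?thesis by simp
    qed
    then show "f x = f y" unfolding f_def by blast
  qed
  ultimately show ?thesis by blast
qed

text \<open>The required \<^term>\<open>y\<close> is one for which the ideal of the integers modulo 2 generated by its class is
  smallest.\<close>

lemma minimal_mod_2:
  fixes Y :: "'k::field_char_0 set"
  assumes nf: "number_field TYPE('k)" and Y: "Y \<noteq> {}" "\<And>y. y \<in> Y \<Longrightarrow> algebraic_int y"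
  shows "\<exists>y\<in>Y. \<forall>a. algebraic_int a \<longrightarrow> a * y \<in> Y \<longrightarrow>
    (\<exists>c. algebraic_int c \<and> algebraic_int ((y - a * y * c) / 2))"
proof -
  obtain f :: "'k \<Rightarrow> nat set" where f: "finite (range f)"
    "\<And>x y. algebraic_int x \<Longrightarrow> algebraic_int y \<Longrightarrow> f x = f y \<longleftrightarrow> algebraic_int ((x - y) / 2)"
    using finite_residues_mod_2[OF nf] by blast
  \<comment> \<open>\<open>S y\<close> is the ideal of O/2O generated by the class of
    \<open>y\<close>, as a set of codes; its cardinality is the size to be minimised.\<close>
  define S where "S y = f ` {y * c | c. algebraic_int c}" for y
  have finS: "finite (S y)" for y
    by (rule finite_subset[OF _ f(1)]) (auto simp: S_def)
  have "\<exists>y. y \<in> Y \<and> (\<forall>z. z \<in> Y \<longrightarrow> card (S y) \<le> card (S z))"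
  proof -
    obtain z where "z \<in> Y" using Y(1) by blast
    then show ?thesis by (rule ex_has_least_nat[of "\<lambda>y. y \<in> Y" z "\<lambda>y. card (S y)"])
  qed
  then obtain y where y: "y \<in> Y" "\<And>z. z \<in> Y \<Longrightarrow> card (S y) \<le> card (S z)" by blast
  have "\<exists>c. algebraic_int c \<and> algebraic_int ((y - a * y * c) / 2)"
    if a: "algebraic_int a" "a * y \<in> Y" for a
  proof -
    have "S (a * y) \<subseteq> S y"
    proof
      fix s assume "s \<in> S (a * y)"
      then obtain c where c: "algebraic_int c" "s = f (a * y * c)" unfolding S_def by blast
      then have "s = f (y * (a * c))" "algebraic_int (a * c)" using a by (auto simp: mult_ac)
      then show "s \<in> S y" unfolding S_def by blast
    qed
    then have "S (a * y) = S y" using y(2)[OF a(2)] by (rule card_seteq[OF finS])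
    moreover have "f (y * 1) \<in> S y" unfolding S_def by (intro imageI CollectI exI[of _ 1]) simp
    ultimately have "f (y * 1) \<in> S (a * y)" by blast
    then obtain c where "algebraic_int c" "f (y * 1) = f (a * y * c)" unfolding S_def by blast
    then have c: "algebraic_int c" "f y = f (a * y * c)" by simp_all
    have "algebraic_int (a * y * c)" using Y(2)[OF a(2)] c(1) by (rule algebraic_int_mult)
    then have "algebraic_int ((y - a * y * c) / 2)" using f(2)[OF Y(2)[OF y(1)]] c(2) by blast
    then show ?thesis using c(1) by blast
  qed
  then show ?thesis using y(1) by blast
qed

section \<open>Valuations at dyadic primes\<close>

lemma field_rec_simps [simp]:
  "carrier (field_rec :: 'k::field ring) = UNIV"
  "x \<otimes>\<^bsub>field_rec\<^esub> y = x * y" "x \<oplus>\<^bsub>field_rec\<^esub> y = x + y"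
  "\<one>\<^bsub>field_rec\<^esub> = (1::'k)" "\<zero>\<^bsub>field_rec\<^esub> = (0::'k)"
  by (simp_all add: ring_of_type_algebra_def)

lemma integers_rec_simps:
  "carrier (integers_rec :: 'k::field ring) = ring_of_integers"
  "x \<otimes>\<^bsub>integers_rec\<^esub> y = x * y" "x \<oplus>\<^bsub>integers_rec\<^esub> y = x + y"
  "\<one>\<^bsub>integers_rec\<^esub> = (1::'k)" "\<zero>\<^bsub>integers_rec\<^esub> = (0::'k)"
  by (simp_all add: ring_of_type_algebra_def)

lemma integers_rec_cring: "cring (integers_rec :: 'k::field_char_0 ring)"
proof (rule cringI)
  show "abelian_group (integers_rec :: 'k ring)"
  proof (rule abelian_groupI)
    fix x :: 'k assume "x \<in> carrier integers_rec"
    then show "\<exists>y\<in>carrier integers_rec. y \<oplus>\<^bsub>integers_rec\<^esub> x = \<zero>\<^bsub>integers_rec\<^esub>"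
      by (intro bexI[of _ "- x"]) (simp_all add: integers_rec_simps)
  qed (auto simp: integers_rec_simps)
  show "Group.comm_monoid (integers_rec :: 'k ring)"
    by (rule Group.comm_monoidI) (auto simp: integers_rec_simps)
qed (auto simp: integers_rec_simps distrib_right)

text \<open>Complete integral closedness. The elements sent into the integers by all powers of
  \<open>g\<close> form a subgroup of the integers, which therefore has a finite basis. It is stable
  under \<open>g\<close> and contains \<open>a \<noteq> 0\<close>, so the determinant trick
  applies.\<close>

lemma algebraic_int_if_almost_integral:
  fixes g :: "'k::field_char_0"
  assumes nf: "number_field TYPE('k)" and a: "a \<noteq> 0" "\<And>k. algebraic_int (g ^ k * a)"
  shows "algebraic_int g"
proof -
  define \<Gamma> where "\<Gamma> = {x. \<forall>k. algebraic_int (g ^ k * x)}"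
  have alg: "algebraic_int x" if "x \<in> \<Gamma>" for x
  proof -
    have "algebraic_int (g ^ 0 * x)" using that unfolding \<Gamma>_def by blast
    then show ?thesis by simp
  qed
  obtain n and w :: "nat \<Rightarrow> 'k" where w: "zfree ring_of_integers n w"
    using ring_of_integers_free[OF nf] by blast
  obtain \<kappa> where \<kappa>: "dual_basis n w \<kappa>" "\<And>x i. algebraic_int x \<Longrightarrow> i < n \<Longrightarrow> \<kappa> i x \<in> \<int>"
    using integral_dual_basis[OF nf w] by blast
  have "\<exists>n w. zfree \<Gamma> n w"
  proof (rule zfree_of_additive_embedding[where d = n and \<phi> = "\<lambda>i x. \<lfloor>\<kappa> i x\<rfloor>"])
    show "0 \<in> \<Gamma>" by (simp add: \<Gamma>_def)
    fix x y assume xy: "x \<in> \<Gamma>" "y \<in> \<Gamma>"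
    then show "x - y \<in> \<Gamma>" by (simp add: \<Gamma>_def right_diff_distrib algebraic_int_diff)
    fix j assume j: "j < n"
    show "\<lfloor>\<kappa> j (x - y)\<rfloor> = \<lfloor>\<kappa> j x\<rfloor> - \<lfloor>\<kappa> j y\<rfloor>"
      unfolding dual_basis_diff[OF \<kappa>(1) j]
      by (rule floor_diff_Ints[OF \<kappa>(2)[OF alg[OF xy(1)] j] \<kappa>(2)[OF alg[OF xy(2)] j]])
  next
    fix x assume x: "x \<in> \<Gamma>" and z: "\<And>j. j < n \<Longrightarrow> \<lfloor>\<kappa> j x\<rfloor> = 0"
    have 0: "\<kappa> j x = 0" if "j < n" for j
      using floor_Ints[OF \<kappa>(2)[OF alg[OF x] that]] z[OF that] by simp
    have "x = (\<Sum>i<n. of_rat (\<kappa> i x) * w i)" by (rule dual_basis_expand[OF \<kappa>(1)])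
    also have "\<dots> = 0" by (rule sum.neutral) (simp add: 0)
    finally show "x = 0" .
  qed
  then obtain n' w' where w': "zfree \<Gamma> n' w'" by blast
  have "a \<in> \<Gamma>" using a(2) by (simp add: \<Gamma>_def)
  then obtain c where c: "a = (\<Sum>i<n'. of_int (c i) * w' i)" unfolding zfree_iff[OF w'] by blast
  have "\<exists>i<n'. w' i \<noteq> 0"
  proof (rule ccontr)
    assume "\<not> ?thesis"
    then have "(\<Sum>i<n'. of_int (c i) * w' i) = 0" by (intro sum.neutral) simp
    then show False using a(1) c by simp
  qed
  then obtain i where i: "i < n'" "w' i \<noteq> 0" by blast
  show ?thesis
  proof (rule algebraic_int_if_stable[of "w' ` {..<n'}" "w' i"])
    fix s assume "s \<in> w' ` {..<n'}"
    then have s: "s \<in> \<Gamma>" using zfree_generator[OF w'] by blast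
    have "g * s \<in> \<Gamma>" unfolding \<Gamma>_def
    proof (intro CollectI allI)
      fix k
      have "algebraic_int (g ^ Suc k * s)" using s unfolding \<Gamma>_def by blast
      then show "algebraic_int (g ^ k * (g * s))" by (simp only: power_Suc2 mult.assoc)
    qed
    then obtain d where d: "g * s = (\<Sum>i<n'. of_int (d i) * w' i)" unfolding zfree_iff[OF w'] by blast
    show "g * s \<in> zspan (w' ` {..<n'})"
      unfolding d by (intro zmod.span_sum zmod.span_scale zmod.span_base imageI)
  qed (use i in auto)
qed

text \<open>The prime ideal axioms are stated for elements of the field, so that what follows
  computes with field operations rather than with those of a ring record. In this form they can also
  be checked directly for a prime that is constructed as an annihilator.\<close>

locale dyadic =
  fixes P :: "'k::field_char_0 set"
  assumes nf: "number_field TYPE('k)"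
    and P_alg: "x \<in> P \<Longrightarrow> algebraic_int x"
    and P_add: "x \<in> P \<Longrightarrow> y \<in> P \<Longrightarrow> x + y \<in> P"
    and P_mult: "x \<in> P \<Longrightarrow> algebraic_int y \<Longrightarrow> x * y \<in> P"
    and P_prime: "algebraic_int x \<Longrightarrow> algebraic_int y \<Longrightarrow> x * y \<in> P \<Longrightarrow> x \<in> P \<or> y \<in> P"
    and P_one: "1 \<notin> P"
    and P_two: "2 \<in> P"

lemma dyadic_iff:
  fixes P :: "'k::field_char_0 set"
  assumes nf: "number_field TYPE('k)"
  shows "dyadic P \<longleftrightarrow> dyadic_prime P"
proof
  assume "dyadic_prime P"
  then have pr: "primeideal P integers_rec" and 2: "2 \<in> P"
    by (simp_all add: dyadic_prime_def finite_prime_def)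
  interpret primeideal P "integers_rec :: 'k ring" by fact
  show "dyadic P"
  proof
    show "number_field TYPE('k)" by fact
    show "2 \<in> P" by fact
    fix x y
    show "algebraic_int x" if "x \<in> P" using Icarr[OF that] by (simp add: integers_rec_simps)
    show "x + y \<in> P" if "x \<in> P" "y \<in> P" using additive_subgroup.a_closed[OF additive_subgroup_axioms that] by (simp add: integers_rec_simps)
    show "x * y \<in> P" if "x \<in> P" "algebraic_int y"
      using I_r_closed[OF that(1), of y] that(2) by (simp add: integers_rec_simps)
    show "x \<in> P \<or> y \<in> P" if "algebraic_int x" "algebraic_int y" "x * y \<in> P"
      using I_prime[of x y] that by (simp add: integers_rec_simps)
    show "1 \<notin> P" using one_imp_carrier I_notcarr by (auto simp: integers_rec_simps)
  qed
next
  assume "dyadic P"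
  then interpret dyadic P .
  interpret R: cring "integers_rec :: 'k ring" by (rule integers_rec_cring)
  have neg: "- x \<in> P" if "x \<in> P" for x using P_mult[OF that, of "-1"] by simp
  have inv: "inv\<^bsub>add_monoid integers_rec\<^esub> x = - x" if "x \<in> P" for x
    unfolding a_inv_def[symmetric]
    by (rule R.minus_equality) (use P_alg[OF that] in \<open>simp_all add: integers_rec_simps\<close>)
  have "0 \<in> P" using P_mult[OF P_two, of 0] by simp
  have id: "ideal P (integers_rec :: 'k ring)"
  proof (rule idealI[OF R.ring_axioms])
    show "subgroup P (add_monoid (integers_rec :: 'k ring))"
    proof
      show "P \<subseteq> carrier (add_monoid (integers_rec :: 'k ring))"
        using P_alg by (auto simp: ring_of_type_algebra_def)
      show "\<one>\<^bsub>add_monoid integers_rec\<^esub> \<in> P" using \<open>0 \<in> P\<close> by (simp add: ring_of_type_algebra_def)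
      show "x \<otimes>\<^bsub>add_monoid integers_rec\<^esub> y \<in> P" if "x \<in> P" "y \<in> P" for x y
        using P_add[OF that] by (simp add: ring_of_type_algebra_def)
      show "inv\<^bsub>add_monoid integers_rec\<^esub> x \<in> P" if "x \<in> P" for x
        unfolding inv[OF that] by (rule neg[OF that])
    qed
    show "x \<otimes>\<^bsub>integers_rec\<^esub> a \<in> P" "a \<otimes>\<^bsub>integers_rec\<^esub> x \<in> P"
      if "a \<in> P" "x \<in> carrier (integers_rec :: 'k ring)" for a x
      using P_mult[OF that(1), of x] that(2) by (simp_all add: integers_rec_simps mult.commute)
  qed
  have "primeideal P (integers_rec :: 'k ring)"
  proof (rule primeidealI[OF id R.is_cring])
    show "carrier (integers_rec :: 'k ring) \<noteq> P" using P_one by (auto simp: integers_rec_simps)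
    fix a b :: 'k
    assume "a \<in> carrier integers_rec" "b \<in> carrier integers_rec" "a \<otimes>\<^bsub>integers_rec\<^esub> b \<in> P"
    then show "a \<in> P \<or> b \<in> P" using P_prime[of a b] by (simp add: integers_rec_simps)
  qed
  moreover have "P \<noteq> {0}" using P_two by auto
  ultimately show "dyadic_prime P" using P_two by (simp add: dyadic_prime_def finite_prime_def)
qed

context dyadic
begin

section \<open>Inverses modulo P and an inverse of the ideal P\<close>

abbreviation unit_at :: "'k \<Rightarrow> bool" where
  "unit_at s \<equiv> algebraic_int s \<and> s \<notin> P"

lemma unit_at_mult: "unit_at s \<Longrightarrow> unit_at t \<Longrightarrow> unit_at (s * t)"
  using P_prime by blast

lemma unit_at_power: "unit_at s \<Longrightarrow> unit_at (s ^ k)"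
  by (induction k) (simp_all add: P_one unit_at_mult)

lemma P_zero: "0 \<in> P" using P_mult[OF P_two, of 0] by simp

lemma P_minus: "x \<in> P \<Longrightarrow> - x \<in> P" using P_mult[of x "-1"] by simp

lemma P_mult_left: "x \<in> P \<Longrightarrow> algebraic_int y \<Longrightarrow> y * x \<in> P"
  using P_mult[of x y] by (simp add: mult.commute)

lemma P_half: "algebraic_int (x / 2) \<Longrightarrow> x \<in> P"
  using P_mult[OF P_two, of "x / 2"] by simp

text \<open>Two powers of \<open>s\<close> agree modulo 2, hence modulo \<open>P\<close>. Cancelling
  the smaller one, which lies outside the prime, exhibits a power of \<open>s\<close> as the
  inverse.\<close>

lemma unit_at_inverse:
  assumes "unit_at s"
  shows "\<exists>t. algebraic_int t \<and> 1 - s * t \<in> P"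
proof -
  obtain f :: "'k \<Rightarrow> nat set" where f: "finite (range f)"
    "\<And>x y. algebraic_int x \<Longrightarrow> algebraic_int y \<Longrightarrow> f x = f y \<longleftrightarrow> algebraic_int ((x - y) / 2)"
    using finite_residues_mod_2[OF nf] by blast
  have "finite (range (\<lambda>i::nat. f (s ^ i)))" by (rule finite_subset[OF _ f(1)]) auto
  then have "\<not> inj (\<lambda>i::nat. f (s ^ i))" using finite_imageD infinite_UNIV_nat by blast
  then obtain i j :: nat where "i \<noteq> j" "f (s ^ i) = f (s ^ j)" by (auto simp: inj_on_def)
  then obtain i j :: nat where ij: "i < j" "f (s ^ i) = f (s ^ j)" by (metis linorder_neqE_nat)
  have sp: "unit_at (s ^ i)" for i using assms by (rule unit_at_power)
  have "algebraic_int ((s ^ i - s ^ j) / 2)" using ij(2) f(2) sp by blast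
  then have "s ^ i - s ^ j \<in> P" by (rule P_half)
  moreover have "s ^ i - s ^ j = s ^ i * (1 - s * s ^ (j - i - 1))"
    using ij(1) by (simp add: right_diff_distrib flip: power_add power_Suc)
  ultimately have "s ^ i * (1 - s * s ^ (j - i - 1)) \<in> P" by simp
  moreover have "algebraic_int (1 - s * s ^ (j - i - 1))" using assms by auto
  ultimately have "1 - s * s ^ (j - i - 1) \<in> P" using P_prime sp by blast
  then show ?thesis using sp by blast
qed

text \<open>\<open>Y\<close> consists of the \<open>y\<close> with nonzero image in the localisation
  of O/2O at \<open>P\<close>. Let \<open>y\<close> in \<open>Y\<close> generate a minimal ideal.
  Every \<open>a\<close> in \<open>P\<close> kills its image: otherwise \<open>y\<close> would be
  congruent to \<open>a * y * c\<close> modulo 2, and \<open>1 - a * c\<close>, which is outside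
  \<open>P\<close>, would kill the class of \<open>y\<close>. A single multiplier \<open>s\<close>
  outside \<open>P\<close> then works for all of \<open>P\<close>, and \<open>s * y / 2\<close> is
  the required element.\<close>

lemma ex_inverse_of_prime:
  "\<exists>g. \<not> algebraic_int g \<and> (\<forall>p\<in>P. algebraic_int (g * p))"
proof -
  define Y where "Y = {y. algebraic_int y \<and> (\<forall>s. unit_at s \<longrightarrow> \<not> algebraic_int (s * y / 2))}"
  have "1 \<in> Y" unfolding Y_def using P_half by auto
  then obtain y where y: "y \<in> Y" and min: "\<And>a. algebraic_int a \<Longrightarrow> a * y \<in> Y \<Longrightarrow>
      \<exists>c. algebraic_int c \<and> algebraic_int ((y - a * y * c) / 2)"
    using minimal_mod_2[OF nf, of Y] unfolding Y_def by blast
  have yalg: "algebraic_int y" using y by (simp add: Y_def)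
  have ann: "\<exists>s. unit_at s \<and> algebraic_int (s * a * y / 2)" if a: "a \<in> P" for a
  proof -
    have "a * y \<notin> Y"
    proof
      assume "a * y \<in> Y"
      then obtain c where c: "algebraic_int c" "algebraic_int ((y - a * y * c) / 2)"
        using min[OF P_alg[OF a]] by blast
      have "algebraic_int ((1 - a * c) * y / 2)" using c(2) by (simp add: algebra_simps)
      moreover have "unit_at (1 - a * c)"
      proof
        show "algebraic_int (1 - a * c)" using P_alg[OF a] c(1) by auto
        show "1 - a * c \<notin> P"
        proof
          assume "1 - a * c \<in> P"
          from P_add[OF this P_mult[OF a c(1)]] show False using P_one by simp
        qed
      qed
      ultimately show False using y unfolding Y_def by blast
    qed
    moreover have "algebraic_int (a * y)" using P_alg[OF a] yalg by auto
    ultimately obtain s where "unit_at s" "algebraic_int (s * (a * y) / 2)" unfolding Y_def by blast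
    then show ?thesis by (auto simp: mult.assoc)
  qed
  \<comment> \<open>The product of the individual multipliers serves finitely many \<open>a\<close>
    at once; representatives modulo 2, chosen by \<open>r\<close> below, reduce all of
    \<open>P\<close> to a finite set.\<close>
  have fin: "\<exists>s. unit_at s \<and> (\<forall>a\<in>V. algebraic_int (s * a * y / 2))" if "finite V" "V \<subseteq> P" for V
    using that
  proof (induction V rule: finite_induct)
    case empty
    show ?case using P_one by (intro exI[of _ 1]) simp
  next
    case (insert a V)
    then obtain s where s: "unit_at s" "\<forall>a\<in>V. algebraic_int (s * a * y / 2)" by blast
    obtain t where t: "unit_at t" "algebraic_int (t * a * y / 2)" using ann insert by blast
    have "algebraic_int (s * t * b * y / 2)" if "b \<in> insert a V" for b
    proof (cases "b = a")
      case True
      have "algebraic_int (s * (t * a * y / 2))" by (rule algebraic_int_mult) (use s t in auto)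
      then show ?thesis using True by (simp add: mult_ac)
    next
      case False
      then have "b \<in> V" using that by blast
      then have "algebraic_int (t * (s * b * y / 2))" by (intro algebraic_int_mult) (use s t in auto)
      then show ?thesis by (simp add: mult_ac)
    qed
    then show ?case using unit_at_mult[OF s(1) t(1)] by blast
  qed
  obtain f :: "'k \<Rightarrow> nat set" where f: "finite (range f)"
    "\<And>x y. algebraic_int x \<Longrightarrow> algebraic_int y \<Longrightarrow> f x = f y \<longleftrightarrow> algebraic_int ((x - y) / 2)"
    using finite_residues_mod_2[OF nf] by blast
  define r where "r v = (SOME a. a \<in> P \<and> f a = v)" for v
  have r: "r (f a) \<in> P \<and> f (r (f a)) = f a" if "a \<in> P" for a
    unfolding r_def using that by (intro someI[of "\<lambda>b. b \<in> P \<and> f b = f a" a]) simp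
  have "finite (f ` P)" by (rule finite_subset[OF _ f(1)]) auto
  then have "finite (r ` f ` P)" by (rule finite_imageI)
  moreover have "r ` f ` P \<subseteq> P" using r by blast
  ultimately obtain s where s: "unit_at s" "\<forall>a\<in>r ` f ` P. algebraic_int (s * a * y / 2)"
    using fin by blast
  have "algebraic_int (s * y / 2 * a)" if a: "a \<in> P" for a
  proof -
    have ra: "r (f a) \<in> P" "f (r (f a)) = f a" using r[OF a] by auto
    then have "algebraic_int ((a - r (f a)) / 2)" using f(2)[OF P_alg[OF a] P_alg[OF ra(1)]] by simp
    then have "algebraic_int (s * y * ((a - r (f a)) / 2))"
      using s(1) yalg by (intro algebraic_int_mult) auto
    moreover have "algebraic_int (s * r (f a) * y / 2)" using s(2) a by blast
    ultimately have "algebraic_int (s * y * ((a - r (f a)) / 2) + s * r (f a) * y / 2)"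
      by (rule algebraic_int_add)
    moreover have "s * y * ((a - r (f a)) / 2) + s * r (f a) * y / 2 = s * y / 2 * a"
      by (simp add: field_simps)
    ultimately show ?thesis by (simp only:)
  qed
  moreover have "\<not> algebraic_int (s * y / 2)" using y s(1) unfolding Y_def by blast
  ultimately show ?thesis by blast
qed

text \<open>If \<open>g\<close> mapped \<open>P\<close> into itself, all \<open>g ^ k * 2\<close>
  would be integral, and then so would be \<open>g\<close>.\<close>

lemma ex_uniformizer:
  assumes "\<not> algebraic_int g" "\<And>p. p \<in> P \<Longrightarrow> algebraic_int (g * p)"
  shows "\<exists>p\<in>P. g * p \<notin> P"
proof (rule ccontr)
  assume "\<not> ?thesis"
  then have stable: "g * p \<in> P" if "p \<in> P" for p using that by blast
  have "g ^ k * 2 \<in> P" for k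
  proof (induction k)
    case (Suc k)
    from stable[OF this] show ?case by (simp add: mult.assoc)
  qed (simp add: P_two)
  then have "algebraic_int g" using algebraic_int_if_almost_integral[OF nf, of 2 g] P_alg by simp
  then show False using assms(1) by blast
qed

section \<open>Powers of P and the order of an integer\<close>

definition Ppow :: "nat \<Rightarrow> 'k set" where
  "Ppow k = P [^]\<^bsub>ideals_set integers_rec\<^esub> k"

lemma Ppow_0: "Ppow 0 = {x. algebraic_int x}"
  by (simp add: Ppow_def nat_pow_def ideals_set_def)

lemma Ppow_Suc: "Ppow (Suc k) = ideal_prod integers_rec (Ppow k) P"
  by (simp add: Ppow_def nat_pow_def ideals_set_def)

lemma Ppow_add: "x \<in> Ppow k \<Longrightarrow> y \<in> Ppow k \<Longrightarrow> x + y \<in> Ppow k"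
proof (cases k)
  case (Suc l)
  assume "x \<in> Ppow k" "y \<in> Ppow k"
  then show ?thesis
    using ideal_prod.sum[of x integers_rec "Ppow l" P y] by (simp add: Suc Ppow_Suc integers_rec_simps)
qed (auto simp: Ppow_0)

lemma Ppow_prodI: "x \<in> Ppow k \<Longrightarrow> y \<in> P \<Longrightarrow> x * y \<in> Ppow (Suc k)"
  using ideal_prod.prod[of x "Ppow k" y P integers_rec] by (simp add: Ppow_Suc integers_rec_simps)

lemma Ppow_Suc_induct [consumes 1, case_names prod sum]:
  assumes "x \<in> Ppow (Suc k)"
    and "\<And>a b. a \<in> Ppow k \<Longrightarrow> b \<in> P \<Longrightarrow> Q (a * b)"
    and "\<And>a b. Q a \<Longrightarrow> Q b \<Longrightarrow> Q (a + b)"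
  shows "Q x"
  using assms(1) unfolding Ppow_Suc
proof (induction rule: ideal_prod.induct)
  case (prod i j)
  then show ?case using assms(2) by (simp add: integers_rec_simps)
next
  case (sum s1 s2)
  then show ?case using assms(3) by (simp add: integers_rec_simps)
qed

lemma Ppow_mult: "x \<in> Ppow k \<Longrightarrow> algebraic_int y \<Longrightarrow> x * y \<in> Ppow k"
proof (cases k)
  case (Suc l)
  assume x: "x \<in> Ppow k" and y: "algebraic_int y"
  from x[unfolded Suc] have "x * y \<in> Ppow (Suc l)"
  proof (induction rule: Ppow_Suc_induct)
    case (prod a b)
    from Ppow_prodI[OF prod(1) P_mult[OF prod(2) y]] show ?case by (simp add: mult.assoc)
  next
    case (sum a b)
    from Ppow_add[OF sum] show ?case by (simp add: distrib_right)
  qed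
  then show ?thesis using Suc by simp
qed (auto simp: Ppow_0)

lemma Ppow_Suc_subset: "x \<in> Ppow (Suc k) \<Longrightarrow> x \<in> Ppow k"
  by (induction rule: Ppow_Suc_induct) (auto intro: Ppow_mult Ppow_add P_alg)

lemma Ppow_antimono: "x \<in> Ppow k \<Longrightarrow> l \<le> k \<Longrightarrow> x \<in> Ppow l"
proof (induction k)
  case (Suc k)
  then show ?case using Ppow_Suc_subset by (cases "l = Suc k") auto
qed simp

text \<open>With \<open>t\<close> inverse to \<open>s\<close> modulo \<open>P\<close>, write
  \<open>a\<close> as \<open>a * (1 - s * t) + s * a * t\<close>: the first summand gains a factor
  from \<open>P\<close>, and the second is covered by the assumption.\<close>

lemma Ppow_cancel:
  assumes s: "unit_at s"
  shows "algebraic_int a \<Longrightarrow> s * a \<in> Ppow k \<Longrightarrow> a \<in> Ppow k"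
proof (induction k)
  case (Suc k)
  have a: "a \<in> Ppow k" using Suc Ppow_Suc_subset by blast
  obtain t where t: "algebraic_int t" "1 - s * t \<in> P" using unit_at_inverse[OF s] by blast
  have "a * (1 - s * t) + s * a * t \<in> Ppow (Suc k)"
    by (rule Ppow_add[OF Ppow_prodI[OF a t(2)] Ppow_mult[OF Suc.prems(2) t(1)]])
  then show ?case by (simp add: algebra_simps)
qed (simp add: Ppow_0)

lemma power_Ppow: "p \<in> P \<Longrightarrow> p ^ k \<in> Ppow k"
  by (induction k) (simp_all add: Ppow_0 Ppow_prodI power_Suc2 del: power_Suc)

text \<open>Locally at \<^term>\<open>P\<close> the ideal \<^term>\<open>P\<close> is generated by \<^term>\<open>p\<close>; denominators are powers of the unit \<^term>\<open>s\<close>.\<close>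

definition uniformizer :: "'k \<Rightarrow> 'k \<Rightarrow> bool" where
  "uniformizer p s \<longleftrightarrow> p \<in> P \<and> unit_at s \<and> (\<forall>a\<in>P. \<exists>b. algebraic_int b \<and> s * a = p * b)"

lemma uniformizer_power:
  assumes u: "uniformizer p s"
  shows "a \<in> Ppow k \<Longrightarrow> \<exists>b. algebraic_int b \<and> s ^ k * a = p ^ k * b"
proof (induction k arbitrary: a)
  case 0
  then show ?case by (auto simp: Ppow_0)
next
  case (Suc k)
  from Suc.prems show ?case
  proof (induction rule: Ppow_Suc_induct)
    case (prod a b)
    obtain c where c: "algebraic_int c" "s ^ k * a = p ^ k * c" using Suc.IH[OF prod(1)] by blast
    obtain d where d: "algebraic_int d" "s * b = p * d" using u prod(2) unfolding uniformizer_def by blast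
    have "s ^ Suc k * (a * b) = (s ^ k * a) * (s * b)" by (simp add: mult_ac)
    also have "\<dots> = p ^ Suc k * (c * d)" unfolding c d by (simp add: mult_ac)
    finally show ?case using c d by blast
  next
    case (sum a b)
    then obtain c d where "algebraic_int c" "s ^ Suc k * a = p ^ Suc k * c"
      "algebraic_int d" "s ^ Suc k * b = p ^ Suc k * d" by blast
    then show ?case by (intro exI[of _ "c + d"]) (simp add: distrib_left algebraic_int_add)
  qed
qed

lemma uniformizer_nonzero: "uniformizer p s \<Longrightarrow> p \<noteq> 0"
proof
  assume u: "uniformizer p s" and "p = 0"
  then obtain b where "s * 2 = 0 * b" using P_two unfolding uniformizer_def by blast
  then have "s = 0" by simp
  then show False using u P_zero unfolding uniformizer_def by blast
qed

text \<open>The denominator is \<open>g * p\<close>, which lies outside \<open>P\<close> by the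
  choice of \<open>p\<close>: one has \<open>g * p * a = p * (g * a)\<close>, and
  \<open>g * a\<close> is integral for \<open>a\<close> in \<open>P\<close>.\<close>

lemma ex_uniformizer_pair: "\<exists>p s. uniformizer p s"
proof -
  obtain g where g: "\<not> algebraic_int g" "\<And>p. p \<in> P \<Longrightarrow> algebraic_int (g * p)"
    using ex_inverse_of_prime by blast
  obtain p where p: "p \<in> P" "g * p \<notin> P" using ex_uniformizer[OF g] by blast
  have "uniformizer p (g * p)"
    unfolding uniformizer_def
  proof (intro conjI ballI)
    fix a assume a: "a \<in> P"
    show "\<exists>b. algebraic_int b \<and> g * p * a = p * b"
      using g(2)[OF a] by (intro exI[of _ "g * a"]) (simp add: mult_ac)
  qed (use p g in auto)
  then show ?thesis by blast
qed

text \<open>Since \<open>g ^ k\<close> maps \<open>Ppow k\<close> into the integers, a nonzero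
  element of all these powers would force \<open>g\<close> to be integral.\<close>

lemma Ppow_bounded:
  assumes a: "a \<noteq> 0"
  shows "\<exists>k. a \<notin> Ppow k"
proof (rule ccontr)
  assume "\<not> ?thesis"
  then have all: "a \<in> Ppow k" for k by blast
  obtain g where g: "\<not> algebraic_int g" "\<And>p. p \<in> P \<Longrightarrow> algebraic_int (g * p)"
    using ex_inverse_of_prime by blast
  have "algebraic_int (g ^ k * x)" if "x \<in> Ppow k" for k x
    using that
  proof (induction k arbitrary: x)
    case (Suc k)
    from Suc.prems show ?case
    proof (induction rule: Ppow_Suc_induct)
      case (prod a b)
      have "algebraic_int ((g ^ k * a) * (g * b))"
        using Suc.IH[OF prod(1)] g(2)[OF prod(2)] by (rule algebraic_int_mult)
      then show ?case by (simp add: mult_ac)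
    next
      case (sum a b)
      then show ?case by (simp add: distrib_left algebraic_int_add)
    qed
  qed (simp add: Ppow_0)
  then have "algebraic_int g"
    using algebraic_int_if_almost_integral[OF nf a] all by blast
  then show False using g by blast
qed

text \<open>The order can be read off any expression of \<open>a\<close> as \<open>p ^ k\<close> up
  to factors outside \<open>P\<close>. If \<open>a\<close> were in a higher power of
  \<open>P\<close>, comparing two such expressions and cancelling \<open>p ^ k\<close> would put an
  element outside \<open>P\<close> into \<open>P\<close>.\<close>

lemma ord_integer_eq:
  assumes u: "uniformizer p s0" and a: "algebraic_int a" and st: "unit_at s" "unit_at t"
    and eq: "s * a = p ^ k * t"
  shows "ord_integer P a = k"
  unfolding ord_integer_def Ppow_def[symmetric]
proof (rule Greatest_equality)
  have p: "p \<in> P" and s0: "unit_at s0" using u by (auto simp: uniformizer_def)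
  have "p ^ k * t \<in> Ppow k" using st by (intro Ppow_mult power_Ppow p) simp
  then show "a \<in> Ppow k" using Ppow_cancel[OF st(1) a] eq by simp
  fix m assume m: "a \<in> Ppow m"
  show "m \<le> k"
  proof (rule ccontr)
    assume "\<not> m \<le> k"
    then obtain l where mk: "m = Suc (k + l)" using less_imp_Suc_add by (metis not_le)
    obtain b where b: "algebraic_int b" "s0 ^ m * a = p ^ m * b"
      using uniformizer_power[OF u m] by blast
    have "p ^ k * (s0 ^ m * t) = s0 ^ m * (s * a)" unfolding eq by (simp add: mult_ac)
    also have "\<dots> = s * (p ^ m * b)" unfolding b(2)[symmetric] by (simp add: mult_ac)
    also have "\<dots> = p ^ k * (p * (p ^ l * s * b))"
      unfolding mk by (simp add: power_add mult_ac)
    finally have "s0 ^ m * t = p * (p ^ l * s * b)" using uniformizer_nonzero[OF u] by simp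
    moreover have "p * (p ^ l * s * b) \<in> P" using p P_alg[OF p] b st by (intro P_mult) auto
    moreover have "unit_at (s0 ^ m * t)" by (rule unit_at_mult[OF unit_at_power[OF s0] st(2)])
    ultimately show False by simp
  qed
qed

lemma unit_form:
  assumes u: "uniformizer p s0" and a: "algebraic_int a" "a \<noteq> 0"
  shows "\<exists>s t. unit_at s \<and> unit_at t \<and> s * a = p ^ ord_integer P a * t"
proof -
  have p: "p \<in> P" and s0: "unit_at s0" using u by (auto simp: uniformizer_def)
  obtain m where m: "a \<notin> Ppow m" using Ppow_bounded[OF a(2)] by blast
  have "\<exists>k. a \<in> Ppow k \<and> a \<notin> Ppow (Suc k)"
  proof (rule ccontr)
    assume "\<not> ?thesis"
    then have step: "a \<in> Ppow (Suc k)" if "a \<in> Ppow k" for k using that by blast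
    have "a \<in> Ppow k" for k by (induction k) (use a step in \<open>simp_all add: Ppow_0\<close>)
    then show False using m by blast
  qed
  then obtain k where k: "a \<in> Ppow k" "a \<notin> Ppow (Suc k)" by blast
  obtain b where b: "algebraic_int b" "s0 ^ k * a = p ^ k * b"
    using uniformizer_power[OF u k(1)] by blast
  have "b \<notin> P"
  proof
    assume "b \<in> P"
    then have "p ^ k * b \<in> Ppow (Suc k)" by (rule Ppow_prodI[OF power_Ppow[OF p]])
    then have "s0 ^ k * a \<in> Ppow (Suc k)" using b by simp
    then show False using Ppow_cancel[OF unit_at_power[OF s0] a(1)] k(2) by blast
  qed
  then have "unit_at (s0 ^ k) \<and> unit_at b \<and> s0 ^ k * a = p ^ k * b"
    using b unit_at_power[OF s0] by blast
  moreover from this have "ord_integer P a = k"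
    using ord_integer_eq[OF u a(1), of "s0 ^ k" b k] by blast
  ultimately show ?thesis by blast
qed

lemma ord_integer_mult:
  assumes "algebraic_int a" "a \<noteq> 0" "algebraic_int b" "b \<noteq> 0"
  shows "ord_integer P (a * b) = ord_integer P a + ord_integer P b"
proof -
  obtain p s0 where u: "uniformizer p s0" using ex_uniformizer_pair by blast
  obtain s t where st: "unit_at s" "unit_at t" "s * a = p ^ ord_integer P a * t"
    using unit_form[OF u assms(1,2)] by blast
  obtain s' t' where st': "unit_at s'" "unit_at t'" "s' * b = p ^ ord_integer P b * t'"
    using unit_form[OF u assms(3,4)] by blast
  have "(s * s') * (a * b) = (s * a) * (s' * b)" by (simp add: mult_ac)
  also have "\<dots> = p ^ (ord_integer P a + ord_integer P b) * (t * t')"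
    unfolding st(3) st'(3) by (simp add: power_add mult_ac)
  finally show ?thesis
    by (rule ord_integer_eq[OF u algebraic_int_mult[OF assms(1,3)] unit_at_mult[OF st(1) st'(1)]
      unit_at_mult[OF st(2) st'(2)]])
qed

text \<open>A nonzero element lies in only finitely many of the powers, so \<open>GREATEST\<close>
  in \<open>ord_integer\<close> denotes a true maximum; as the powers decrease, membership becomes
  an inequality.\<close>

lemma ord_integer_ge_iff:
  assumes a: "algebraic_int a" "a \<noteq> 0"
  shows "k \<le> ord_integer P a \<longleftrightarrow> a \<in> Ppow k"
proof -
  obtain m where m: "a \<notin> Ppow m" using Ppow_bounded[OF a(2)] by blast
  have bound: "j \<le> m" if "a \<in> Ppow j" for j
    using m Ppow_antimono[OF that, of m] by linarith
  have "a \<in> Ppow (ord_integer P a)"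
    unfolding ord_integer_def Ppow_def[symmetric]
    by (rule GreatestI_nat[of "\<lambda>k. a \<in> Ppow k" 0 m]) (use a bound in \<open>simp_all add: Ppow_0\<close>)
  moreover have "k \<le> ord_integer P a" if "a \<in> Ppow k"
    unfolding ord_integer_def Ppow_def[symmetric]
    by (rule Greatest_le_nat[of "\<lambda>k. a \<in> Ppow k" k m]) (use that bound in simp_all)
  ultimately show ?thesis using Ppow_antimono by blast
qed

section \<open>The valuation on the field\<close>

lemma ord_at_0: "ord_at P 0 = \<infinity>"
  by (simp add: ord_at_def)

text \<open>Cross-multiplying two fractions for one element and using additivity of the order shows
  that the definite description in \<open>ord_at\<close> has a unique solution.\<close>

lemma ord_at_quotient:
  assumes a: "algebraic_int a" "a \<noteq> 0" and b: "algebraic_int b" "b \<noteq> 0"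
  shows "ord_at P (a / b) = ereal (real (ord_integer P a) - real (ord_integer P b))"
proof -
  have "(THE v. \<exists>c\<in>ring_of_integers - {0}. \<exists>d\<in>ring_of_integers - {0}. a / b = c / d \<and>
       v = ereal (real (ord_integer P c) - real (ord_integer P d))) =
    ereal (real (ord_integer P a) - real (ord_integer P b))"
  proof (rule the_equality)
    show "\<exists>c\<in>ring_of_integers - {0}. \<exists>d\<in>ring_of_integers - {0}. a / b = c / d \<and>
       ereal (real (ord_integer P a) - real (ord_integer P b)) =
       ereal (real (ord_integer P c) - real (ord_integer P d))"
      using a b by (intro bexI[of _ a] bexI[of _ b]) auto
    fix v
    assume "\<exists>c\<in>ring_of_integers - {0}. \<exists>d\<in>ring_of_integers - {0}. a / b = c / d \<and>
       v = ereal (real (ord_integer P c) - real (ord_integer P d))"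
    then obtain c d where c: "algebraic_int c" "c \<noteq> 0" and d: "algebraic_int d" "d \<noteq> 0"
      and eq: "a / b = c / d" and v: "v = ereal (real (ord_integer P c) - real (ord_integer P d))"
      by blast
    have "a * d = c * b" using eq b d by (simp add: frac_eq_eq)
    then have "ord_integer P a + ord_integer P d = ord_integer P c + ord_integer P b"
      using ord_integer_mult[OF a d] ord_integer_mult[OF c b] by simp
    then have "real (ord_integer P a) + real (ord_integer P d) = real (ord_integer P c) + real (ord_integer P b)"
      by (simp only: of_nat_add[symmetric])
    then have "real (ord_integer P c) - real (ord_integer P d) = real (ord_integer P a) - real (ord_integer P b)"
      by simp
    then show "v = ereal (real (ord_integer P a) - real (ord_integer P b))" using v by simp
  qed
  then show ?thesis using a b by (simp add: ord_at_def)
qed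

lemma quotient_form:
  obtains a b where "algebraic_int a" "algebraic_int b" "b \<noteq> 0" "(x :: 'k) = a / b"
proof -
  obtain N :: int where N: "N \<noteq> 0" "algebraic_int (of_int N * x)"
    using integral_multiple[OF nf] by blast
  have "x = of_int N * x / of_int N" using N(1) by simp
  then show ?thesis using that[of "of_int N * x" "of_int N"] N by simp
qed

lemma ord_at_integer:
  assumes "algebraic_int a" "a \<noteq> 0"
  shows "ord_at P a = ereal (real (ord_integer P a))"
proof -
  have "ord_integer P 1 = 0"
    using ord_integer_mult[of 1 1] by simp
  then show ?thesis using ord_at_quotient[OF assms, of 1] by simp
qed

lemma ord_at_int: "x \<noteq> 0 \<Longrightarrow> \<exists>n::int. ord_at P x = ereal (of_int n)"
proof -
  assume x: "x \<noteq> 0"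
  obtain a b where ab: "algebraic_int a" "algebraic_int b" "b \<noteq> 0" "x = a / b"
    by (rule quotient_form)
  then have "a \<noteq> 0" using x by auto
  then have "ord_at P x = ereal (of_int (int (ord_integer P a) - int (ord_integer P b)))"
    using ord_at_quotient[of a b] ab by simp
  then show ?thesis by blast
qed

lemma ord_at_mult: "ord_at P (x * y) = ord_at P x + ord_at P y"
proof (cases "x = 0 \<or> y = 0")
  case True
  have "ord_at P z \<noteq> -\<infinity>" for z using ord_at_int[of z] by (cases "z = 0") (auto simp: ord_at_0)
  then show ?thesis using True by (auto simp: ord_at_0)
next
  case False
  obtain a b where ab: "algebraic_int a" "algebraic_int b" "b \<noteq> 0" "x = a / b" by (rule quotient_form)
  obtain c d where cd: "algebraic_int c" "algebraic_int d" "d \<noteq> 0" "y = c / d" by (rule quotient_form)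
  have nz: "a \<noteq> 0" "c \<noteq> 0" using False ab cd by auto
  have "ord_at P (x * y) = ord_at P ((a * c) / (b * d))" using ab cd by simp
  also have "\<dots> = ereal (real (ord_integer P (a * c)) - real (ord_integer P (b * d)))"
    using ab cd nz by (intro ord_at_quotient) auto
  also have "\<dots> = ord_at P x + ord_at P y"
    using ab cd nz by (simp add: ord_at_quotient ord_integer_mult)
  finally show ?thesis .
qed

lemma ord_at_add: "min (ord_at P x) (ord_at P y) \<le> ord_at P (x + y)"
proof (cases "x = 0 \<or> y = 0 \<or> x + y = 0")
  case True
  then show ?thesis by (auto simp: ord_at_0)
next
  case False
  obtain a b where ab: "algebraic_int a" "algebraic_int b" "b \<noteq> 0" "x = a / b" by (rule quotient_form)
  obtain c d where cd: "algebraic_int c" "algebraic_int d" "d \<noteq> 0" "y = c / d" by (rule quotient_form)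
  define e f g where "e = a * d" and "f = c * b" and "g = b * d"
  have alg: "algebraic_int e" "algebraic_int f" "algebraic_int g" using ab cd by (auto simp: e_def f_def g_def)
  have x: "x = e / g" and y: "y = f / g" using ab cd by (simp_all add: e_def f_def g_def)
  have nz: "e \<noteq> 0" "f \<noteq> 0" "g \<noteq> 0" using False x y by auto
  have xy: "x + y = (e + f) / g" unfolding x y by (simp add: add_divide_distrib)
  have nz': "e + f \<noteq> 0" using False xy by auto
  have alg': "algebraic_int (e + f)" using alg by auto
  define k where "k = min (ord_integer P e) (ord_integer P f)"
  have "e \<in> Ppow k" by (rule iffD1[OF ord_integer_ge_iff[OF alg(1) nz(1)]]) (simp add: k_def)
  moreover have "f \<in> Ppow k" by (rule iffD1[OF ord_integer_ge_iff[OF alg(2) nz(2)]]) (simp add: k_def)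
  ultimately have "e + f \<in> Ppow k" by (rule Ppow_add)
  then have "k \<le> ord_integer P (e + f)"
    using ord_integer_ge_iff[OF alg' nz'] by blast
  then have "real k \<le> real (ord_integer P (e + f))" by simp
  then show ?thesis
    unfolding xy ord_at_quotient[OF alg' nz' alg(3) nz(3)] unfolding x y
    using ord_at_quotient[OF alg(1) nz(1) alg(3) nz(3)] ord_at_quotient[OF alg(2) nz(2) alg(3) nz(3)]
    by (simp add: k_def min_def split: if_splits)
qed

lemma ord_at_nonneg: "algebraic_int x \<Longrightarrow> 0 \<le> ord_at P x"
  using ord_at_integer[of x] by (cases "x = 0") (simp_all add: ord_at_0)

lemma ord_at_prime: "x \<in> P \<Longrightarrow> 1 \<le> ord_at P x"
proof (cases "x = 0")
  case False
  assume "x \<in> P"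
  then have "x ^ 1 \<in> Ppow 1" by (rule power_Ppow)
  then have "1 \<le> ord_integer P x" using ord_integer_ge_iff[of x 1] P_alg[OF \<open>x \<in> P\<close>] False by simp
  then have "ereal 1 \<le> ereal (real (ord_integer P x))" by simp
  then show ?thesis using ord_at_integer[OF P_alg[OF \<open>x \<in> P\<close>] False] by (simp add: one_ereal_def)
qed (simp add: ord_at_0)

lemma ex_ord_at_1: "\<exists>p\<in>P. ord_at P p = 1"
proof -
  obtain p s where u: "uniformizer p s" using ex_uniformizer_pair by blast
  have p: "p \<in> P" using u by (simp add: uniformizer_def)
  have "ord_integer P p = 1"
    by (rule ord_integer_eq[OF u P_alg[OF p], of 1 1]) (simp_all add: P_one)
  then have "ord_at P p = 1"
    using ord_at_integer[OF P_alg[OF p] uniformizer_nonzero[OF u]] by (simp add: one_ereal_def)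
  then show ?thesis using p by blast
qed

text \<open>If \<open>z\<close> were in \<open>P\<close>, then for a suitable \<open>p\<close> in
  \<open>P\<close> the product \<open>z * p\<close>, which is 2 times an element outside
  \<open>P\<close>, would lie in the square of \<open>P\<close>. Hence 2 would lie there too, and
  its order would be at least 2.\<close>

lemma annihilator_not_in_prime:
  assumes ord: "ord_at P 2 = 1" and z: "algebraic_int z" "\<not> algebraic_int (z / 2)"
    and ann: "\<And>p. p \<in> P \<Longrightarrow> algebraic_int (z * p / 2)"
  shows "z \<notin> P"
proof
  assume zP: "z \<in> P"
  obtain p where p: "p \<in> P" "z / 2 * p \<notin> P"
    using ex_uniformizer[of "z / 2"] z ann by auto
  have s: "unit_at (z / 2 * p)" using p ann[of p] by simp
  have "z ^ 1 \<in> Ppow 1" using zP by (rule power_Ppow)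
  then have "z * p \<in> Ppow (Suc 1)" using p(1) by (intro Ppow_prodI) simp_all
  then have "(z / 2 * p) * 2 \<in> Ppow (Suc 1)" by simp
  then have "2 \<in> Ppow (Suc 1)" by (rule Ppow_cancel[OF s algebraic_int_numeral])
  then have "Suc 1 \<le> ord_integer P 2" using ord_integer_ge_iff[of 2 "Suc 1"] by simp
  then show False using ord ord_at_integer[of 2] by (simp add: one_ereal_def)
qed

end

section \<open>Traces modulo an unramified dyadic prime\<close>

context dyadic
begin

text \<open>Integrality of both sides is part of the relation, so the rules for sums, products and
  powers have no side conditions and chains of congruences compose.\<close>

definition pcong :: "'k \<Rightarrow> 'k \<Rightarrow> bool" (infix "\<doteq>" 50) where
  "x \<doteq> y \<longleftrightarrow> algebraic_int x \<and> algebraic_int y \<and> x - y \<in> P"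

lemma pcong_alg: "x \<doteq> y \<Longrightarrow> algebraic_int x" "x \<doteq> y \<Longrightarrow> algebraic_int y"
  by (simp_all add: pcong_def)

lemma pcong_refl: "algebraic_int x \<Longrightarrow> x \<doteq> x"
  by (simp add: pcong_def P_zero)

lemma pcong_sym: "x \<doteq> y \<Longrightarrow> y \<doteq> x"
  using P_minus[of "x - y"] by (simp add: pcong_def)

lemma pcong_trans [trans]: "x \<doteq> y \<Longrightarrow> y \<doteq> z \<Longrightarrow> x \<doteq> z"
  using P_add[of "x - y" "y - z"] by (simp add: pcong_def)

lemma pcong_add: "x \<doteq> y \<Longrightarrow> x' \<doteq> y' \<Longrightarrow> x + x' \<doteq> y + y'"
  using P_add[of "x - y" "x' - y'"] by (simp add: pcong_def algebraic_int_add algebra_simps)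

lemma pcong_mult: "x \<doteq> y \<Longrightarrow> x' \<doteq> y' \<Longrightarrow> x * x' \<doteq> y * y'"
proof -
  assume a: "x \<doteq> y" "x' \<doteq> y'"
  have "(x - y) * x' + y * (x' - y') \<in> P"
    using a unfolding pcong_def by (intro P_add P_mult P_mult_left) auto
  moreover have "(x - y) * x' + y * (x' - y') = x * x' - y * y'" by (simp add: algebra_simps)
  ultimately show ?thesis using a by (simp add: pcong_def algebraic_int_mult)
qed

lemma pcong_power: "x \<doteq> y \<Longrightarrow> x ^ n \<doteq> y ^ n"
  by (induction n) (simp_all add: pcong_refl pcong_mult)

lemma pcong_sum: "(\<And>i. i \<in> I \<Longrightarrow> f i \<doteq> g i) \<Longrightarrow> (\<Sum>i\<in>I. f i) \<doteq> (\<Sum>i\<in>I. g i)"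
  by (induction I rule: infinite_finite_induct) (simp_all add: pcong_refl pcong_add)

lemma pcong_P: "x \<in> P \<Longrightarrow> x \<doteq> 0"
  by (simp add: pcong_def P_alg)

lemma pcong_in_P: "x \<doteq> y \<Longrightarrow> y \<in> P \<Longrightarrow> x \<in> P"
  using P_add[of "x - y" y] by (simp add: pcong_def)

lemma pcong_neg: "algebraic_int x \<Longrightarrow> - x \<doteq> x"
proof -
  assume x: "algebraic_int x"
  have "- (2 * x) \<in> P" by (intro P_minus P_mult P_two x)
  then show ?thesis using x by (simp add: pcong_def)
qed

lemma frobenius_add: "algebraic_int x \<Longrightarrow> algebraic_int y \<Longrightarrow> (x + y) ^ (2 ^ i) \<doteq> x ^ (2 ^ i) + y ^ (2 ^ i)"
proof (induction i)
  case (Suc i)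
  have sq: "(a + b) ^ 2 \<doteq> a ^ 2 + b ^ 2" if "algebraic_int a" "algebraic_int b" for a b
  proof -
    have "2 * (a * b) \<in> P" using that by (intro P_mult P_two) auto
    moreover have "(a + b) ^ 2 - (a ^ 2 + b ^ 2) = 2 * (a * b)" by (simp add: power2_eq_square algebra_simps)
    ultimately show ?thesis using that by (simp add: pcong_def algebraic_int_add algebraic_int_power)
  qed
  have "(x + y) ^ 2 ^ Suc i = ((x + y) ^ 2 ^ i) ^ 2" by (simp flip: power_mult add: mult.commute)
  also have "\<dots> \<doteq> (x ^ 2 ^ i + y ^ 2 ^ i) ^ 2" by (rule pcong_power) (rule Suc.IH[OF Suc.prems])
  also have "\<dots> \<doteq> (x ^ 2 ^ i) ^ 2 + (y ^ 2 ^ i) ^ 2" using Suc.prems by (intro sq) auto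
  also have "(x ^ 2 ^ i) ^ 2 + (y ^ 2 ^ i) ^ 2 = x ^ 2 ^ Suc i + y ^ 2 ^ Suc i"
    by (simp flip: power_mult add: mult.commute)
  finally show ?case .
qed (simp add: pcong_refl algebraic_int_add)

lemma P_power: "algebraic_int x \<Longrightarrow> x ^ n \<in> P \<Longrightarrow> x \<in> P"
  using unit_at_power by blast

section \<open>Representatives of the residue field\<close>

lemma ex_residue_system:
  "\<exists>\<rho>. finite (\<rho> ` ring_of_integers) \<and> (\<forall>x. algebraic_int x \<longrightarrow> x \<doteq> \<rho> x) \<and>
    (\<forall>x y. x \<doteq> y \<longrightarrow> \<rho> x = \<rho> y)"
proof -
  obtain f :: "'k \<Rightarrow> nat set" where f: "finite (range f)"
    "\<And>x y. algebraic_int x \<Longrightarrow> algebraic_int y \<Longrightarrow> f x = f y \<longleftrightarrow> algebraic_int ((x - y) / 2)"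
    using finite_residues_mod_2[OF nf] by blast
  define \<rho> where "\<rho> x = (SOME y. x \<doteq> y)" for x
  have 1: "x \<doteq> \<rho> x" if "algebraic_int x" for x
    unfolding \<rho>_def using pcong_refl[OF that] by (rule someI)
  have 2: "\<rho> x = \<rho> y" if "x \<doteq> y" for x y
  proof -
    \<comment> \<open>Congruent elements have the same class as a predicate, so the choice operator
      returns one and the same representative.\<close>
    have "(\<lambda>z. x \<doteq> z) = (\<lambda>z. y \<doteq> z)"
      using that pcong_sym pcong_trans by blast
    then show ?thesis unfolding \<rho>_def by simp
  qed
  define g where "g v = (SOME x. algebraic_int x \<and> f x = v)" for v
  have "\<rho> ` ring_of_integers \<subseteq> (\<lambda>v. \<rho> (g v)) ` range f"
  proof
    fix u assume "u \<in> \<rho> ` ring_of_integers"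
    then obtain x where x: "algebraic_int x" "u = \<rho> x" by blast
    have g: "algebraic_int (g (f x)) \<and> f (g (f x)) = f x"
      unfolding g_def by (rule someI[of "\<lambda>y. algebraic_int y \<and> f y = f x" x]) (simp add: x)
    then have "algebraic_int ((x - g (f x)) / 2)" using f(2)[OF x(1), of "g (f x)"] by simp
    then have "x \<doteq> g (f x)" using P_half x(1) g by (simp add: pcong_def)
    then show "u \<in> (\<lambda>v. \<rho> (g v)) ` range f" using 2 x(2) by blast
  qed
  then have "finite (\<rho> ` ring_of_integers)" by (rule finite_subset) (use f(1) in simp)
  then show ?thesis using 1 2 by blast
qed

definition residue :: "'k \<Rightarrow> 'k" where
  "residue = (SOME \<rho>. finite (\<rho> ` ring_of_integers) \<and> (\<forall>x. algebraic_int x \<longrightarrow> x \<doteq> \<rho> x) \<and>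
    (\<forall>x y. x \<doteq> y \<longrightarrow> \<rho> x = \<rho> y))"

definition residues :: "'k set" where
  "residues = residue ` ring_of_integers"

lemma residue_props:
  shows finite_residues: "finite residues"
    and pcong_residue: "algebraic_int x \<Longrightarrow> x \<doteq> residue x"
    and residue_cong: "x \<doteq> y \<Longrightarrow> residue x = residue y"
  using someI_ex[OF ex_residue_system] unfolding residue_def[symmetric] residues_def by blast+

lemma residues_alg: "u \<in> residues \<Longrightarrow> algebraic_int u"
  using pcong_residue pcong_alg unfolding residues_def by blast

lemma residues_inj: "u \<in> residues \<Longrightarrow> v \<in> residues \<Longrightarrow> u \<doteq> v \<Longrightarrow> u = v"
proof -
  assume u: "u \<in> residues" and v: "v \<in> residues" and uv: "u \<doteq> v"
  have fix_residue: "residue w = w" if w: "w \<in> residues" for w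
  proof -
    obtain x where x: "algebraic_int x" "w = residue x" using w unfolding residues_def by blast
    have "residue x = residue w" using residue_cong[OF pcong_residue[OF x(1)]] x by simp
    then show ?thesis using x by simp
  qed
  show ?thesis using residue_cong[OF uv] fix_residue[OF u] fix_residue[OF v] by simp
qed

text \<open>A map that is injective modulo \<open>P\<close> permutes the finite residue field. As
  \<open>g u\<close> may fail to be a chosen representative, it is replaced by one, and the sums
  agree modulo \<open>P\<close>.\<close>

lemma sum_residues_reindex:
  assumes g: "\<And>u. algebraic_int u \<Longrightarrow> algebraic_int (g u)"
    "\<And>u v. algebraic_int u \<Longrightarrow> algebraic_int v \<Longrightarrow> g u \<doteq> g v \<Longrightarrow> u \<doteq> v"
    and h: "\<And>u v. u \<doteq> v \<Longrightarrow> h u \<doteq> h v"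
  shows "(\<Sum>u\<in>residues. h (g u)) \<doteq> (\<Sum>u\<in>residues. h u)"
proof -
  define p where "p u = residue (g u)" for u
  have "inj_on p residues"
  proof (rule inj_onI)
    fix u v assume uv: "u \<in> residues" "v \<in> residues" "p u = p v"
    have gu: "g u \<doteq> p u" unfolding p_def by (rule pcong_residue[OF g(1)[OF residues_alg[OF uv(1)]]])
    have gv: "g v \<doteq> p v" unfolding p_def by (rule pcong_residue[OF g(1)[OF residues_alg[OF uv(2)]]])
    have "g u \<doteq> g v" by (rule pcong_trans[OF gu[unfolded uv(3)] pcong_sym[OF gv]])
    from g(2)[OF residues_alg[OF uv(1)] residues_alg[OF uv(2)] this] show "u = v"
      by (rule residues_inj[OF uv(1,2)])
  qed
  moreover have "p ` residues \<subseteq> residues"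
  proof
    fix v assume "v \<in> p ` residues"
    then obtain u where u: "u \<in> residues" "v = residue (g u)" unfolding p_def by blast
    then show "v \<in> residues" using g(1)[OF residues_alg[OF u(1)]] unfolding residues_def by blast
  qed
  ultimately have bij: "bij_betw p residues residues"
    unfolding bij_betw_def using endo_inj_surj[OF finite_residues, of p] by blast
  have "(\<Sum>u\<in>residues. h (g u)) \<doteq> (\<Sum>u\<in>residues. h (p u))"
    unfolding p_def by (intro pcong_sum h pcong_residue g(1) residues_alg)
  then show ?thesis using sum.reindex_bij_betw[OF bij, of h] by simp
qed

text \<open>Translation by 1 permutes the residue field, so the sum of all residues is congruent to
  itself plus their number.\<close>

lemma card_residues_P: "of_nat (card residues) \<in> P"
proof -
  have "(\<Sum>u\<in>residues. u + 1) \<doteq> (\<Sum>u\<in>residues. u)"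
    by (rule sum_residues_reindex) (auto simp: pcong_def)
  then have "(\<Sum>u\<in>residues. u + 1) - (\<Sum>u\<in>residues. u) \<in> P" by (simp add: pcong_def)
  then show ?thesis by (simp add: sum.distrib)
qed

section \<open>Frobenius powers and the trace of the residue field\<close>

lemma ex_frobenius_period: "\<exists>r>0. \<forall>x. algebraic_int x \<longrightarrow> x ^ (2 ^ r) \<doteq> x"
proof -
  \<comment> \<open>\<open>F i\<close> is the i-th power of Frobenius as a self-map of a finite set,
    so two of these maps coincide.\<close>
  define F where "F i = (\<lambda>u\<in>residues. residue (u ^ (2 ^ i)))" for i :: nat
  have "F i \<in> residues \<rightarrow>\<^sub>E residues" for i
    unfolding F_def
  proof (intro PiE_I)
    fix u assume u: "u \<in> residues"
    then have "algebraic_int (u ^ (2 ^ i))" by (intro algebraic_int_power residues_alg)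
    then have "residue (u ^ (2 ^ i)) \<in> residues" unfolding residues_def by blast
    then show "(\<lambda>u\<in>residues. residue (u ^ (2 ^ i))) u \<in> residues" using u by simp
  qed simp
  moreover have "finite (residues \<rightarrow>\<^sub>E residues)"
    by (intro finite_PiE finite_residues)
  ultimately have "finite (range F)"
    by (intro finite_subset[of "range F" "residues \<rightarrow>\<^sub>E residues"]) blast+
  then have "\<not> inj F" using finite_imageD infinite_UNIV_nat by blast
  then obtain i j where "i \<noteq> j" "F i = F j" by (auto simp: inj_on_def)
  then obtain i j where ij: "i < j" "F i = F j" by (metis linorder_neqE_nat)
  have "x ^ (2 ^ (j - i)) \<doteq> x" if x: "algebraic_int x" for x
  proof -
    define u where "u = residue x"
    have u: "u \<in> residues" "x \<doteq> u" "algebraic_int u"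
    proof -
      show "u \<in> residues" using x unfolding u_def residues_def by blast
      then show "algebraic_int u" by (rule residues_alg)
      show "x \<doteq> u" unfolding u_def by (rule pcong_residue[OF x])
    qed
    have "F i u = F j u" using ij by simp
    then have "residue (u ^ 2 ^ i) = residue (u ^ 2 ^ j)" using u(1) by (simp add: F_def)
    moreover have c: "u ^ 2 ^ l \<doteq> residue (u ^ 2 ^ l)" for l
      by (intro pcong_residue algebraic_int_power u(3))
    ultimately have "u ^ 2 ^ j \<doteq> residue (u ^ 2 ^ i)" using c[of j] by (simp only:)
    then have ij': "u ^ 2 ^ j \<doteq> u ^ 2 ^ i" using pcong_sym[OF c[of i]] by (rule pcong_trans)
    define d where "d = u ^ 2 ^ (j - i)"
    have d: "algebraic_int d" using u(3) by (auto simp: d_def)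
    have "d ^ 2 ^ i = u ^ 2 ^ j"
    proof -
      have "2 ^ (j - i) * 2 ^ i = (2::nat) ^ j" using ij(1) unfolding power_add[symmetric] by simp
      then show ?thesis unfolding d_def power_mult[symmetric] by (simp only:)
    qed
    \<comment> \<open>Frobenius is injective: a power of the difference of \<open>d\<close> and
      \<open>u\<close> vanishes, so the difference does. It is written as a sum in order to apply
      \<open>frobenius_add\<close>; the sign disappears in characteristic 2.\<close>
    have "(d + - u) ^ 2 ^ i \<doteq> d ^ 2 ^ i + (- u) ^ 2 ^ i"
      by (rule frobenius_add[OF d]) (simp add: u(3))
    also have "\<dots> \<doteq> u ^ 2 ^ i + u ^ 2 ^ i"
      unfolding \<open>d ^ 2 ^ i = u ^ 2 ^ j\<close> by (intro pcong_add ij' pcong_power pcong_neg u(3))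
    also have "u ^ 2 ^ i + u ^ 2 ^ i = 2 * u ^ 2 ^ i" by simp
    finally have "(d + - u) ^ 2 ^ i \<in> P"
      by (rule pcong_in_P) (rule P_mult[OF P_two algebraic_int_power[OF u(3)]])
    moreover have "algebraic_int (d + - u)" by (intro algebraic_int_add d algebraic_int_minus u(3))
    ultimately have "d - u \<in> P" using P_power[of "d + - u"] by simp
    then have "d \<doteq> u" using d u(3) by (simp add: pcong_def)
    have "x ^ 2 ^ (j - i) \<doteq> d" unfolding d_def by (rule pcong_power[OF u(2)])
    also note \<open>d \<doteq> u\<close>
    also have "u \<doteq> x" by (rule pcong_sym[OF u(2)])
    finally show ?thesis .
  qed
  then show ?thesis using ij(1) by (intro exI[of _ "j - i"]) auto
qed

text \<open>The order of Frobenius on the residue field, that is, the residue degree over the field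
  with two elements. Being least, it provides for every smaller positive exponent an element that
  the corresponding Frobenius power moves.\<close>

definition period :: nat where
  "period = (LEAST r. 0 < r \<and> (\<forall>x. algebraic_int x \<longrightarrow> x ^ (2 ^ r) \<doteq> x))"

lemma period_pos: "0 < period"
  and pcong_power_period: "algebraic_int x \<Longrightarrow> x ^ (2 ^ period) \<doteq> x"
  using LeastI_ex[OF ex_frobenius_period] unfolding period_def by blast+

lemma period_minimal:
  assumes "0 < i" "i < period"
  shows "\<exists>x. algebraic_int x \<and> \<not> x ^ (2 ^ i) \<doteq> x"
proof (rule ccontr)
  assume "\<not> ?thesis"
  then have "period \<le> i" unfolding period_def using assms(1) by (intro Least_le) blast
  then show False using assms(2) by simp
qed

text \<open>The trace of the residue field over the field with two elements.\<close>

definition rtrace :: "'k \<Rightarrow> 'k" where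
  "rtrace x = (\<Sum>i<period. x ^ (2 ^ i))"

lemma rtrace_alg: "algebraic_int x \<Longrightarrow> algebraic_int (rtrace x)"
  by (auto simp: rtrace_def)

lemma rtrace_cong: "x \<doteq> y \<Longrightarrow> rtrace x \<doteq> rtrace y"
  unfolding rtrace_def by (intro pcong_sum pcong_power)

lemma rtrace_0: "rtrace 0 = 0"
  by (simp add: rtrace_def power_0_left)

lemma rtrace_P: "x \<in> P \<Longrightarrow> rtrace x \<in> P"
proof -
  assume "x \<in> P"
  then have "rtrace x \<doteq> rtrace 0" by (intro rtrace_cong pcong_P)
  then have "rtrace x \<doteq> 0" by (simp only: rtrace_0)
  then show ?thesis using pcong_in_P P_zero by blast
qed

lemma rtrace_add: "algebraic_int x \<Longrightarrow> algebraic_int y \<Longrightarrow> rtrace (x + y) \<doteq> rtrace x + rtrace y"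
  unfolding rtrace_def sum.distrib[symmetric] by (intro pcong_sum frobenius_add)

lemma rtrace_sum:
  "(\<And>i. i \<in> I \<Longrightarrow> algebraic_int (f i)) \<Longrightarrow> rtrace (\<Sum>i\<in>I. f i) \<doteq> (\<Sum>i\<in>I. rtrace (f i))"
proof (induction I rule: infinite_finite_induct)
  case (insert i I)
  have "rtrace (f i + (\<Sum>j\<in>I. f j)) \<doteq> rtrace (f i) + rtrace (\<Sum>j\<in>I. f j)"
    using insert by (intro rtrace_add) auto
  also have "\<dots> \<doteq> rtrace (f i) + (\<Sum>j\<in>I. rtrace (f j))"
    using insert by (intro pcong_add pcong_refl rtrace_alg) auto
  finally show ?case using insert by simp
qed (simp_all add: rtrace_0 pcong_refl)

text \<open>Modulo \<open>P\<close> both sides depend on the parity of \<open>c\<close> only, and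
  they agree for the multipliers 0 and 1.\<close>

lemma rtrace_int:
  assumes "algebraic_int x"
  shows "rtrace (of_int c * x) \<doteq> of_int c * rtrace x"
proof (cases "even c")
  case True
  then obtain q where "c = 2 * q" by (rule evenE)
  then have "of_int c = (2 :: 'k) * of_int q" by simp
  then have c: "of_int c \<in> P" using P_mult[OF P_two] by simp
  have "rtrace (of_int c * x) \<in> P" "of_int c * rtrace x \<in> P"
    using c assms by (auto intro!: rtrace_P P_mult rtrace_alg)
  then show ?thesis by (rule pcong_trans[OF pcong_P pcong_sym[OF pcong_P]])
next
  case False
  then obtain q where "c = 2 * q + 1" by (rule oddE)
  then have "of_int c - 1 = (2 :: 'k) * of_int q" by simp
  then have "of_int c - 1 \<in> P" using P_mult[OF P_two] by simp
  then have c: "of_int c \<doteq> 1" by (simp add: pcong_def)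
  have "rtrace (of_int c * x) \<doteq> rtrace (1 * x)" by (intro rtrace_cong pcong_mult c pcong_refl assms)
  also have "1 * x = x" by simp
  also have "rtrace x = 1 * rtrace x" by simp
  also have "1 * rtrace x \<doteq> of_int c * rtrace x"
    by (intro pcong_mult pcong_sym[OF c] pcong_refl rtrace_alg assms)
  finally show ?thesis .
qed

text \<open>Squaring permutes the summands of the trace cyclically, by
  \<open>x ^ (2 ^ period) \<doteq> x\<close>. So the trace is congruent to its own square, and
  primality of \<open>P\<close> leaves the values 0 and 1.\<close>

lemma rtrace_01:
  assumes x: "algebraic_int x"
  shows "rtrace x \<in> P \<or> rtrace x \<doteq> 1"
proof -
  have sq: "(\<Sum>i\<in>I. y i) ^ 2 \<doteq> (\<Sum>i\<in>I. y i ^ 2)" if "\<And>i. i \<in> I \<Longrightarrow> algebraic_int (y i)" for I :: "nat set" and y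
    using that
  proof (induction I rule: infinite_finite_induct)
    case (insert i I)
    have "(y i + (\<Sum>j\<in>I. y j)) ^ (2 ^ 1) \<doteq> y i ^ (2 ^ 1) + (\<Sum>j\<in>I. y j) ^ (2 ^ 1)"
      using insert by (intro frobenius_add) auto
    then have "(y i + (\<Sum>j\<in>I. y j)) ^ 2 \<doteq> y i ^ 2 + (\<Sum>j\<in>I. y j) ^ 2" by simp
    also have "\<dots> \<doteq> y i ^ 2 + (\<Sum>j\<in>I. y j ^ 2)"
      using insert by (intro pcong_add pcong_refl) auto
    finally show ?case using insert by simp
  qed (simp_all add: pcong_refl)
  have "rtrace x ^ 2 \<doteq> (\<Sum>i<period. (x ^ 2 ^ i) ^ 2)" unfolding rtrace_def using x by (intro sq) auto
  also have "(\<Sum>i<period. (x ^ 2 ^ i) ^ 2) = (\<Sum>i<period. x ^ 2 ^ Suc i)"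
    by (simp flip: power_mult add: mult.commute)
  also have "(\<Sum>i<period. x ^ 2 ^ Suc i) \<doteq> (\<Sum>i<period. x ^ 2 ^ i)"
  proof -
    have "(\<Sum>i<period. x ^ 2 ^ Suc i) + x ^ 2 ^ 0 = (\<Sum>i<Suc period. x ^ 2 ^ i)"
      by (subst sum.lessThan_Suc_shift) (simp only: add.commute)
    also have "\<dots> = (\<Sum>i<period. x ^ 2 ^ i) + x ^ 2 ^ period" by simp
    finally have "(\<Sum>i<period. x ^ 2 ^ Suc i) - (\<Sum>i<period. x ^ 2 ^ i) = x ^ 2 ^ period - x"
      by (simp add: algebra_simps)
    moreover have "x ^ 2 ^ period - x \<in> P" using pcong_power_period[OF x] by (simp add: pcong_def)
    ultimately have "(\<Sum>i<period. x ^ 2 ^ Suc i) - (\<Sum>i<period. x ^ 2 ^ i) \<in> P" by (simp only:)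
    then show ?thesis unfolding pcong_def using x by (auto simp del: power_Suc)
  qed
  also have "(\<Sum>i<period. x ^ 2 ^ i) = rtrace x" by (simp add: rtrace_def)
  finally have "rtrace x ^ 2 - rtrace x \<in> P" by (simp add: pcong_def)
  then have "rtrace x * (rtrace x - 1) \<in> P" by (simp add: power2_eq_square algebra_simps)
  then have "rtrace x \<in> P \<or> rtrace x - 1 \<in> P" using rtrace_alg[OF x] by (intro P_prime) auto
  then show ?thesis using rtrace_alg[OF x] by (auto simp: pcong_def)
qed

section \<open>Inverses and power sums over the residue field\<close>

definition rinv :: "'k \<Rightarrow> 'k" where
  "rinv u = (if unit_at u then SOME t. algebraic_int t \<and> u * t \<doteq> 1 else 0)"

lemma rinv_unit:
  assumes "unit_at u"
  shows "algebraic_int (rinv u) \<and> u * rinv u \<doteq> 1"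
proof -
  obtain t where t: "algebraic_int t" "1 - u * t \<in> P" using unit_at_inverse[OF assms] by blast
  have "1 \<doteq> u * t" using t assms by (auto simp: pcong_def)
  then have "algebraic_int t \<and> u * t \<doteq> 1" using t pcong_sym by blast
  then have "algebraic_int (SOME t. algebraic_int t \<and> u * t \<doteq> 1) \<and>
      u * (SOME t. algebraic_int t \<and> u * t \<doteq> 1) \<doteq> 1"
    by (rule someI)
  then show ?thesis using assms by (simp add: rinv_def)
qed

lemma rinv_alg: "algebraic_int (rinv u)"
  using rinv_unit by (cases "unit_at u") (auto simp: rinv_def)

text \<open>With this default value the zero class contributes nothing, so sums over the nonzero
  residues can run over all of \<open>residues\<close>.\<close>

lemma rinv_P: "u \<in> P \<Longrightarrow> rinv u = 0"
  by (simp add: rinv_def)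

lemma rinv_unique:
  assumes "unit_at u" "algebraic_int t" "u * t \<doteq> 1"
  shows "t \<doteq> rinv u"
proof -
  have "t = 1 * t" by simp
  also have "1 * t \<doteq> (u * rinv u) * t"
    using rinv_unit[OF assms(1)] by (intro pcong_mult[OF pcong_sym pcong_refl[OF assms(2)]]) blast
  also have "(u * rinv u) * t = (u * t) * rinv u" by (simp add: mult_ac)
  also have "\<dots> \<doteq> 1 * rinv u" by (intro pcong_mult pcong_refl assms(3) rinv_alg)
  also have "1 * rinv u = rinv u" by simp
  finally show ?thesis .
qed

lemma rinv_cong: "u \<doteq> v \<Longrightarrow> rinv u \<doteq> rinv v"
proof (cases "u \<in> P")
  case True
  assume "u \<doteq> v"
  then have "v \<in> P" using pcong_in_P[OF pcong_sym] True by blast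
  then show ?thesis using True by (simp add: rinv_P pcong_refl)
next
  case False
  assume uv: "u \<doteq> v"
  then have u: "unit_at u" using False pcong_alg by blast
  have v: "unit_at v" using False pcong_alg pcong_in_P uv by blast
  show ?thesis
  proof (rule rinv_unique[OF v rinv_alg])
    have "v * rinv u \<doteq> u * rinv u" by (intro pcong_mult pcong_sym[OF uv] pcong_refl rinv_alg)
    also have "\<dots> \<doteq> 1" using rinv_unit[OF u] by blast
    finally show "v * rinv u \<doteq> 1" .
  qed
qed

lemma rinv_mult:
  assumes g: "unit_at g" and u: "algebraic_int u"
  shows "rinv (g * u) \<doteq> rinv g * rinv u"
proof (cases "u \<in> P")
  case True
  then have "g * u \<in> P" using g by (intro P_mult_left) auto
  then show ?thesis using True by (simp add: rinv_P pcong_refl)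
next
  case False
  then have u: "unit_at u" using u by blast
  have "g * u * (rinv g * rinv u) = (g * rinv g) * (u * rinv u)" by (simp add: mult_ac)
  also have "\<dots> \<doteq> 1 * 1" using rinv_unit g u by (intro pcong_mult) auto
  finally have "g * u * (rinv g * rinv u) \<doteq> 1" by simp
  then show ?thesis
    by (rule pcong_sym[OF rinv_unique[OF unit_at_mult[OF g u] algebraic_int_mult[OF rinv_alg rinv_alg]]])
qed

text \<open>The number of residues is 0 modulo \<open>P\<close>, so the nonzero ones number -1,
  which is 1 in characteristic 2.\<close>

lemma sum_residues_unit:
  assumes x: "algebraic_int x"
  shows "(\<Sum>u\<in>residues. if u \<in> P then 0 else x) \<doteq> x"
proof -
  have "residue 0 \<in> residues" by (simp add: residues_def)
  moreover have "residue 0 \<in> P" using pcong_in_P[OF pcong_sym[OF pcong_residue[of 0]] P_zero] by simp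
  moreover have "u = residue 0" if "u \<in> residues" "u \<in> P" for u
    by (rule residues_inj[OF that(1) \<open>residue 0 \<in> residues\<close>
      pcong_trans[OF pcong_P[OF that(2)] pcong_sym[OF pcong_P[OF \<open>residue 0 \<in> P\<close>]]]])
  ultimately have R: "residues = insert (residue 0) {u \<in> residues. u \<notin> P}" by (intro equalityI subsetI) blast+
  define N where "N = {u \<in> residues. u \<notin> P}"
  have N: "finite N" "residue 0 \<notin> N" using finite_residues \<open>residue 0 \<in> P\<close> by (auto simp: N_def)
  have "card residues = card (insert (residue 0) N)" using arg_cong[OF R, of card] unfolding N_def .
  then have "card residues = Suc (card N)" unfolding card_insert_disjoint[OF N] .
  then have "of_nat (card N) + 1 \<in> P" using card_residues_P by (simp add: add.commute)
  then have "of_nat (card N) - (- 1) \<in> P" by simp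
  then have c: "of_nat (card N) \<doteq> - 1" unfolding pcong_def by simp
  have "(\<Sum>u\<in>residues. if u \<in> P then 0 else x) = of_nat (card N) * x"
  proof -
    have "(\<Sum>u\<in>residues. if u \<in> P then 0 else x) = (\<Sum>u\<in>N. x)"
      unfolding N_def by (rule sum.mono_neutral_cong_right) (auto simp: finite_residues)
    then show ?thesis by simp
  qed
  also have "\<dots> \<doteq> (- 1) * x" by (intro pcong_mult c pcong_refl x)
  also have "(- 1) * x = - x" by simp
  also have "- x \<doteq> x" by (rule pcong_neg[OF x])
  finally show ?thesis .
qed

text \<open>Replacing \<open>u\<close> by \<open>g * u\<close> multiplies the sum by
  \<open>g * rinv g ^ q\<close>, where \<open>q\<close> is \<open>2 ^ i\<close>. Minimality of the
  period supplies a \<open>g\<close> not fixed by the q-th power, for which this factor differs from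
  1; so the sum vanishes.\<close>

lemma power_sum_residues:
  assumes "0 < i" "i < period"
  shows "(\<Sum>u\<in>residues. u * rinv u ^ (2 ^ i)) \<in> P"
proof -
  define q :: nat where "q = 2 ^ i"
  define S where "S = (\<Sum>u\<in>residues. u * rinv u ^ q)"
  obtain g where g: "algebraic_int g" "\<not> g ^ q \<doteq> g"
    using period_minimal[OF assms] unfolding q_def by blast
  have gP: "g \<notin> P"
  proof
    assume gP: "g \<in> P"
    have "g ^ q = g * g ^ (q - 1)" by (simp add: q_def flip: power_Suc)
    then have "g ^ q \<in> P" using P_mult[OF gP, of "g ^ (q - 1)"] g(1) by auto
    then show False using pcong_trans[OF pcong_P pcong_sym[OF pcong_P[OF gP]]] g(2) by blast
  qed
  then have gu: "unit_at g" using g(1) by blast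
  have Salg: "algebraic_int S" unfolding S_def
    using rinv_alg residues_alg by (intro algebraic_int_sum algebraic_int_mult algebraic_int_power) auto
  have "(\<Sum>u\<in>residues. (g * u) * rinv (g * u) ^ q) \<doteq> S"
    unfolding S_def
  proof (rule sum_residues_reindex)
    fix u v assume uv: "algebraic_int u" "algebraic_int v" "g * u \<doteq> g * v"
    then have "g * (u - v) \<in> P" by (simp add: pcong_def right_diff_distrib)
    then have "u - v \<in> P" using P_prime[OF g(1), of "u - v"] gP uv by auto
    then show "u \<doteq> v" using uv by (simp add: pcong_def)
  qed (use g in \<open>auto intro!: pcong_mult pcong_power rinv_cong\<close>)
  moreover have "(\<Sum>u\<in>residues. (g * u) * rinv (g * u) ^ q) \<doteq> g * rinv g ^ q * S"
  proof -
    have "(\<Sum>u\<in>residues. (g * u) * rinv (g * u) ^ q) \<doteq> (\<Sum>u\<in>residues. (g * u) * (rinv g * rinv u) ^ q)"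
      using residues_alg g(1) by (intro pcong_sum pcong_mult pcong_power rinv_mult gu pcong_refl) auto
    also have "(\<Sum>u\<in>residues. (g * u) * (rinv g * rinv u) ^ q) = g * rinv g ^ q * S"
      by (simp add: S_def sum_distrib_left power_mult_distrib mult_ac)
    finally show ?thesis .
  qed
  ultimately have "S \<doteq> g * rinv g ^ q * S" by (rule pcong_trans[OF pcong_sym])
  then have "S * (1 - g * rinv g ^ q) \<in> P" by (simp add: pcong_def algebra_simps)
  moreover have "1 - g * rinv g ^ q \<notin> P"
  proof
    assume "1 - g * rinv g ^ q \<in> P"
    then have "1 \<doteq> g * rinv g ^ q" using g(1) rinv_alg by (auto simp: pcong_def)
    then have "1 * g ^ q \<doteq> g * rinv g ^ q * g ^ q" using g(1) by (intro pcong_mult pcong_refl) auto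
    also have "g * rinv g ^ q * g ^ q = g * (g * rinv g) ^ q" by (simp add: power_mult_distrib mult_ac)
    also have "\<dots> \<doteq> g * 1 ^ q" using rinv_unit[OF gu] g(1) by (intro pcong_mult pcong_power pcong_refl) auto
    finally show False using g(2) by simp
  qed
  moreover have "algebraic_int (1 - g * rinv g ^ q)" using g(1) rinv_alg by auto
  ultimately have "S \<in> P" using P_prime[OF Salg] by blast
  then show ?thesis by (simp add: S_def q_def)
qed

text \<open>The identity map of the residue field \<open>k\<close> as a sum of rank one maps: the coefficient of
  \<open>z ^ (2 ^ i)\<close> on the left is a power sum over \<open>k\<close>, which vanishes unless \<open>i = 0\<close>.\<close>

lemma rank_one_expansion:
  assumes z: "algebraic_int z"
  shows "(\<Sum>u\<in>residues. u * rtrace (rinv u * z)) \<doteq> z"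
proof -
  have "(\<Sum>u\<in>residues. u * rtrace (rinv u * z)) =
      (\<Sum>u\<in>residues. \<Sum>i<period. (u * rinv u ^ 2 ^ i) * z ^ 2 ^ i)"
    by (simp add: rtrace_def sum_distrib_left power_mult_distrib mult_ac)
  also have "\<dots> = (\<Sum>i<period. \<Sum>u\<in>residues. (u * rinv u ^ 2 ^ i) * z ^ 2 ^ i)" by (rule sum.swap)
  also have "\<dots> = (\<Sum>i<period. (\<Sum>u\<in>residues. u * rinv u ^ 2 ^ i) * z ^ 2 ^ i)"
    by (simp only: sum_distrib_right)
  also have "\<dots> \<doteq> (\<Sum>i<period. of_bool (i = 0) * z)"
  proof (rule pcong_sum)
    fix i assume i: "i \<in> {..<period}"
    show "(\<Sum>u\<in>residues. u * rinv u ^ 2 ^ i) * z ^ 2 ^ i \<doteq> of_bool (i = 0) * z"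
    proof (cases "i = 0")
      case True
      have "(\<Sum>u\<in>residues. u * rinv u ^ 2 ^ i) \<doteq> (\<Sum>u\<in>residues. if u \<in> P then 0 else 1)"
      proof (rule pcong_sum)
        fix u assume "u \<in> residues"
        then show "u * rinv u ^ 2 ^ i \<doteq> (if u \<in> P then 0 else 1)"
          using True rinv_unit[of u] residues_alg by (auto simp: rinv_P pcong_refl)
      qed
      also have "\<dots> \<doteq> 1" by (rule sum_residues_unit) simp
      finally have "(\<Sum>u\<in>residues. u * rinv u ^ 2 ^ i) * z \<doteq> 1 * z" by (intro pcong_mult pcong_refl z)
      then show ?thesis using True by simp
    next
      case False
      then have "(\<Sum>u\<in>residues. u * rinv u ^ 2 ^ i) \<in> P" using i by (intro power_sum_residues) auto
      then have "(\<Sum>u\<in>residues. u * rinv u ^ 2 ^ i) * z ^ 2 ^ i \<in> P" using z by (intro P_mult) auto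
      then show ?thesis using pcong_P False by simp
    qed
  qed
  also have "(\<Sum>i<period. of_bool (i = 0) * z) = z"
    using period_pos by (simp add: of_bool_def if_distrib[of "\<lambda>b. b * z"] cong: if_cong)
  finally show ?thesis .
qed

text \<open>By the second assumption \<open>e * z\<close> modulo 2 depends only on \<open>z\<close>
  modulo \<open>P\<close>. Expanding \<open>z = x * w i\<close> into rank one terms gives the
  coordinates of \<open>e * z\<close> modulo 2 as sums over residues \<open>u\<close>. After summing
  over \<open>i\<close> and exchanging the sums the basis drops out: each \<open>u\<close> outside
  \<open>P\<close> contributes the residue trace of \<open>rinv u * x * (e * u)\<close>, which is
  that of \<open>x\<close>, and the number of such \<open>u\<close> is odd.\<close>

lemma residue_trace_formula:
  assumes e: "e \<doteq> 1" "\<And>p. p \<in> P \<Longrightarrow> algebraic_int (e * p / 2)" and x: "algebraic_int x"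
  shows "of_rat (field_trace (x * e)) \<doteq> rtrace x"
proof -
  obtain n and w :: "nat \<Rightarrow> 'k" where w: "zfree ring_of_integers n w"
    using ring_of_integers_free[OF nf] by blast
  obtain \<kappa> where \<kappa>: "dual_basis n w \<kappa>" "\<And>x i. algebraic_int x \<Longrightarrow> i < n \<Longrightarrow> \<kappa> i x \<in> \<int>"
    using integral_dual_basis[OF nf w] by blast
  have walg: "algebraic_int (w i)" if "i < n" for i
    using zfree_generator[OF w that] by simp
  have ealg: "algebraic_int e" using e(1) pcong_alg by blast
  define k where "k i y = \<lfloor>\<kappa> i y\<rfloor>" for i y
  have k: "\<kappa> i y = of_int (k i y)" if "i < n" "algebraic_int y" for i y
    unfolding k_def by (rule floor_Ints[OF \<kappa>(2)[OF that(2,1)], symmetric])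
  \<comment> \<open>Coordinate functionals commute with rational scalars only, so the residue trace,
    whose values are 0 and 1, is lifted to an integer.\<close>
  define \<epsilon> :: "'k \<Rightarrow> int" where "\<epsilon> y = (if rtrace y \<in> P then 0 else 1)" for y
  have \<epsilon>: "of_int (\<epsilon> y) \<doteq> rtrace y" if "algebraic_int y" for y
    using rtrace_01[OF that] pcong_P pcong_sym by (auto simp: \<epsilon>_def)
  have coord: "of_rat (\<kappa> i (x * e * w i)) \<doteq>
      (\<Sum>u\<in>residues. rtrace (rinv u * (x * w i)) * of_int (k i (e * u)))" if i: "i < n" for i
  proof -
    define z where "z = x * w i"
    have z: "algebraic_int z" using x walg[OF i] by (auto simp: z_def)
    have "(\<Sum>u\<in>residues. u * of_int (\<epsilon> (rinv u * z))) \<doteq> (\<Sum>u\<in>residues. u * rtrace (rinv u * z))"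
      using residues_alg rinv_alg z by (intro pcong_sum pcong_mult pcong_refl \<epsilon>) auto
    also have "\<dots> \<doteq> z" by (rule rank_one_expansion[OF z])
    finally have "z \<doteq> (\<Sum>u\<in>residues. u * of_int (\<epsilon> (rinv u * z)))" by (rule pcong_sym)
    then have "z - (\<Sum>u\<in>residues. u * of_int (\<epsilon> (rinv u * z))) \<in> P" by (simp add: pcong_def)
    \<comment> \<open>Multiplication by \<open>e\<close> turns the congruence for \<open>z\<close>
      modulo \<open>P\<close> into one for \<open>e * z\<close> modulo 2; \<open>?q\<close> is half
      of the difference.\<close>
    from e(2)[OF this] have q: "algebraic_int (e * (z - (\<Sum>u\<in>residues. u * of_int (\<epsilon> (rinv u * z)))) / 2)"
      (is "algebraic_int ?q") .
    have "e * z = (\<Sum>u\<in>residues. of_int (\<epsilon> (rinv u * z)) * (e * u)) + of_int 2 * ?q"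
    proof -
      have "e * z = e * (\<Sum>u\<in>residues. u * of_int (\<epsilon> (rinv u * z))) + of_int 2 * ?q"
        by (simp add: field_simps)
      moreover have "e * (\<Sum>u\<in>residues. u * of_int (\<epsilon> (rinv u * z))) =
          (\<Sum>u\<in>residues. of_int (\<epsilon> (rinv u * z)) * (e * u))"
        unfolding sum_distrib_left by (intro sum.cong refl) (simp only: mult_ac)
      ultimately show ?thesis by (simp only:)
    qed
    then have "\<kappa> i (e * z) = (\<Sum>u\<in>residues. of_int (\<epsilon> (rinv u * z)) * \<kappa> i (e * u)) + of_int 2 * \<kappa> i ?q"
      by (simp only: dual_basis_add[OF \<kappa>(1) i] dual_basis_sum[OF \<kappa>(1) i] dual_basis_int_scale[OF \<kappa>(1) i])
    also have "\<dots> = (\<Sum>u\<in>residues. of_int (\<epsilon> (rinv u * z) * k i (e * u))) + of_int (2 * k i ?q)"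
      using k[OF i q] residues_alg ealg by (simp add: k[OF i] algebraic_int_mult)
    also have "\<dots> = of_int ((\<Sum>u\<in>residues. \<epsilon> (rinv u * z) * k i (e * u)) + 2 * k i ?q)"
      by (simp only: of_int_add of_int_sum)
    finally have "of_rat (\<kappa> i (e * z)) =
        (of_int ((\<Sum>u\<in>residues. \<epsilon> (rinv u * z) * k i (e * u)) + 2 * k i ?q) :: 'k)"
      by (simp only: of_rat_of_int_eq)
    also have "\<dots> =
        (\<Sum>u\<in>residues. of_int (\<epsilon> (rinv u * z)) * of_int (k i (e * u))) + (2 :: 'k) * of_int (k i ?q)"
      by (simp only: of_int_add of_int_sum of_int_mult of_int_numeral)
    also have "\<dots> \<doteq> (\<Sum>u\<in>residues. rtrace (rinv u * z) * of_int (k i (e * u))) + 0"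
      using z by (intro pcong_add pcong_sum pcong_mult pcong_refl \<epsilon> pcong_P P_mult P_two algebraic_int_mult rinv_alg) auto
    finally show ?thesis by (simp add: z_def mult_ac)
  qed
  have "of_rat (field_trace (x * e)) = (\<Sum>i<n. of_rat (\<kappa> i (x * e * w i)) :: 'k)"
    by (simp add: field_trace_eq[OF nf \<kappa>(1)] of_rat_sum)
  also have "\<dots> \<doteq> (\<Sum>i<n. \<Sum>u\<in>residues. rtrace (rinv u * (x * w i)) * of_int (k i (e * u)))"
    by (rule pcong_sum) (simp add: coord)
  also have "\<dots> = (\<Sum>u\<in>residues. \<Sum>i<n. of_int (k i (e * u)) * rtrace (rinv u * (x * w i)))"
    by (subst sum.swap) (simp add: mult.commute)
  also have "\<dots> \<doteq> (\<Sum>u\<in>residues. if u \<in> P then 0 else rtrace x)"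
  proof (rule pcong_sum)
    fix u assume "u \<in> residues"
    then have u: "algebraic_int u" by (rule residues_alg)
    have "(\<Sum>i<n. of_int (k i (e * u)) * rtrace (rinv u * (x * w i))) \<doteq>
        (\<Sum>i<n. rtrace (of_int (k i (e * u)) * (rinv u * (x * w i))))"
      using x walg rinv_alg by (intro pcong_sum pcong_sym[OF rtrace_int] algebraic_int_mult) auto
    also have "\<dots> \<doteq> rtrace (\<Sum>i<n. of_int (k i (e * u)) * (rinv u * (x * w i)))"
      using x walg rinv_alg by (intro pcong_sym[OF rtrace_sum] algebraic_int_mult) auto
    \<comment> \<open>Additivity of the residue trace has moved the sum over the basis inside, where
      it reassembles \<open>e * u\<close> from its coordinates.\<close>
    also have "(\<Sum>i<n. of_int (k i (e * u)) * (rinv u * (x * w i))) =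
        rinv u * x * (\<Sum>i<n. of_rat (\<kappa> i (e * u)) * w i)"
      using ealg u by (simp add: k algebraic_int_mult sum_distrib_left mult_ac)
    also have "(\<Sum>i<n. of_rat (\<kappa> i (e * u)) * w i) = e * u"
      by (rule dual_basis_expand[OF \<kappa>(1), symmetric])
    also have "rtrace (rinv u * x * (e * u)) \<doteq> (if u \<in> P then 0 else rtrace x)"
    proof (cases "u \<in> P")
      case True
      then show ?thesis by (simp add: rinv_P rtrace_0 pcong_refl)
    next
      case False
      have "rinv u * x * (e * u) = x * (e * (u * rinv u))" by (simp add: mult_ac)
      also have "\<dots> \<doteq> x * (1 * 1)" using rinv_unit[of u] False u by (intro pcong_mult pcong_refl x e(1)) auto
      finally have "rtrace (rinv u * x * (e * u)) \<doteq> rtrace (x * (1 * 1))" by (rule rtrace_cong)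
      then show ?thesis using False by simp
    qed
    finally show "(\<Sum>i<n. of_int (k i (e * u)) * rtrace (rinv u * (x * w i))) \<doteq> (if u \<in> P then 0 else rtrace x)" .
  qed
  also have "\<dots> \<doteq> rtrace x" by (rule sum_residues_unit[OF rtrace_alg[OF x]])
  finally show ?thesis .
qed

lemma trace_not_even:
  assumes e: "e \<doteq> 1" "\<And>p. p \<in> P \<Longrightarrow> algebraic_int (e * p / 2)"
  shows "\<exists>x. algebraic_int x \<and> field_trace (x * e / 2) \<notin> \<int>"
proof (rule ccontr)
  assume "\<not> ?thesis"
  then have even: "field_trace (x * e / 2) \<in> \<int>" if "algebraic_int x" for x using that by blast
  have rt: "rtrace x \<in> P" if x: "algebraic_int x" for x
  proof -
    obtain q where q: "field_trace (x * e / 2) = of_int q" using even[OF x] by (auto elim: Ints_cases)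
    have "field_trace (x * e) = of_int 2 * field_trace (x * e / 2)"
      using field_trace_int[OF nf, of 2 "x * e / 2"] by simp
    then have "of_rat (field_trace (x * e)) = (2 :: 'k) * of_int q"
      unfolding q by (simp add: of_rat_mult)
    then have "(2 :: 'k) * of_int q \<doteq> rtrace x" using residue_trace_formula[OF e x] by simp
    moreover have "(2 :: 'k) * of_int q \<in> P" by (intro P_mult P_two) simp
    ultimately show ?thesis using pcong_in_P pcong_sym by blast
  qed
  have "(\<Sum>u\<in>residues. u * rtrace (rinv u * 1)) \<doteq> (\<Sum>u\<in>residues. u * 0)"
    using residues_alg rinv_alg rt by (intro pcong_sum pcong_mult pcong_refl pcong_P) auto
  then have "1 \<doteq> (\<Sum>u\<in>residues. u * 0)"
    by (rule pcong_trans[OF pcong_sym[OF rank_one_expansion[OF algebraic_int_1]]])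
  then show False using P_one by (simp add: pcong_def)
qed

end

theorem odd_discriminant_if_unramified:
  assumes nf: "number_field TYPE('k::field_char_0)"
    and unr: "\<And>P::'k set. dyadic P \<Longrightarrow> ord_at P 2 = 1"
  shows "odd (discriminant TYPE('k))"
proof
  assume "even (discriminant TYPE('k))"
  then obtain y0 :: 'k where y0: "algebraic_int y0" "\<not> algebraic_int (y0 / 2)"
    "\<And>x. algebraic_int x \<Longrightarrow> field_trace (x * y0 / 2) \<in> \<int>"
    using even_discriminant[OF nf] by blast
  define Y where "Y = {y0 * a | a. algebraic_int a \<and> \<not> algebraic_int (y0 * a / 2)}"
  have "y0 * 1 \<in> Y" unfolding Y_def using y0 by (intro CollectI exI[of _ 1]) simp
  moreover have "algebraic_int y" if "y \<in> Y" for y using that y0 by (auto simp: Y_def)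
  ultimately obtain y where y: "y \<in> Y" and min: "\<And>a. algebraic_int a \<Longrightarrow> a * y \<in> Y \<Longrightarrow>
      \<exists>c. algebraic_int c \<and> algebraic_int ((y - a * y * c) / 2)"
    using minimal_mod_2[OF nf, of Y] by blast
  obtain b where b: "algebraic_int b" "y = y0 * b" "\<not> algebraic_int (y / 2)"
    using y unfolding Y_def by blast
  have yalg: "algebraic_int y" using b y0 by auto
  have memY: "a * y \<in> Y" if "algebraic_int a" "\<not> algebraic_int (a * y / 2)" for a
    unfolding Y_def using that b by (intro CollectI exI[of _ "b * a"]) (auto simp: mult_ac)
  \<comment> \<open>The annihilator of the class of \<open>y\<close> in O/2O. It is prime because
    the ideal generated by that class is minimal.\<close>
  define P where "P = {a. algebraic_int a \<and> algebraic_int (a * y / 2)}"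
  have "dyadic P"
  proof
    show "number_field TYPE('k)" by fact
    show "2 \<in> P" using yalg by (simp add: P_def)
    show "1 \<notin> P" using b by (simp add: P_def)
    fix u v
    show "algebraic_int u" if "u \<in> P" using that by (simp add: P_def)
    show "u + v \<in> P" if "u \<in> P" "v \<in> P"
      using that algebraic_int_add[of "u * y / 2" "v * y / 2"]
      by (auto simp: P_def distrib_right add_divide_distrib)
    show "u * v \<in> P" if "u \<in> P" "algebraic_int v"
      using that algebraic_int_mult[of "u * y / 2" v] by (auto simp: P_def mult_ac)
    show "u \<in> P \<or> v \<in> P" if uv: "algebraic_int u" "algebraic_int v" "u * v \<in> P"
    proof (rule disjCI)
      assume "v \<notin> P"
      \<comment> \<open>The class of \<open>v * y\<close> is still nonzero, so by minimality
        \<open>y\<close> is congruent to \<open>v * y * c\<close> modulo 2. Multiplying by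
        \<open>u\<close> shows that \<open>u\<close> kills \<open>y\<close>, because
        \<open>u * v\<close> does.\<close>
      then obtain c where c: "algebraic_int c" "algebraic_int ((y - v * y * c) / 2)"
        using min[OF uv(2) memY[OF uv(2)]] uv(2) by (auto simp: P_def)
      have "algebraic_int (u * ((y - v * y * c) / 2))" by (rule algebraic_int_mult[OF uv(1) c(2)])
      moreover have "algebraic_int (c * (u * v * y / 2))"
        using uv(3) by (intro algebraic_int_mult c(1)) (simp add: P_def)
      ultimately have "algebraic_int (u * ((y - v * y * c) / 2) + c * (u * v * y / 2))"
        by (rule algebraic_int_add)
      moreover have "u * ((y - v * y * c) / 2) + c * (u * v * y / 2) = u * y / 2"
        by (simp add: field_simps)
      ultimately have "algebraic_int (u * y / 2)" by (simp only:)
      then show "u \<in> P" using uv(1) by (simp add: P_def)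
    qed
  qed
  then interpret dyadic P .
  have ann: "algebraic_int (y * p / 2)" if "p \<in> P" for p
    using that by (simp add: P_def mult.commute)
  have "y \<notin> P"
    by (rule annihilator_not_in_prime[OF unr[OF \<open>dyadic P\<close>] yalg b(3) ann])
  then obtain t where t: "algebraic_int t" "1 - y * t \<in> P" using unit_at_inverse yalg by blast
  have "pcong 1 (y * t)" using t yalg by (auto simp: pcong_def)
  then have "pcong (y * t) 1" by (rule pcong_sym)
  moreover have "algebraic_int (y * t * p / 2)" if "p \<in> P" for p
    using algebraic_int_mult[OF ann[OF that] t(1)] by (simp add: mult_ac)
  ultimately obtain x where x: "algebraic_int x" "field_trace (x * (y * t) / 2) \<notin> \<int>"
    using trace_not_even by blast
  \<comment> \<open>Passing from \<open>y0\<close> to \<open>y\<close> and to \<open>y * t\<close>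
    only multiplied by integers, so the evenness of the traces is inherited.\<close>
  have "field_trace ((x * t * b) * y0 / 2) \<in> \<int>" using x(1) t(1) b(1) by (intro y0(3)) auto
  then show False using x(2) b(2) by (simp add: mult_ac)
qed

section \<open>Completions\<close>

text \<open>What the argument on BONGs uses of a completion, kept apart from Cauchy sequences.
  Values are extended reals, as for \<open>ord_completion\<close>; that nonzero elements have
  integral order is what makes parity arguments possible.\<close>

locale valued_field = field F for F (structure) +
  fixes \<nu> :: "'a \<Rightarrow> ereal"
  assumes val_zero: "\<nu> \<zero> = \<infinity>"
    and val_int: "x \<in> carrier F \<Longrightarrow> x \<noteq> \<zero> \<Longrightarrow> \<exists>n::int. \<nu> x = ereal (of_int n)"
    and val_mult: "x \<in> carrier F \<Longrightarrow> y \<in> carrier F \<Longrightarrow> \<nu> (x \<otimes> y) = \<nu> x + \<nu> y"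
    and val_add: "x \<in> carrier F \<Longrightarrow> y \<in> carrier F \<Longrightarrow> min (\<nu> x) (\<nu> y) \<le> \<nu> (x \<oplus> y)"

context dyadic
begin

abbreviation v :: "'k \<Rightarrow> ereal" where "v \<equiv> ord_at P"

lemma v_1: "v 1 = 0"
proof -
  obtain n :: int where n: "v 1 = ereal (of_int n)" using ord_at_int[of 1] by auto
  have "v 1 + v 1 = v 1" using ord_at_mult[of 1 1] by simp
  then show ?thesis unfolding n by (simp add: zero_ereal_def)
qed

lemma v_minus: "v (- x) = v x"
proof -
  obtain n :: int where n: "v (- 1) = ereal (of_int n)" using ord_at_int[of "- 1"] by auto
  have "v (- 1) + v (- 1) = 0" using ord_at_mult[of "- 1" "- 1"] v_1 by simp
  then have "v (- 1) = 0" unfolding n by (simp add: zero_ereal_def)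
  then show ?thesis using ord_at_mult[of "- 1" x] by simp
qed

lemma v_add_ge: "c \<le> v x \<Longrightarrow> c \<le> v y \<Longrightarrow> c \<le> v (x + y)"
  using ord_at_add[of x y] by (meson min.boundedI order_trans)

lemma v_diff_ge: "c \<le> v x \<Longrightarrow> c \<le> v y \<Longrightarrow> c \<le> v (x - y)"
  using v_add_ge[of c x "- y"] by (simp add: v_minus)

lemma v_mult_ge: "ereal a \<le> v x \<Longrightarrow> ereal b \<le> v y \<Longrightarrow> ereal (a + b) \<le> v (x * y)"
  using add_mono[of "ereal a" "v x" "ereal b" "v y"] by (simp add: ord_at_mult)

lemma v_commute: "v (x - y) = v (y - x)"
  using v_minus[of "x - y"] by simp

lemma v_add_eq:
  assumes "v x < v y"
  shows "v (x + y) = v x"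
proof (rule antisym)
  show "v x \<le> v (x + y)" using assms by (intro v_add_ge) auto
  show "v (x + y) \<le> v x"
  proof (rule ccontr)
    assume "\<not> v (x + y) \<le> v x"
    then have "min (v (x + y)) (v y) > v x" using assms by simp
    also have "min (v (x + y)) (v y) \<le> v ((x + y) - y)" by (intro v_diff_ge) auto
    finally show False by simp
  qed
qed

lemma v_inverse: "x \<noteq> 0 \<Longrightarrow> v (inverse x) = - v x"
proof -
  assume x: "x \<noteq> 0"
  obtain n :: int where n: "v x = ereal (of_int n)" using ord_at_int[OF x] by blast
  obtain m :: int where m: "v (inverse x) = ereal (of_int m)" using ord_at_int[of "inverse x"] x by auto
  have "v x + v (inverse x) = 0" using ord_at_mult[of x "inverse x"] v_1 x by simp
  then show ?thesis unfolding n m by (simp add: zero_ereal_def)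
qed

lemma null_seqs_iff: "s \<in> null_seqs P \<longleftrightarrow> (\<forall>N::nat. \<exists>M. \<forall>i\<ge>M. ereal (real N) \<le> v (s i))"
proof
  assume "s \<in> null_seqs P"
  then have t: "\<forall>r. eventually (\<lambda>i. ereal r < v (s i)) sequentially"
    by (simp add: null_seqs_def tendsto_PInfty)
  show "\<forall>N::nat. \<exists>M. \<forall>i\<ge>M. ereal (real N) \<le> v (s i)"
  proof
    fix N :: nat
    obtain M where "\<forall>i\<ge>M. ereal (real N) < v (s i)" using t unfolding eventually_sequentially by blast
    then show "\<exists>M. \<forall>i\<ge>M. ereal (real N) \<le> v (s i)" using less_imp_le by blast
  qed
next
  assume n: "\<forall>N::nat. \<exists>M. \<forall>i\<ge>M. ereal (real N) \<le> v (s i)"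
  have "\<exists>M. \<forall>i\<ge>M. ereal r < v (s i)" for r
  proof -
    obtain N :: nat where N: "r < real N" using reals_Archimedean2 by blast
    obtain M where "\<forall>i\<ge>M. ereal (real N) \<le> v (s i)" using n by blast
    moreover have "ereal r < ereal (real N)" using N by simp
    ultimately show ?thesis using less_le_trans by blast
  qed
  then show "s \<in> null_seqs P" by (simp add: null_seqs_def tendsto_PInfty eventually_sequentially)
qed

lemma cauchy_seqs_iff:
  "s \<in> cauchy_seqs P \<longleftrightarrow> (\<forall>N::nat. \<exists>M. \<forall>i\<ge>M. \<forall>j\<ge>M. ereal (real N) \<le> v (s i - s j))"
  by (simp add: cauchy_seqs_def)

lemma null_cauchy: "s \<in> null_seqs P \<Longrightarrow> s \<in> cauchy_seqs P"
  unfolding null_seqs_iff cauchy_seqs_iff by (meson v_diff_ge)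

lemma const_cauchy: "(\<lambda>_. x) \<in> cauchy_seqs P"
  by (simp add: cauchy_seqs_iff ord_at_0)

text \<open>Infinitely many terms have order below some \<open>N\<close>. Once all differences have
  order at least \<open>N\<close>, the ultrametric inequality gives every later term the order of
  one such term.\<close>

lemma cauchy_eventually_const:
  assumes s: "s \<in> cauchy_seqs P" and nn: "s \<notin> null_seqs P"
  shows "\<exists>(k::int) M. \<forall>i\<ge>M. v (s i) = ereal (of_int k)"
proof -
  obtain N :: nat where "\<not> (\<exists>M. \<forall>i\<ge>M. ereal (real N) \<le> v (s i))"
    using nn unfolding null_seqs_iff by blast
  then have N: "\<exists>i\<ge>M. v (s i) < ereal (real N)" for M by (auto simp: not_le)
  obtain M where M: "\<And>i j. i \<ge> M \<Longrightarrow> j \<ge> M \<Longrightarrow> ereal (real N) \<le> v (s i - s j)"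
    using s unfolding cauchy_seqs_iff by blast
  obtain i0 where i0: "i0 \<ge> M" "v (s i0) < ereal (real N)" using N by blast
  have "s i0 \<noteq> 0" using i0(2) by (auto simp: ord_at_0)
  then obtain k :: int where k: "v (s i0) = ereal (of_int k)" using ord_at_int by blast
  have "v (s j) = ereal (of_int k)" if "j \<ge> M" for j
  proof -
    have "v (s i0) < v (s j - s i0)" using i0(2) M[OF that i0(1)] by (rule less_le_trans)
    from v_add_eq[OF this] show ?thesis using k by simp
  qed
  then show ?thesis by blast
qed

lemma cauchy_bounded:
  assumes s: "s \<in> cauchy_seqs P"
  shows "\<exists>(B::nat) M. \<forall>i\<ge>M. ereal (- real B) \<le> v (s i)"
proof (cases "s \<in> null_seqs P")
  case True
  then obtain M where "\<forall>i\<ge>M. ereal (real 0) \<le> v (s i)" unfolding null_seqs_iff by blast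
  then show ?thesis by (intro exI[of _ 0] exI[of _ M]) simp
next
  case False
  then obtain k :: int and M where "\<forall>i\<ge>M. v (s i) = ereal (of_int k)"
    using cauchy_eventually_const[OF s] by blast
  moreover have "- real (nat \<bar>k\<bar>) \<le> of_int k" by simp
  ultimately show ?thesis by (intro exI[of _ "nat \<bar>k\<bar>"] exI[of _ M]) simp
qed

lemma cauchy_add:
  assumes "s \<in> cauchy_seqs P" "t \<in> cauchy_seqs P"
  shows "(\<lambda>i. s i + t i) \<in> cauchy_seqs P"
  unfolding cauchy_seqs_iff
proof
  fix N :: nat
  obtain M1 where M1: "\<And>i j. i \<ge> M1 \<Longrightarrow> j \<ge> M1 \<Longrightarrow> ereal (real N) \<le> v (s i - s j)"
    using assms(1) unfolding cauchy_seqs_iff by blast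
  obtain M2 where M2: "\<And>i j. i \<ge> M2 \<Longrightarrow> j \<ge> M2 \<Longrightarrow> ereal (real N) \<le> v (t i - t j)"
    using assms(2) unfolding cauchy_seqs_iff by blast
  have "ereal (real N) \<le> v (s i + t i - (s j + t j))" if "i \<ge> max M1 M2" "j \<ge> max M1 M2" for i j
    using v_add_ge[OF M1[of i j] M2[of i j]] that by (simp add: algebra_simps)
  then show "\<exists>M. \<forall>i\<ge>M. \<forall>j\<ge>M. ereal (real N) \<le> v (s i + t i - (s j + t j))" by blast
qed

lemma cauchy_uminus: "s \<in> cauchy_seqs P \<Longrightarrow> (\<lambda>i. - s i) \<in> cauchy_seqs P"
  unfolding cauchy_seqs_iff using v_commute by simp

lemma cauchy_mult:
  assumes "s \<in> cauchy_seqs P" "t \<in> cauchy_seqs P"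
  shows "(\<lambda>i. s i * t i) \<in> cauchy_seqs P"
  unfolding cauchy_seqs_iff
proof
  fix N :: nat
  obtain B1 :: nat and L1 where B1: "\<And>i. i \<ge> L1 \<Longrightarrow> ereal (- real B1) \<le> v (s i)"
    using cauchy_bounded[OF assms(1)] by blast
  obtain B2 :: nat and L2 where B2: "\<And>i. i \<ge> L2 \<Longrightarrow> ereal (- real B2) \<le> v (t i)"
    using cauchy_bounded[OF assms(2)] by blast
  obtain M1 where M1: "\<And>i j. i \<ge> M1 \<Longrightarrow> j \<ge> M1 \<Longrightarrow> ereal (real (N + B2)) \<le> v (s i - s j)"
    using assms(1) unfolding cauchy_seqs_iff by blast
  obtain M2 where M2: "\<And>i j. i \<ge> M2 \<Longrightarrow> j \<ge> M2 \<Longrightarrow> ereal (real (N + B1)) \<le> v (t i - t j)"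
    using assms(2) unfolding cauchy_seqs_iff by blast
  define M where "M = max (max L1 L2) (max M1 M2)"
  have "ereal (real N) \<le> v (s i * t i - s j * t j)" if ij: "i \<ge> M" "j \<ge> M" for i j
  proof -
    have "ereal (- real B1 + real (N + B1)) \<le> v (s i * (t i - t j))"
      using ij by (intro v_mult_ge B1 M2) (simp_all add: M_def)
    moreover have "ereal (real (N + B2) + - real B2) \<le> v ((s i - s j) * t j)"
      using ij by (intro v_mult_ge B2 M1) (simp_all add: M_def)
    ultimately have "ereal (real N) \<le> v (s i * (t i - t j) + (s i - s j) * t j)"
      by (intro v_add_ge) simp_all
    moreover have "s i * (t i - t j) + (s i - s j) * t j = s i * t i - s j * t j"
      by (simp add: algebra_simps)
    ultimately show ?thesis by (simp only:)
  qed
  then show "\<exists>M. \<forall>i\<ge>M. \<forall>j\<ge>M. ereal (real N) \<le> v (s i * t i - s j * t j)" by blast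
qed

lemma null_add:
  assumes "s \<in> null_seqs P" "t \<in> null_seqs P"
  shows "(\<lambda>i. s i + t i) \<in> null_seqs P"
  unfolding null_seqs_iff
proof
  fix N :: nat
  obtain M1 where M1: "\<And>i. i \<ge> M1 \<Longrightarrow> ereal (real N) \<le> v (s i)"
    using assms(1) unfolding null_seqs_iff by blast
  obtain M2 where M2: "\<And>i. i \<ge> M2 \<Longrightarrow> ereal (real N) \<le> v (t i)"
    using assms(2) unfolding null_seqs_iff by blast
  have "ereal (real N) \<le> v (s i + t i)" if "i \<ge> max M1 M2" for i
    using v_add_ge[OF M1[of i] M2[of i]] that by simp
  then show "\<exists>M. \<forall>i\<ge>M. ereal (real N) \<le> v (s i + t i)" by blast
qed

lemma null_mult:
  assumes "s \<in> null_seqs P" "t \<in> cauchy_seqs P"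
  shows "(\<lambda>i. s i * t i) \<in> null_seqs P"
  unfolding null_seqs_iff
proof
  fix N :: nat
  obtain B :: nat and L where B: "\<And>i. i \<ge> L \<Longrightarrow> ereal (- real B) \<le> v (t i)"
    using cauchy_bounded[OF assms(2)] by blast
  obtain M where M: "\<And>i. i \<ge> M \<Longrightarrow> ereal (real (N + B)) \<le> v (s i)"
    using assms(1) unfolding null_seqs_iff by blast
  have "ereal (real N) \<le> v (s i * t i)" if "i \<ge> max L M" for i
    using v_mult_ge[OF M[of i] B[of i]] that by simp
  then show "\<exists>M. \<forall>i\<ge>M. ereal (real N) \<le> v (s i * t i)" by blast
qed

lemma null_zero: "(\<lambda>_. 0) \<in> null_seqs P"
  by (simp add: null_seqs_iff ord_at_0)

lemma null_uminus: "s \<in> null_seqs P \<Longrightarrow> (\<lambda>i. - s i) \<in> null_seqs P"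
  unfolding null_seqs_iff by (simp add: v_minus)

section \<open>The ring of Cauchy sequences and its quotient by null sequences\<close>

lemma cauchy_rec_simps:
  "carrier (cauchy_rec P) = cauchy_seqs P"
  "s \<otimes>\<^bsub>cauchy_rec P\<^esub> t = (\<lambda>i. s i * t i)" "s \<oplus>\<^bsub>cauchy_rec P\<^esub> t = (\<lambda>i. s i + t i)"
  "\<one>\<^bsub>cauchy_rec P\<^esub> = (\<lambda>_. 1)" "\<zero>\<^bsub>cauchy_rec P\<^esub> = (\<lambda>_. 0)"
  by (simp_all add: cauchy_rec_def)

lemma cauchy_rec_cring: "cring (cauchy_rec P)"
proof (rule cringI)
  show "abelian_group (cauchy_rec P)"
  proof (rule abelian_groupI)
    fix s assume "s \<in> carrier (cauchy_rec P)"
    then show "\<exists>t\<in>carrier (cauchy_rec P). t \<oplus>\<^bsub>cauchy_rec P\<^esub> s = \<zero>\<^bsub>cauchy_rec P\<^esub>"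
      by (intro bexI[of _ "\<lambda>i. - s i"]) (simp_all add: cauchy_rec_simps cauchy_uminus)
  qed (simp_all add: cauchy_rec_simps cauchy_add const_cauchy add_ac)
  show "Group.comm_monoid (cauchy_rec P)"
    by (rule Group.comm_monoidI) (simp_all add: cauchy_rec_simps cauchy_mult const_cauchy mult_ac)
qed (simp_all add: cauchy_rec_simps distrib_right)

sublocale C: cring "cauchy_rec P"
  by (rule cauchy_rec_cring)

sublocale N: ideal "null_seqs P" "cauchy_rec P"
proof (rule idealI)
  show "ring (cauchy_rec P)" by (rule C.ring_axioms)
  show "subgroup (null_seqs P) (add_monoid (cauchy_rec P))"
  proof
    show "null_seqs P \<subseteq> carrier (add_monoid (cauchy_rec P))"
      using null_cauchy by (auto simp: cauchy_rec_def)
    show "\<one>\<^bsub>add_monoid (cauchy_rec P)\<^esub> \<in> null_seqs P" by (simp add: cauchy_rec_def null_zero)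
    fix s assume s: "s \<in> null_seqs P"
    show "s \<otimes>\<^bsub>add_monoid (cauchy_rec P)\<^esub> t \<in> null_seqs P" if "t \<in> null_seqs P" for t
      using null_add[OF s that] by (simp add: cauchy_rec_def)
    have "inv\<^bsub>add_monoid (cauchy_rec P)\<^esub> s = (\<lambda>i. - s i)"
      unfolding a_inv_def[symmetric]
      by (rule C.minus_equality)
        (simp_all add: cauchy_rec_simps null_cauchy[OF s] cauchy_uminus[OF null_cauchy[OF s]])
    then show "inv\<^bsub>add_monoid (cauchy_rec P)\<^esub> s \<in> null_seqs P" using null_uminus[OF s] by simp
  qed
  fix s t assume st: "s \<in> null_seqs P" "t \<in> carrier (cauchy_rec P)"
  show "s \<otimes>\<^bsub>cauchy_rec P\<^esub> t \<in> null_seqs P" using null_mult st by (simp add: cauchy_rec_simps)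
  then show "t \<otimes>\<^bsub>cauchy_rec P\<^esub> s \<in> null_seqs P" by (simp add: cauchy_rec_simps mult.commute)
qed

definition coset :: "(nat \<Rightarrow> 'k) \<Rightarrow> (nat \<Rightarrow> 'k) set" where
  "coset s = null_seqs P +>\<^bsub>cauchy_rec P\<^esub> s"

lemma completion_carrier: "x \<in> carrier (completion P) \<longleftrightarrow> (\<exists>s\<in>cauchy_seqs P. x = coset s)"
  by (auto simp: completion_def FactRing_def A_RCOSETS_def' coset_def cauchy_rec_simps)

lemma coset_carrier: "s \<in> cauchy_seqs P \<Longrightarrow> coset s \<in> carrier (completion P)"
  unfolding completion_carrier by blast

lemma coset_mult:
  "s \<in> cauchy_seqs P \<Longrightarrow> t \<in> cauchy_seqs P \<Longrightarrow>
    coset s \<otimes>\<^bsub>completion P\<^esub> coset t = coset (\<lambda>i. s i * t i)"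
  using N.rcoset_mult_add[of s t] by (simp add: completion_def FactRing_def coset_def cauchy_rec_simps)

lemma coset_add:
  "s \<in> cauchy_seqs P \<Longrightarrow> t \<in> cauchy_seqs P \<Longrightarrow>
    coset s \<oplus>\<^bsub>completion P\<^esub> coset t = coset (\<lambda>i. s i + t i)"
  using N.a_rcos_sum[of s t] by (simp add: completion_def FactRing_def coset_def cauchy_rec_simps)

lemma completion_one: "\<one>\<^bsub>completion P\<^esub> = coset (\<lambda>_. 1)"
  by (simp add: completion_def FactRing_def coset_def cauchy_rec_simps)

lemma mem_coset: "t \<in> coset s \<longleftrightarrow> (\<exists>n\<in>null_seqs P. t = (\<lambda>i. n i + s i))"
  by (simp add: coset_def a_r_coset_def' cauchy_rec_simps)

lemma completion_zero: "\<zero>\<^bsub>completion P\<^esub> = coset (\<lambda>_. 0)"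
proof -
  have "coset (\<lambda>_. 0) = null_seqs P" by (auto simp: mem_coset)
  then show ?thesis by (simp add: completion_def FactRing_def)
qed

lemma coset_eqI:
  assumes "(\<lambda>i. s i - t i) \<in> null_seqs P"
  shows "coset s = coset t"
proof -
  have "coset s \<subseteq> coset t" if d: "(\<lambda>i. s i - t i) \<in> null_seqs P" for s t
  proof
    fix u assume "u \<in> coset s"
    then obtain n where n: "n \<in> null_seqs P" "u = (\<lambda>i. n i + s i)" unfolding mem_coset by blast
    have "(\<lambda>i. n i + (s i - t i)) \<in> null_seqs P" by (rule null_add[OF n(1) d])
    then show "u \<in> coset t" unfolding mem_coset n(2) by (intro bexI[of _ "\<lambda>i. n i + (s i - t i)"]) auto
  qed
  moreover have "(\<lambda>i. t i - s i) \<in> null_seqs P" using null_uminus[OF assms] by simp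
  ultimately show ?thesis using assms by (intro equalityI)
qed

lemma coset_zero_iff: "coset s = coset (\<lambda>_. 0) \<longleftrightarrow> s \<in> null_seqs P"
proof
  assume "coset s = coset (\<lambda>_. 0)"
  moreover have "s \<in> coset s" unfolding mem_coset using null_zero by (intro bexI[of _ "\<lambda>_. 0"]) auto
  ultimately show "s \<in> null_seqs P" by (auto simp: mem_coset)
next
  assume "s \<in> null_seqs P"
  then show "coset s = coset (\<lambda>_. 0)" by (intro coset_eqI) simp
qed

text \<open>Justifies the definite description in \<open>ord_completion\<close>. A non-null Cauchy
  sequence has eventually constant order, which the order of an added null sequence soon exceeds, so
  all members of the coset share the limit; for null sequences the limit is infinite.\<close>

lemma ord_completion_coset:
  assumes s: "s \<in> cauchy_seqs P" and lim: "(\<lambda>i. v (s i)) \<longlonglongrightarrow> l"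
  shows "ord_completion P (coset s) = l"
  unfolding ord_completion_def
proof (rule the_equality)
  have t: "(\<lambda>i. v (n i + s i)) \<longlonglongrightarrow> l" if n: "n \<in> null_seqs P" for n
  proof (cases "s \<in> null_seqs P")
    case True
    then have "l = \<infinity>" using lim LIMSEQ_unique by (auto simp: null_seqs_def)
    then show ?thesis using null_add[OF n True] by (simp add: null_seqs_def)
  next
    case False
    then obtain k :: int and M where k: "\<And>i. i \<ge> M \<Longrightarrow> v (s i) = ereal (of_int k)"
      using cauchy_eventually_const[OF s] by blast
    obtain M' where M': "\<And>i. i \<ge> M' \<Longrightarrow> ereal (real (nat \<bar>k\<bar> + 1)) \<le> v (n i)"
      using n unfolding null_seqs_iff by blast
    have "v (n i + s i) = v (s i)" if "i \<ge> max M M'" for i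
    proof -
      have "v (s i) < ereal (real (nat \<bar>k\<bar> + 1))" using k[of i] that by simp
      also have "\<dots> \<le> v (n i)" using M' that by simp
      finally show ?thesis using v_add_eq[of "s i" "n i"] by (simp add: add.commute)
    qed
    then have "eventually (\<lambda>i. v (s i) = v (n i + s i)) sequentially"
      unfolding eventually_sequentially by (intro exI[of _ "max M M'"]) simp
    then show ?thesis using lim by (rule Lim_transform_eventually[rotated])
  qed
  then show "\<forall>t\<in>coset s. (\<lambda>i. v (t i)) \<longlonglongrightarrow> l" by (auto simp: mem_coset)
  fix l' assume "\<forall>t\<in>coset s. (\<lambda>i. v (t i)) \<longlonglongrightarrow> l'"
  moreover have "s \<in> coset s" unfolding mem_coset using null_zero by (intro bexI[of _ "\<lambda>_. 0"]) auto
  ultimately show "l' = l" using lim LIMSEQ_unique by blast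
qed

lemma ord_completion_null: "s \<in> null_seqs P \<Longrightarrow> ord_completion P (coset s) = \<infinity>"
  using ord_completion_coset[OF null_cauchy] by (simp add: null_seqs_def)

lemma ord_completion_tendsto:
  assumes s: "s \<in> cauchy_seqs P"
  shows "(\<lambda>i. v (s i)) \<longlonglongrightarrow> ord_completion P (coset s)"
proof (cases "s \<in> null_seqs P")
  case True
  then show ?thesis by (simp add: ord_completion_null) (simp add: null_seqs_def)
next
  case False
  then obtain k :: int and M where k: "\<And>i. i \<ge> M \<Longrightarrow> v (s i) = ereal (of_int k)"
    using cauchy_eventually_const[OF s] by blast
  then have lim: "(\<lambda>i. v (s i)) \<longlonglongrightarrow> ereal (of_int k)"
    by (intro tendsto_eventually) (auto simp: eventually_sequentially)
  then show ?thesis using ord_completion_coset[OF s lim] by simp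
qed

lemma ord_completion_eventually:
  assumes s: "s \<in> cauchy_seqs P" "s \<notin> null_seqs P"
  shows "\<exists>(k::int) M. ord_completion P (coset s) = ereal (of_int k) \<and> (\<forall>i\<ge>M. v (s i) = ereal (of_int k))"
proof -
  obtain k :: int and M where k: "\<And>i. i \<ge> M \<Longrightarrow> v (s i) = ereal (of_int k)"
    using cauchy_eventually_const[OF s] by blast
  then have lim: "(\<lambda>i. v (s i)) \<longlonglongrightarrow> ereal (of_int k)"
    by (intro tendsto_eventually) (auto simp: eventually_sequentially)
  then show ?thesis using ord_completion_coset[OF s(1) lim] k by blast
qed

lemma completion_cring: "cring (completion P)"
  unfolding completion_def by (rule N.quotient_is_cring) (rule cauchy_rec_cring)

text \<open>The termwise inverse works: a non-null Cauchy sequence has eventually constant order, so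
  the default inverse of 0 occurs at finitely many places at most.\<close>

lemma completion_inverse:
  assumes s: "s \<in> cauchy_seqs P" "s \<notin> null_seqs P"
  shows "\<exists>t\<in>cauchy_seqs P. coset (\<lambda>i. s i * t i) = coset (\<lambda>_. 1)"
proof -
  obtain k :: int and M where k: "\<And>i. i \<ge> M \<Longrightarrow> v (s i) = ereal (of_int k)"
    using cauchy_eventually_const[OF s] by blast
  have nz: "s i \<noteq> 0" if "i \<ge> M" for i using k[OF that] by (auto simp: ord_at_0)
  have vi: "v (inverse (s i)) = ereal (- of_int k)" if "i \<ge> M" for i
    using v_inverse[OF nz[OF that]] k[OF that] by simp
  have "(\<lambda>i. inverse (s i)) \<in> cauchy_seqs P"
    unfolding cauchy_seqs_iff
  proof
    fix N :: nat
    \<comment> \<open>The difference of two inverses is the difference of the terms divided by their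
      product, which has order \<open>2 * k\<close>; hence the extra precision.\<close>
    obtain M' where M': "\<And>i j. i \<ge> M' \<Longrightarrow> j \<ge> M' \<Longrightarrow> ereal (real (N + nat (2 * \<bar>k\<bar>))) \<le> v (s i - s j)"
      using s(1) unfolding cauchy_seqs_iff by blast
    have "ereal (real N) \<le> v (inverse (s i) - inverse (s j))" if ij: "i \<ge> max M M'" "j \<ge> max M M'" for i j
    proof -
      have vi': "ereal (- of_int k) \<le> v (inverse (s i))" "ereal (- of_int k) \<le> v (inverse (s j))"
        using vi ij by simp_all
      have "ereal (real (N + nat (2 * \<bar>k\<bar>))) \<le> v (s j - s i)" using M'[of j i] ij by simp
      from v_mult_ge[OF v_mult_ge[OF this vi'(1)] vi'(2)]
      have "ereal (real (N + nat (2 * \<bar>k\<bar>)) + (- of_int k) + (- of_int k)) \<le>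
          v ((s j - s i) * inverse (s i) * inverse (s j))" .
      also have "(s j - s i) * inverse (s i) * inverse (s j) = inverse (s i) - inverse (s j)"
        using nz[of i] nz[of j] ij by (simp add: field_simps)
      finally have "ereal (real (N + nat (2 * \<bar>k\<bar>)) + (- of_int k) + (- of_int k)) \<le>
          v (inverse (s i) - inverse (s j))" .
      moreover have "ereal (real N) \<le> ereal (real (N + nat (2 * \<bar>k\<bar>)) + (- of_int k) + (- of_int k))"
        by (simp add: abs_if)
      ultimately show ?thesis by (rule order_trans[rotated])
    qed
    then show "\<exists>M. \<forall>i\<ge>M. \<forall>j\<ge>M. ereal (real N) \<le> v (inverse (s i) - inverse (s j))" by blast
  qed
  moreover have "(\<lambda>i. s i * inverse (s i) - 1) \<in> null_seqs P"
    unfolding null_seqs_iff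
  proof
    fix N :: nat
    have "ereal (real N) \<le> v (s i * inverse (s i) - 1)" if "i \<ge> M" for i
      using nz[OF that] by (simp add: ord_at_0)
    then show "\<exists>M. \<forall>i\<ge>M. ereal (real N) \<le> v (s i * inverse (s i) - 1)" by blast
  qed
  ultimately show ?thesis using coset_eqI[of "\<lambda>i. s i * inverse (s i)" "\<lambda>_. 1"]
    by (intro bexI[of _ "\<lambda>i. inverse (s i)"])
qed

lemma completion_valued_field: "valued_field (completion P) (ord_completion P)"
proof -
  have one_not_null: "(\<lambda>_. 1) \<notin> null_seqs P"
  proof
    assume "(\<lambda>_. 1) \<in> null_seqs P"
    then have "ereal (real 1) \<le> v 1" unfolding null_seqs_iff by blast
    then show False using v_1 by simp
  qed
  have f: "field (completion P)"
  proof (rule cring.cring_fieldI2[OF completion_cring])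
    show "\<zero>\<^bsub>completion P\<^esub> \<noteq> \<one>\<^bsub>completion P\<^esub>"
      using one_not_null coset_zero_iff[of "\<lambda>_. 1"] unfolding completion_zero completion_one by auto
    fix x assume x: "x \<in> carrier (completion P)" "x \<noteq> \<zero>\<^bsub>completion P\<^esub>"
    then obtain s where s: "s \<in> cauchy_seqs P" "x = coset s" unfolding completion_carrier by blast
    then have "s \<notin> null_seqs P" using x(2) coset_zero_iff unfolding completion_zero by blast
    then obtain t where t: "t \<in> cauchy_seqs P" "coset (\<lambda>i. s i * t i) = coset (\<lambda>_. 1)"
      using completion_inverse[OF s(1)] by blast
    then show "\<exists>y\<in>carrier (completion P). x \<otimes>\<^bsub>completion P\<^esub> y = \<one>\<^bsub>completion P\<^esub>"
      using s coset_mult coset_carrier unfolding completion_one by (intro bexI[of _ "coset t"]) simp_all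
  qed
  show ?thesis
  proof (rule valued_field.intro[OF f], unfold_locales)
    show "ord_completion P \<zero>\<^bsub>completion P\<^esub> = \<infinity>"
      unfolding completion_zero by (rule ord_completion_null[OF null_zero])
    fix x assume x: "x \<in> carrier (completion P)"
    then obtain s where s: "s \<in> cauchy_seqs P" "x = coset s" unfolding completion_carrier by blast
    show "\<exists>n::int. ord_completion P x = ereal (of_int n)" if "x \<noteq> \<zero>\<^bsub>completion P\<^esub>"
    proof -
      have "s \<notin> null_seqs P" using that s(2) coset_zero_iff unfolding completion_zero by blast
      then show ?thesis using ord_completion_eventually[OF s(1)] s(2) by blast
    qed
    fix y assume y: "y \<in> carrier (completion P)"
    then obtain t where t: "t \<in> cauchy_seqs P" "y = coset t" unfolding completion_carrier by blast
    have noninf: "ord_completion P (coset u) \<noteq> -\<infinity>" if "u \<in> cauchy_seqs P" for u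
      using ord_completion_eventually[OF that] ord_completion_null[of u] by (cases "u \<in> null_seqs P") auto
    show "ord_completion P (x \<otimes>\<^bsub>completion P\<^esub> y) = ord_completion P x + ord_completion P y"
    proof (cases "s \<in> null_seqs P \<or> t \<in> null_seqs P")
      case True
      then have "(\<lambda>i. s i * t i) \<in> null_seqs P"
        using null_mult[OF _ t(1), of s] null_mult[OF _ s(1), of t] by (auto simp: mult.commute)
      moreover have "ord_completion P x + ord_completion P y = \<infinity>"
        using True ord_completion_null noninf[OF s(1)] noninf[OF t(1)] s(2) t(2) by auto
      ultimately show ?thesis
        using coset_mult[OF s(1) t(1)] s(2) t(2) by (simp add: ord_completion_null)
    next
      case False
      obtain k :: int and M where k: "ord_completion P x = ereal (of_int k)" "\<forall>i\<ge>M. v (s i) = ereal (of_int k)"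
        using ord_completion_eventually[OF s(1)] False s(2) by blast
      obtain k' :: int and M' where k': "ord_completion P y = ereal (of_int k')" "\<forall>i\<ge>M'. v (t i) = ereal (of_int k')"
        using ord_completion_eventually[OF t(1)] False t(2) by blast
      have "\<forall>i\<ge>max M M'. v (s i * t i) = ereal (of_int k) + ereal (of_int k')"
        using k(2) k'(2) by (simp add: ord_at_mult)
      then have "(\<lambda>i. v (s i * t i)) \<longlonglongrightarrow> ereal (of_int k) + ereal (of_int k')"
        by (intro tendsto_eventually) (auto simp: eventually_sequentially intro!: exI[of _ "max M M'"])
      then have "ord_completion P (coset (\<lambda>i. s i * t i)) = ereal (of_int k) + ereal (of_int k')"
        by (rule ord_completion_coset[OF cauchy_mult[OF s(1) t(1)]])
      then show ?thesis using coset_mult[OF s(1) t(1)] s(2) t(2) k(1) k'(1) by simp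
    qed
    have "(\<lambda>i. min (v (s i)) (v (t i))) \<longlonglongrightarrow> min (ord_completion P x) (ord_completion P y)"
      unfolding s(2) t(2) by (intro tendsto_min ord_completion_tendsto s(1) t(1))
    moreover have "(\<lambda>i. v (s i + t i)) \<longlonglongrightarrow> ord_completion P (x \<oplus>\<^bsub>completion P\<^esub> y)"
      unfolding s(2) t(2) coset_add[OF s(1) t(1)]
      by (rule ord_completion_tendsto[OF cauchy_add[OF s(1) t(1)]])
    ultimately show "min (ord_completion P x) (ord_completion P y) \<le> ord_completion P (x \<oplus>\<^bsub>completion P\<^esub> y)"
      by (rule LIMSEQ_le) (intro exI[of _ 0] allI impI ord_at_add)
  qed
qed

lemma to_completion_coset: "to_completion P x = coset (\<lambda>_. x)"
  by (simp add: to_completion_def coset_def)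

lemma to_completion_hom: "to_completion P \<in> ring_hom field_rec (completion P)"
  by (rule ring_hom_memI)
    (simp_all add: to_completion_coset coset_carrier const_cauchy coset_mult coset_add completion_one)

lemma ord_to_completion: "ord_completion P (to_completion P x) = ord_at P x"
  unfolding to_completion_coset by (rule ord_completion_coset[OF const_cauchy]) simp

end

section \<open>Bilinear forms in coordinates\<close>

context cring
begin

lemma finsum_swap:
  assumes "finite A" "finite B" "\<And>i j. i \<in> A \<Longrightarrow> j \<in> B \<Longrightarrow> f i j \<in> carrier R"
  shows "(\<Oplus>i\<in>A. \<Oplus>j\<in>B. f i j) = (\<Oplus>j\<in>B. \<Oplus>i\<in>A. f i j)"
  using assms(1,3)
proof (induction A rule: finite_induct)
  case empty
  show ?case by (simp add: finsum_zero)
next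
  case (insert a A)
  have "(\<Oplus>i\<in>insert a A. \<Oplus>j\<in>B. f i j) = (\<Oplus>j\<in>B. f a j) \<oplus> (\<Oplus>i\<in>A. \<Oplus>j\<in>B. f i j)"
    using insert by (intro finsum_insert) (auto intro!: finsum_closed)
  also have "\<dots> = (\<Oplus>j\<in>B. f a j) \<oplus> (\<Oplus>j\<in>B. \<Oplus>i\<in>A. f i j)"
    using insert by simp
  also have "\<dots> = (\<Oplus>j\<in>B. f a j \<oplus> (\<Oplus>i\<in>A. f i j))"
    using insert by (intro finsum_addf[symmetric]) (auto intro!: finsum_closed)
  also have "\<dots> = (\<Oplus>j\<in>B. \<Oplus>i\<in>insert a A. f i j)"
    using insert by (intro finsum_cong' finsum_insert[symmetric]) (auto intro!: finsum_closed)
  finally show ?case .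
qed

end

locale coordinates = cring R for R :: "'a ring" (structure) +
  fixes m :: nat
begin

abbreviation coords :: "(nat \<Rightarrow> 'a) set" where
  "coords \<equiv> carrier (coord_space R m)"

lemma coord_space_simps:
  "coords = {..<m} \<rightarrow>\<^sub>E carrier R"
  "\<zero>\<^bsub>coord_space R m\<^esub> = (\<lambda>i\<in>{..<m}. \<zero>)"
  "x \<oplus>\<^bsub>coord_space R m\<^esub> y = (\<lambda>i\<in>{..<m}. x i \<oplus> y i)"
  "c \<odot>\<^bsub>coord_space R m\<^esub> x = (\<lambda>i\<in>{..<m}. c \<otimes> x i)"
  by (simp_all add: coord_space_def)

lemma coords_component: "x \<in> coords \<Longrightarrow> i < m \<Longrightarrow> x i \<in> carrier R"
  by (auto simp: coord_space_simps)

lemma coordsI: "(\<And>i. i < m \<Longrightarrow> f i \<in> carrier R) \<Longrightarrow> (\<lambda>i\<in>{..<m}. f i) \<in> coords"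
  by (auto simp: coord_space_simps)

lemma coords_eqI:
  assumes "x \<in> coords" "y \<in> coords" "\<And>i. i < m \<Longrightarrow> x i = y i"
  shows "x = y"
  by (rule PiE_ext[OF assms(1,2)[unfolded coord_space_simps(1)]]) (use assms(3) in simp)

lemma coord_space_abelian_group: "abelian_group (coord_space R m)"
proof (rule abelian_groupI)
  fix x assume x: "x \<in> coords"
  show "\<exists>y\<in>coords. y \<oplus>\<^bsub>coord_space R m\<^esub> x = \<zero>\<^bsub>coord_space R m\<^esub>"
  proof (rule bexI[of _ "\<lambda>i\<in>{..<m}. \<ominus> x i"])
    show "(\<lambda>i\<in>{..<m}. \<ominus> x i) \<oplus>\<^bsub>coord_space R m\<^esub> x = \<zero>\<^bsub>coord_space R m\<^esub>"
      unfolding coord_space_simps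
      by (rule restrict_ext) (simp add: l_neg coords_component[OF x])
  qed (rule coordsI, simp add: coords_component[OF x])
  show "\<zero>\<^bsub>coord_space R m\<^esub> \<oplus>\<^bsub>coord_space R m\<^esub> x = x"
  proof (rule coords_eqI)
    show "\<zero>\<^bsub>coord_space R m\<^esub> \<oplus>\<^bsub>coord_space R m\<^esub> x \<in> coords"
      unfolding coord_space_simps(2-) by (rule coordsI) (simp add: coords_component[OF x])
  qed (simp_all add: x coord_space_simps(2-) coords_component[OF x])
next
  fix x y assume xy: "x \<in> coords" "y \<in> coords"
  show "x \<oplus>\<^bsub>coord_space R m\<^esub> y \<in> coords"
    unfolding coord_space_simps(2-) by (rule coordsI) (simp add: coords_component xy)
  show "x \<oplus>\<^bsub>coord_space R m\<^esub> y = y \<oplus>\<^bsub>coord_space R m\<^esub> x"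
    unfolding coord_space_simps(2-) by (rule restrict_ext) (simp add: a_comm coords_component xy)
  fix z assume z: "z \<in> coords"
  show "x \<oplus>\<^bsub>coord_space R m\<^esub> y \<oplus>\<^bsub>coord_space R m\<^esub> z = x \<oplus>\<^bsub>coord_space R m\<^esub> (y \<oplus>\<^bsub>coord_space R m\<^esub> z)"
    unfolding coord_space_simps(2-) by (rule restrict_ext) (simp add: a_assoc coords_component xy z)
next
  show "\<zero>\<^bsub>coord_space R m\<^esub> \<in> coords"
    unfolding coord_space_simps(2-) by (rule coordsI) simp
qed

lemma coords_smult: "c \<in> carrier R \<Longrightarrow> x \<in> coords \<Longrightarrow> c \<odot>\<^bsub>coord_space R m\<^esub> x \<in> coords"
  unfolding coord_space_simps(2-) by (rule coordsI) (simp add: coords_component)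

lemma coords_minus:
  assumes "x \<in> coords" "y \<in> coords"
  shows "x \<ominus>\<^bsub>coord_space R m\<^esub> y = (\<lambda>i\<in>{..<m}. x i \<ominus> y i)"
proof -
  interpret V: abelian_group "coord_space R m" by (rule coord_space_abelian_group)
  have n: "(\<lambda>i\<in>{..<m}. \<ominus> y i) \<in> coords"
    by (rule coordsI) (simp add: coords_component[OF assms(2)])
  have "\<ominus>\<^bsub>coord_space R m\<^esub> y = (\<lambda>i\<in>{..<m}. \<ominus> y i)"
  proof (rule V.minus_equality[OF _ assms(2) n])
    show "(\<lambda>i\<in>{..<m}. \<ominus> y i) \<oplus>\<^bsub>coord_space R m\<^esub> y = \<zero>\<^bsub>coord_space R m\<^esub>"
      unfolding coord_space_simps
      by (rule restrict_ext) (simp add: l_neg coords_component[OF assms(2)])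
  qed
  then show ?thesis unfolding a_minus_def by (simp add: coord_space_simps(3) cong: restrict_cong)
qed

lemma coords_diff:
  assumes "x \<in> coords" "y \<in> coords"
  shows "x \<ominus>\<^bsub>coord_space R m\<^esub> y \<in> coords"
  unfolding coords_minus[OF assms] by (rule coordsI) (simp add: coords_component[OF assms(1)] coords_component[OF assms(2)])

lemma lin_span_base:
  assumes "\<one> \<in> A" "s \<in> S" "s \<in> coords"
  shows "s \<in> lin_span A (coord_space R m) S"
proof -
  interpret V: abelian_group "coord_space R m" by (rule coord_space_abelian_group)
  have 1: "\<one> \<odot>\<^bsub>coord_space R m\<^esub> s = s"
    by (rule coords_eqI[OF coords_smult[OF one_closed assms(3)] assms(3)])
      (simp add: coord_space_simps(4) coords_component[OF assms(3)])
  have "(\<Oplus>\<^bsub>coord_space R m\<^esub>t\<in>{s}. \<one> \<odot>\<^bsub>coord_space R m\<^esub> t) = s"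
    using 1 assms(3) by (subst V.finsum_insert) auto
  then show ?thesis
    unfolding lin_span_def using assms by (intro CollectI exI[of _ "\<lambda>_. \<one>"] exI[of _ "{s}"]) auto
qed

end

section \<open>Rules for a form given by a symmetric Gram matrix\<close>

locale gram = coordinates +
  fixes G :: "nat \<Rightarrow> nat \<Rightarrow> 'a"
  assumes gram: "gram_matrix R m G"
begin

abbreviation B :: "(nat \<Rightarrow> 'a) \<Rightarrow> (nat \<Rightarrow> 'a) \<Rightarrow> 'a" where
  "B \<equiv> bform R m G"

lemma gram_carrier: "i < m \<Longrightarrow> j < m \<Longrightarrow> G i j \<in> carrier R"
  and gram_sym: "i < m \<Longrightarrow> j < m \<Longrightarrow> G i j = G j i"
  using gram unfolding gram_matrix_def by blast+

lemma bform_term_carrier: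
  "x \<in> coords \<Longrightarrow> y \<in> coords \<Longrightarrow> i < m \<Longrightarrow> j < m \<Longrightarrow> x i \<otimes> G i j \<otimes> y j \<in> carrier R"
  by (simp add: coords_component gram_carrier)

lemma bform_inner_carrier:
  "x \<in> coords \<Longrightarrow> y \<in> coords \<Longrightarrow> i < m \<Longrightarrow> (\<Oplus>j\<in>{..<m}. x i \<otimes> G i j \<otimes> y j) \<in> carrier R"
  by (intro finsum_closed Pi_I bform_term_carrier) auto

lemma bform_closed: "x \<in> coords \<Longrightarrow> y \<in> coords \<Longrightarrow> B x y \<in> carrier R"
  unfolding bform_def by (intro finsum_closed Pi_I bform_inner_carrier) auto

lemma bform_sym:
  assumes "x \<in> coords" "y \<in> coords"
  shows "B x y = B y x"
proof -
  have "B x y = (\<Oplus>j\<in>{..<m}. \<Oplus>i\<in>{..<m}. x i \<otimes> G i j \<otimes> y j)"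
    unfolding bform_def by (rule finsum_swap) (simp_all add: bform_term_carrier assms)
  also have "\<dots> = B y x"
    unfolding bform_def
  proof (intro finsum_cong' refl)
    fix i j assume "i \<in> {..<m}" "j \<in> {..<m}"
    then show "x j \<otimes> G j i \<otimes> y i = y i \<otimes> G i j \<otimes> x j"
      using assms gram_sym[of i j] by (simp add: coords_component gram_carrier m_ac)
  qed (auto intro!: Pi_I finsum_closed bform_term_carrier assms)
  finally show ?thesis .
qed

lemma bform_add:
  assumes "x \<in> coords" "y \<in> coords" "z \<in> coords"
  shows "B (x \<oplus>\<^bsub>coord_space R m\<^esub> y) z = B x z \<oplus> B y z"
proof -
  have "B (x \<oplus>\<^bsub>coord_space R m\<^esub> y) z =
      (\<Oplus>i\<in>{..<m}. \<Oplus>j\<in>{..<m}. (x i \<otimes> G i j \<otimes> z j) \<oplus> (y i \<otimes> G i j \<otimes> z j))"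
    unfolding bform_def
    by (intro finsum_cong' refl)
      (auto simp: coord_space_simps(3) l_distr coords_component[OF assms(1)] coords_component[OF assms(2)]
        coords_component[OF assms(3)] gram_carrier intro!: Pi_I finsum_closed)
  also have "\<dots> = (\<Oplus>i\<in>{..<m}. (\<Oplus>j\<in>{..<m}. x i \<otimes> G i j \<otimes> z j) \<oplus> (\<Oplus>j\<in>{..<m}. y i \<otimes> G i j \<otimes> z j))"
  proof (intro finsum_cong' refl)
    fix i assume i: "i \<in> {..<m}"
    show "(\<Oplus>j\<in>{..<m}. (x i \<otimes> G i j \<otimes> z j) \<oplus> (y i \<otimes> G i j \<otimes> z j)) =
        (\<Oplus>j\<in>{..<m}. x i \<otimes> G i j \<otimes> z j) \<oplus> (\<Oplus>j\<in>{..<m}. y i \<otimes> G i j \<otimes> z j)"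
      using i by (intro finsum_addf Pi_I bform_term_carrier assms) auto
  qed (auto intro!: Pi_I a_closed bform_inner_carrier assms)
  also have "\<dots> = B x z \<oplus> B y z"
    unfolding bform_def by (intro finsum_addf Pi_I bform_inner_carrier assms) auto
  finally show ?thesis .
qed

lemma bform_smult:
  assumes "c \<in> carrier R" "x \<in> coords" "z \<in> coords"
  shows "B (c \<odot>\<^bsub>coord_space R m\<^esub> x) z = c \<otimes> B x z"
proof -
  have "c \<otimes> B x z = (\<Oplus>i\<in>{..<m}. c \<otimes> (\<Oplus>j\<in>{..<m}. x i \<otimes> G i j \<otimes> z j))"
    unfolding bform_def by (intro finsum_rdistr Pi_I bform_inner_carrier assms) auto
  also have "\<dots> = (\<Oplus>i\<in>{..<m}. \<Oplus>j\<in>{..<m}. c \<otimes> (x i \<otimes> G i j \<otimes> z j))"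
    by (intro finsum_cong' refl finsum_rdistr Pi_I bform_term_carrier assms)
      (auto intro!: finsum_closed Pi_I m_closed assms coords_component[OF assms(2)]
        coords_component[OF assms(3)] gram_carrier)
  also have "\<dots> = B (c \<odot>\<^bsub>coord_space R m\<^esub> x) z"
    unfolding bform_def
    by (intro finsum_cong' refl)
      (auto simp: coord_space_simps(4) m_assoc coords_component[OF assms(2)] coords_component[OF assms(3)]
        assms(1) gram_carrier intro!: Pi_I finsum_closed)
  finally show ?thesis by (rule sym)
qed

lemma bform_zero:
  assumes "z \<in> coords"
  shows "B \<zero>\<^bsub>coord_space R m\<^esub> z = \<zero>"
proof -
  interpret V: abelian_group "coord_space R m" by (rule coord_space_abelian_group)
  have "B \<zero>\<^bsub>coord_space R m\<^esub> z \<oplus> B \<zero>\<^bsub>coord_space R m\<^esub> z = B \<zero>\<^bsub>coord_space R m\<^esub> z"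
    using bform_add[OF V.zero_closed V.zero_closed assms] by simp
  then show ?thesis using bform_closed[OF V.zero_closed assms] by (simp add: add.l_cancel_one)
qed

lemma bform_diff_smult:
  assumes c: "c \<in> carrier R" and x: "x \<in> coords" and y: "y \<in> coords" and z: "z \<in> coords"
  shows "B (y \<ominus>\<^bsub>coord_space R m\<^esub> c \<odot>\<^bsub>coord_space R m\<^esub> x) z = B y z \<ominus> c \<otimes> B x z"
proof -
  have "y \<ominus>\<^bsub>coord_space R m\<^esub> c \<odot>\<^bsub>coord_space R m\<^esub> x =
      y \<oplus>\<^bsub>coord_space R m\<^esub> (\<ominus> c) \<odot>\<^bsub>coord_space R m\<^esub> x"
    unfolding coords_minus[OF y coords_smult[OF c x]]
    unfolding coord_space_simps(3,4)
    by (rule restrict_ext) (simp add: a_minus_def l_minus c coords_component[OF x])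
  then show ?thesis
    using bform_add[OF y coords_smult[OF _ x] z, of "\<ominus> c"] bform_smult[OF _ x z, of "\<ominus> c"] c
      bform_closed[OF x z] by (simp add: a_minus_def l_minus)
qed

lemma finsum_smult_coords:
  assumes "finite T" "T \<subseteq> coords" "c \<in> T \<rightarrow> carrier R"
  shows "(\<Oplus>\<^bsub>coord_space R m\<^esub>s\<in>T. c s \<odot>\<^bsub>coord_space R m\<^esub> s) \<in> coords"
proof -
  interpret V: abelian_group "coord_space R m" by (rule coord_space_abelian_group)
  show ?thesis using assms by (intro V.finsum_closed Pi_I coords_smult) auto
qed

lemma bform_finsum_closed:
  assumes A: "A \<subseteq> carrier R" "\<zero> \<in> A" "\<And>a b. a \<in> A \<Longrightarrow> b \<in> A \<Longrightarrow> a \<oplus> b \<in> A"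
      "\<And>a b. a \<in> A \<Longrightarrow> b \<in> A \<Longrightarrow> a \<otimes> b \<in> A"
    and z: "z \<in> coords"
    and T: "finite T" "T \<subseteq> coords" "c \<in> T \<rightarrow> A" "\<And>s. s \<in> T \<Longrightarrow> B s z \<in> A"
  shows "B (\<Oplus>\<^bsub>coord_space R m\<^esub>s\<in>T. c s \<odot>\<^bsub>coord_space R m\<^esub> s) z \<in> A"
  using T
proof (induction T rule: finite_induct)
  case empty
  interpret V: abelian_group "coord_space R m" by (rule coord_space_abelian_group)
  show ?case by (simp add: bform_zero[OF z] A(2))
next
  case (insert t T)
  interpret V: abelian_group "coord_space R m" by (rule coord_space_abelian_group)
  have cT: "c \<in> T \<rightarrow> A" "c t \<in> A" "t \<in> coords" "T \<subseteq> coords" using insert.prems by auto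
  have cR: "c \<in> T \<rightarrow> carrier R" "c t \<in> carrier R" using cT A(1) by auto
  define S where "S = (\<Oplus>\<^bsub>coord_space R m\<^esub>s\<in>T. c s \<odot>\<^bsub>coord_space R m\<^esub> s)"
  have Sc: "S \<in> coords" unfolding S_def by (rule finsum_smult_coords[OF insert.hyps(1) cT(4) cR(1)])
  have "(\<Oplus>\<^bsub>coord_space R m\<^esub>s\<in>insert t T. c s \<odot>\<^bsub>coord_space R m\<^esub> s) =
      c t \<odot>\<^bsub>coord_space R m\<^esub> t \<oplus>\<^bsub>coord_space R m\<^esub> S"
    unfolding S_def using insert.hyps cT cR by (intro V.finsum_insert) (auto intro!: coords_smult)
  moreover have "B (c t \<odot>\<^bsub>coord_space R m\<^esub> t \<oplus>\<^bsub>coord_space R m\<^esub> S) z = c t \<otimes> B t z \<oplus> B S z"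
    using bform_add[OF coords_smult[OF cR(2) cT(3)] Sc z] bform_smult[OF cR(2) cT(3) z] by simp
  moreover have "B S z \<in> A"
    unfolding S_def by (rule insert.IH[OF cT(4) cT(1) insert.prems(3)]) simp
  moreover have "c t \<otimes> B t z \<in> A" by (rule A(4)[OF cT(2) insert.prems(3)]) simp
  ultimately show ?case using A(3) by simp
qed

lemma lin_span_coords:
  assumes "A \<subseteq> carrier R" "S \<subseteq> coords"
  shows "lin_span A (coord_space R m) S \<subseteq> coords"
  unfolding lin_span_def using assms by (auto intro!: finsum_smult_coords)

text \<open>Integrality on generators extends linearly in one argument after the other. It serves
  twice: for the global lattice of a scalar form, and for a completed lattice, which is generated by
  the images of global vectors.\<close>

lemma lin_span_integral:
  assumes A: "A \<subseteq> carrier R" "\<zero> \<in> A" "\<And>a b. a \<in> A \<Longrightarrow> b \<in> A \<Longrightarrow> a \<oplus> b \<in> A"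
      "\<And>a b. a \<in> A \<Longrightarrow> b \<in> A \<Longrightarrow> a \<otimes> b \<in> A"
    and S: "S \<subseteq> coords" "\<And>s t. s \<in> S \<Longrightarrow> t \<in> S \<Longrightarrow> B s t \<in> A"
    and x: "x \<in> lin_span A (coord_space R m) S" and y: "y \<in> lin_span A (coord_space R m) S"
  shows "B x y \<in> A"
proof -
  have yc: "y \<in> coords" using lin_span_coords[OF A(1) S(1)] y by blast
  have half: "B s y \<in> A" if s: "s \<in> S" for s
  proof -
    have sc: "s \<in> coords" using s S(1) by blast
    obtain c T where T: "finite T" "T \<subseteq> S" "c \<in> T \<rightarrow> A" "y = (\<Oplus>\<^bsub>coord_space R m\<^esub>s\<in>T. c s \<odot>\<^bsub>coord_space R m\<^esub> s)"
      using y unfolding lin_span_def by blast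
    have "B y s \<in> A" unfolding T(4)
      by (rule bform_finsum_closed[OF A sc T(1) _ T(3)]) (use T(2) S s in auto)
    then show ?thesis using bform_sym[OF sc yc] by simp
  qed
  obtain c T where T: "finite T" "T \<subseteq> S" "c \<in> T \<rightarrow> A" "x = (\<Oplus>\<^bsub>coord_space R m\<^esub>s\<in>T. c s \<odot>\<^bsub>coord_space R m\<^esub> s)"
    using x unfolding lin_span_def by blast
  show ?thesis unfolding T(4)
    by (rule bform_finsum_closed[OF A yc T(1) _ T(3)]) (use T(2) S half in auto)
qed

lemma lattice_norm_base:
  assumes "\<one> \<in> A" "y \<in> L" "y \<in> coords"
  shows "B y y \<in> lattice_norm R A m G L"
proof -
  have "(\<Oplus>q\<in>{B y y}. \<one> \<otimes> q) = B y y"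
    using bform_closed[OF assms(3,3)] by (subst finsum_insert) auto
  then show ?thesis
    unfolding lattice_norm_def using assms by (intro CollectI exI[of _ "\<lambda>_. \<one>"] exI[of _ "{B y y}"]) auto
qed

end

section \<open>Values of lattices with a BONG\<close>

context valued_field
begin

lemma val_one: "\<nu> \<one> = 0"
proof -
  obtain n :: int where n: "\<nu> \<one> = ereal (of_int n)" using val_int[of \<one>] by auto
  have "\<nu> \<one> + \<nu> \<one> = \<nu> \<one>" using val_mult[of \<one> \<one>] by simp
  then show ?thesis unfolding n by (simp add: zero_ereal_def)
qed

lemma val_uminus:
  assumes "x \<in> carrier F"
  shows "\<nu> (\<ominus> x) = \<nu> x"
proof -
  have nz: "\<ominus> \<one> \<noteq> \<zero>" using minus_minus[of \<one>] by (metis minus_zero one_closed one_not_zero)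
  obtain n :: int where n: "\<nu> (\<ominus> \<one>) = ereal (of_int n)" using val_int[OF _ nz] by auto
  have "\<nu> (\<ominus> \<one>) + \<nu> (\<ominus> \<one>) = 0" using val_mult[of "\<ominus> \<one>" "\<ominus> \<one>"] val_one by (simp add: l_minus)
  then have "\<nu> (\<ominus> \<one>) = 0" unfolding n by (simp add: zero_ereal_def)
  then show ?thesis using val_mult[of "\<ominus> \<one>" x] assms by (simp add: l_minus)
qed

lemma val_add_ge: "x \<in> carrier F \<Longrightarrow> y \<in> carrier F \<Longrightarrow> c \<le> \<nu> x \<Longrightarrow> c \<le> \<nu> y \<Longrightarrow> c \<le> \<nu> (x \<oplus> y)"
  using val_add[of x y] by (meson min.boundedI order_trans)

lemma val_diff_ge: "x \<in> carrier F \<Longrightarrow> y \<in> carrier F \<Longrightarrow> c \<le> \<nu> x \<Longrightarrow> c \<le> \<nu> y \<Longrightarrow> c \<le> \<nu> (x \<ominus> y)"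
  unfolding a_minus_def by (rule val_add_ge) (simp_all add: val_uminus)

lemma val_mult_ge:
  assumes "x \<in> carrier F" "y \<in> carrier F" "c \<le> \<nu> x" "0 \<le> \<nu> y"
  shows "c \<le> \<nu> (x \<otimes> y)" "c \<le> \<nu> (y \<otimes> x)"
proof -
  show "c \<le> \<nu> (x \<otimes> y)" using add_mono[OF assms(3,4)] val_mult[OF assms(1,2)] by simp
  then show "c \<le> \<nu> (y \<otimes> x)" using m_comm[OF assms(1,2)] by simp
qed

lemma val_inv:
  assumes "x \<in> carrier F" "x \<noteq> \<zero>"
  shows "\<nu> (inv x) = - \<nu> x"
proof -
  have ix: "inv x \<in> carrier F" "x \<otimes> inv x = \<one>" "inv x \<noteq> \<zero>"
    using assms field_Units by (auto intro: Units_inv_closed Units_r_inv simp: nonzero_imp_inverse_nonzero)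
  obtain n :: int where n: "\<nu> x = ereal (of_int n)" using val_int[OF assms] by blast
  obtain k :: int where k: "\<nu> (inv x) = ereal (of_int k)" using val_int[OF ix(1,3)] by blast
  have "\<nu> x + \<nu> (inv x) = 0" using val_mult[OF assms(1) ix(1)] ix(2) val_one by simp
  then show ?thesis unfolding n k by (simp add: zero_ereal_def)
qed

definition vring :: "'a set" where
  "vring = {x \<in> carrier F. 0 \<le> \<nu> x}"

lemma vring_subring:
  "vring \<subseteq> carrier F" "\<zero> \<in> vring" "\<one> \<in> vring"
  "a \<in> vring \<Longrightarrow> b \<in> vring \<Longrightarrow> a \<oplus> b \<in> vring" "a \<in> vring \<Longrightarrow> b \<in> vring \<Longrightarrow> a \<otimes> b \<in> vring"
  using val_add_ge[of a b 0] val_mult_ge(1)[of a b 0]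
  by (auto simp: vring_def val_zero val_one)

text \<open>The supremum in the definition of the relative defect is attained because orders are integers.\<close>

lemma square_approximation:
  assumes c: "c \<in> carrier F" "c \<noteq> \<zero>" and p: "p \<in> carrier F" "\<nu> p = 1"
    and d: "1 < (INF y\<in>(\<lambda>y. inv c \<otimes> y) `
      (\<Inter>x\<in>carrier F. {(c \<ominus> x \<otimes> x) \<otimes> y | y. y \<in> vring}). \<nu> y)"
  shows "\<exists>t\<in>carrier F. \<nu> c + 2 \<le> \<nu> (c \<ominus> t \<otimes> t)"
proof (rule ccontr)
  assume contra: "\<not> ?thesis"
  obtain n :: int where n: "\<nu> c = ereal (of_int n)" using val_int[OF c] by blast
  have ic: "inv c \<in> carrier F" "c \<otimes> inv c = \<one>" using c field_Units by (auto intro: Units_inv_closed Units_r_inv)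
  have cp: "c \<otimes> p \<in> carrier F" using c p by simp
  \<comment> \<open>Without an approximating square, each \<open>c \<ominus> x \<otimes> x\<close>
    has order at most that of \<open>c \<otimes> p\<close> and hence divides it. Then
    \<open>p\<close> itself lies in the ideal whose order is supposed to exceed 1, although
    \<open>\<nu> p = 1\<close>.\<close>
  have "c \<otimes> p \<in> {(c \<ominus> x \<otimes> x) \<otimes> y | y. y \<in> vring}" if x: "x \<in> carrier F" for x
  proof -
    define e where "e = c \<ominus> x \<otimes> x"
    have e: "e \<in> carrier F" using c x by (simp add: e_def)
    have lt: "\<not> \<nu> c + 2 \<le> \<nu> e" using contra x unfolding e_def by blast
    have nz: "e \<noteq> \<zero>" using lt val_zero by auto
    obtain k :: int where k: "\<nu> e = ereal (of_int k)" using val_int[OF e nz] by blast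
    have kn: "k \<le> n + 1"
    proof -
      have "\<not> of_int n + 2 \<le> (of_int k :: real)" using lt unfolding n k by (simp add: numeral_eq_ereal)
      then have "of_int k < (of_int (n + 2) :: real)" by simp
      then have "k < n + 2" by (simp only: of_int_less_iff)
      then show ?thesis by simp
    qed
    have ie: "inv e \<in> carrier F" "e \<otimes> inv e = \<one>" using e nz field_Units by (auto intro: Units_inv_closed Units_r_inv)
    have "\<nu> (inv e \<otimes> (c \<otimes> p)) = - \<nu> e + (\<nu> c + 1)"
      using val_mult[OF ie(1) cp] val_mult[OF c(1) p(1)] val_inv[OF e nz] p(2) by simp
    also have "\<dots> = ereal (of_int (n + 1 - k))" unfolding n k by (simp add: one_ereal_def)
    finally have "0 \<le> \<nu> (inv e \<otimes> (c \<otimes> p))" using kn by simp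
    then have "inv e \<otimes> (c \<otimes> p) \<in> vring" using ie cp by (simp add: vring_def)
    moreover have "c \<otimes> p = e \<otimes> (inv e \<otimes> (c \<otimes> p))" using ie e cp by (simp flip: m_assoc[OF e ie(1) cp])
    ultimately show ?thesis unfolding e_def by blast
  qed
  then have "c \<otimes> p \<in> (\<Inter>x\<in>carrier F. {(c \<ominus> x \<otimes> x) \<otimes> y | y. y \<in> vring})" by blast
  then have "inv c \<otimes> (c \<otimes> p) \<in> (\<lambda>y. inv c \<otimes> y) ` (\<Inter>x\<in>carrier F. {(c \<ominus> x \<otimes> x) \<otimes> y | y. y \<in> vring})"
    by (rule imageI)
  moreover have "inv c \<otimes> (c \<otimes> p) = p"
    using ic c p m_assoc[OF ic(1) c(1) p(1)] m_comm[OF c(1) ic(1)] by simp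
  ultimately have "p \<in> (\<lambda>y. inv c \<otimes> y) ` (\<Inter>x\<in>carrier F. {(c \<ominus> x \<otimes> x) \<otimes> y | y. y \<in> vring})" by simp
  from INF_lower[OF this, of \<nu>] d p(2) show False by simp
qed

end

section \<open>Orthogonal projections and values along a BONG\<close>

locale valued_gram = valued_field F \<nu> + gram F m G
  for F :: "'a ring" (structure) and \<nu> and m and G
begin

abbreviation proj :: "(nat \<Rightarrow> 'a) \<Rightarrow> (nat \<Rightarrow> 'a) \<Rightarrow> nat \<Rightarrow> 'a" where
  "proj \<equiv> proj_orth F m G"

lemma
  assumes x: "x \<in> coords" "B x x \<noteq> \<zero>" and y: "y \<in> coords"
  shows proj_coords: "proj x y \<in> coords"
    and bform_proj: "z \<in> coords \<Longrightarrow> B (proj x y) z = B y z \<ominus> B y x \<otimes> inv (B x x) \<otimes> B x z"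
    and qform_proj: "B (proj x y) (proj x y) =
      B y y \<ominus> B x x \<otimes> ((B y x \<otimes> inv (B x x)) \<otimes> (B y x \<otimes> inv (B x x)))"
proof -
  have a: "B x x \<in> carrier F" "B y x \<in> carrier F" "B y y \<in> carrier F" using bform_closed x y by auto
  have ia: "inv (B x x) \<in> carrier F" "B x x \<otimes> inv (B x x) = \<one>"
    using a x field_Units by (auto intro: Units_inv_closed Units_r_inv)
  define t where "t = B y x \<otimes> inv (B x x)"
  have t: "t \<in> carrier F" using a ia by (simp add: t_def)
  have p: "proj x y = y \<ominus>\<^bsub>coord_space F m\<^esub> t \<odot>\<^bsub>coord_space F m\<^esub> x"
    by (simp add: proj_orth_def t_def)
  show pc: "proj x y \<in> coords" unfolding p by (rule coords_diff[OF y coords_smult[OF t x(1)]])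
  have bp: "B (proj x y) z = B y z \<ominus> t \<otimes> B x z" if z: "z \<in> coords" for z
    unfolding p by (rule bform_diff_smult[OF t x(1) y z])
  then show "B (proj x y) z = B y z \<ominus> B y x \<otimes> inv (B x x) \<otimes> B x z" if "z \<in> coords"
    using that unfolding t_def .
  have tx: "t \<otimes> B x x = B y x"
  proof -
    have "t \<otimes> B x x = B y x \<otimes> (inv (B x x) \<otimes> B x x)" unfolding t_def by (rule m_assoc[OF a(2) ia(1) a(1)])
    also have "inv (B x x) \<otimes> B x x = \<one>" using m_comm[OF a(1) ia(1)] ia(2) by (rule trans[OF sym])
    also have "B y x \<otimes> \<one> = B y x" by (rule r_one[OF a(2)])
    finally show ?thesis .
  qed
  have "B (proj x y) x = B y x \<ominus> t \<otimes> B x x" by (rule bp[OF x(1)])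
  also have "\<dots> = \<zero>" unfolding tx a_minus_def by (rule r_neg[OF a(2)])
  finally have 0: "B x (proj x y) = \<zero>" using bform_sym[OF x(1) pc] by simp
  have "B (proj x y) (proj x y) = B y (proj x y) \<ominus> t \<otimes> B x (proj x y)" by (rule bp[OF pc])
  also have "\<dots> = B (proj x y) y" unfolding 0 using t bform_sym[OF y pc] bform_closed[OF pc y] by (simp add: a_minus_def)
  also have "\<dots> = B y y \<ominus> t \<otimes> B x y" by (rule bp[OF y])
  also have "t \<otimes> B x y = t \<otimes> (t \<otimes> B x x)" using bform_sym[OF x(1) y] tx by simp
  also have "\<dots> = B x x \<otimes> (t \<otimes> t)" using t a by (simp add: m_ac)
  finally show "B (proj x y) (proj x y) =
      B y y \<ominus> B x x \<otimes> ((B y x \<otimes> inv (B x x)) \<otimes> (B y x \<otimes> inv (B x x)))" unfolding t_def .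
qed

lemma bong_anisotropic:
  assumes "is_bong F A m G xs L" "L \<subseteq> coords" "x \<in> set xs"
  shows "x \<in> coords \<and> B x x \<noteq> \<zero>"
  using assms
proof (induction xs arbitrary: L)
  case (Cons a xs)
  have a: "a \<in> coords" "B a a \<noteq> \<zero>" using Cons.prems by auto
  have "proj a ` L \<subseteq> coords" using proj_coords[OF a] Cons.prems(2) by blast
  then show ?case using Cons.IH[of "proj a ` L"] Cons.prems a by auto
qed simp

text \<open>Completing the square. Here \<open>b\<close> is the inverse of \<open>a\<close>, and
  \<open>s \<otimes> s\<close> will be close to \<open>a \<otimes> a'\<close>, so that
  \<open>a'\<close> times the square of \<open>u\<close> is close to \<open>a\<close> times the
  square of \<open>b \<otimes> s \<otimes> u\<close>. Merging this with \<open>a\<close> times the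
  square of \<open>t\<close> costs a cross term divisible by 2.\<close>

lemma square_step_identity:
  assumes "a \<in> carrier F" "b \<in> carrier F" "a' \<in> carrier F" "s \<in> carrier F" "t \<in> carrier F" "u \<in> carrier F"
      "q \<in> carrier F" "a \<otimes> b = \<one>"
  shows "q \<ominus> a \<otimes> ((t \<oplus> b \<otimes> s \<otimes> u) \<otimes> (t \<oplus> b \<otimes> s \<otimes> u)) =
    ((q \<ominus> a \<otimes> (t \<otimes> t)) \<ominus> a' \<otimes> (u \<otimes> u)) \<oplus> (b \<otimes> (u \<otimes> u)) \<otimes> (a \<otimes> a' \<ominus> s \<otimes> s)
      \<ominus> (\<one> \<oplus> \<one>) \<otimes> (t \<otimes> s \<otimes> u)"
proof -
  \<comment> \<open>The product \<open>a \<otimes> b\<close> is kept visible in both expansions, so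
    that it can be replaced by \<open>\<one>\<close> before the final identity, which then holds in
    every commutative ring.\<close>
  have 1: "a \<otimes> ((t \<oplus> b \<otimes> s \<otimes> u) \<otimes> (t \<oplus> b \<otimes> s \<otimes> u)) =
      a \<otimes> (t \<otimes> t) \<oplus> (a \<otimes> b) \<otimes> ((\<one> \<oplus> \<one>) \<otimes> (t \<otimes> s \<otimes> u)) \<oplus> (a \<otimes> b) \<otimes> (b \<otimes> (s \<otimes> s \<otimes> u \<otimes> u))"
    using assms(1-7) by algebra
  have 2: "(b \<otimes> (u \<otimes> u)) \<otimes> (a \<otimes> a' \<ominus> s \<otimes> s) = (a \<otimes> b) \<otimes> (a' \<otimes> (u \<otimes> u)) \<ominus> b \<otimes> (s \<otimes> s \<otimes> u \<otimes> u)"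
    using assms(1-7) by algebra
  show ?thesis unfolding 1 2 assms(8) using assms(1-7) by algebra
qed

text \<open>If \<open>a\<^sub>2\<close> is a unit, then \<open>a\<^sub>1a\<^sub>2\<close> is a square modulo \<open>\<pp>\<^sup>2\<close>, so the values \<open>a\<^sub>1t\<^sup>2 + a\<^sub>2u\<^sup>2\<close> are again
  \<open>a\<^sub>1\<close> times a square modulo \<open>\<pp>\<^sup>2\<close>; otherwise \<open>a\<^sub>2\<close> has even order, so it vanishes modulo \<open>\<pp>\<^sup>2\<close>.\<close>

lemma bong_values:
  assumes two: "2 \<le> \<nu> (\<one> \<oplus> \<one>)"
    and "is_bong F vring m G (x # xs) L" "L \<subseteq> coords"
    and "\<And>y z. y \<in> L \<Longrightarrow> z \<in> L \<Longrightarrow> B y z \<in> vring"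
    and "\<nu> (B x x) = 0"
    and "\<And>i. Suc i < length (x # xs) \<Longrightarrow>
      \<exists>t\<in>carrier F. let c = B ((x # xs) ! i) ((x # xs) ! i) \<otimes> B ((x # xs) ! Suc i) ((x # xs) ! Suc i)
        in \<nu> c + 2 \<le> \<nu> (c \<ominus> t \<otimes> t)"
    and "y \<in> L"
  shows "\<exists>t\<in>vring. 2 \<le> \<nu> (B y y \<ominus> B x x \<otimes> (t \<otimes> t))"
  using assms(2-)
proof (induction xs arbitrary: x L y)
  case (Nil x L y)
  have x: "x \<in> L" "x \<in> coords" "B x x \<noteq> \<zero>" and y: "y \<in> coords" using Nil.prems by auto
  define t where "t = B y x \<otimes> inv (B x x)"
  have a: "B x x \<in> carrier F" "B y x \<in> carrier F" using bform_closed x y by auto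
  have ia: "inv (B x x) \<in> carrier F" using a x field_Units by (auto intro: Units_inv_closed)
  have "B y x \<in> vring" using Nil.prems(3,6) x(1) by blast
  moreover have "inv (B x x) \<in> vring" using ia val_inv[OF a(1) x(3)] Nil.prems(4) by (simp add: vring_def)
  ultimately have t: "t \<in> vring" unfolding t_def by (rule vring_subring)
  \<comment> \<open>The BONG ends here, so the whole lattice projects to 0 and the value of
    \<open>y\<close> is exactly \<open>B x x\<close> times a square.\<close>
  have "proj x y = \<zero>\<^bsub>coord_space F m\<^esub>" using Nil.prems(1,6) by auto
  moreover have "\<zero>\<^bsub>coord_space F m\<^esub> \<in> coords"
    by (rule abelian_monoid.zero_closed[OF abelian_group.axioms(1)[OF coord_space_abelian_group]])
  ultimately have "B (proj x y) (proj x y) = \<zero>" using bform_zero by simp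
  then have "B y y \<ominus> B x x \<otimes> (t \<otimes> t) = \<zero>" using qform_proj[OF x(2,3) y] unfolding t_def by simp
  then show ?case using t val_zero by (intro bexI[of _ t]) simp
next
  case (Cons x' xs x L y)
  have x: "x \<in> L" "x \<in> coords" "B x x \<noteq> \<zero>" and y: "y \<in> coords" using Cons.prems by auto
  have a: "B x x \<in> carrier F" "B y x \<in> carrier F" "B y y \<in> carrier F" using bform_closed x y by auto
  have ia: "inv (B x x) \<in> carrier F" "B x x \<otimes> inv (B x x) = \<one>"
    using a x field_Units by (auto intro: Units_inv_closed Units_r_inv)
  have iav: "inv (B x x) \<in> vring" using ia val_inv[OF a(1) x(3)] Cons.prems(4) by (simp add: vring_def)
  define L' where "L' = proj x ` L"
  have bong': "is_bong F vring m G (x' # xs) L'" using Cons.prems(1) by (simp add: L'_def)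
  have L'c: "L' \<subseteq> coords" unfolding L'_def using proj_coords[OF x(2,3)] Cons.prems(2) by blast
  \<comment> \<open>As \<open>B x x\<close> is a unit, the coefficients of the projection are
    integral. Hence the form stays integral on the projected lattice, as the induction
    requires.\<close>
  have coeff: "B z x \<otimes> inv (B x x) \<in> vring" if "z \<in> L" for z
    using Cons.prems(3)[OF that x(1)] iav by (rule vring_subring)
  have B'1: "B (proj x z) w \<in> vring" if z: "z \<in> L" and w: "w \<in> L" for z w
  proof -
    have c: "z \<in> coords" "w \<in> coords" using z w Cons.prems(2) by auto
    have "B z x \<otimes> inv (B x x) \<otimes> B x w \<in> vring"
      using coeff[OF z] Cons.prems(3)[OF x(1) w] by (rule vring_subring)
    then show ?thesis
      unfolding bform_proj[OF x(2,3) c] using Cons.prems(3)[OF z w] val_diff_ge[of _ _ 0]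
      by (auto simp: vring_def)
  qed
  have B': "B z w \<in> vring" if z: "z \<in> L'" and w: "w \<in> L'" for z w
  proof -
    obtain z0 w0 where zw: "z = proj x z0" "w = proj x w0" "z0 \<in> L" "w0 \<in> L"
      using z w unfolding L'_def by blast
    have c: "z0 \<in> coords" "w0 \<in> coords" using zw Cons.prems(2) by auto
    have zc: "z \<in> coords" "w \<in> coords" using z w L'c by auto
    have "B z0 w \<in> vring" using bform_sym[OF c(1) zc(2)] B'1[OF zw(4,3)] zw by simp
    moreover have "B x w \<in> vring" using bform_sym[OF x(2) zc(2)] B'1[OF zw(4) x(1)] zw by simp
    then have "B z0 x \<otimes> inv (B x x) \<otimes> B x w \<in> vring" by (rule vring_subring(5)[OF coeff[OF zw(3)]])
    ultimately show ?thesis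
      unfolding zw(1) bform_proj[OF x(2,3) c(1) zc(2)] using val_diff_ge[of _ _ 0]
      by (auto simp: vring_def)
  qed
  have x': "x' \<in> L'" "x' \<in> coords" "B x' x' \<noteq> \<zero>" using bong' L'c by auto
  have a': "B x' x' \<in> carrier F" using bform_closed x' by auto
  define t where "t = B y x \<otimes> inv (B x x)"
  have t: "t \<in> vring" unfolding t_def by (rule coeff[OF Cons.prems(6)])
  define q where "q = B (proj x y) (proj x y)"
  have q: "q = B y y \<ominus> B x x \<otimes> (t \<otimes> t)" unfolding q_def t_def by (rule qform_proj[OF x(2,3) y])
  have pL': "proj x y \<in> L'" using Cons.prems(6) by (simp add: L'_def)
  obtain s where s: "s \<in> carrier F"
    "\<nu> (B x x \<otimes> B x' x') + 2 \<le> \<nu> (B x x \<otimes> B x' x' \<ominus> s \<otimes> s)"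
    using Cons.prems(5)[of 0] by (auto simp: Let_def)
  define c where "c = B x x \<otimes> B x' x'"
  have cF: "c \<in> carrier F" using a a' by (simp add: c_def)
  have vc: "\<nu> c = \<nu> (B x' x')" using val_mult[OF a(1) a'] Cons.prems(4) by (simp add: c_def)
  have s2: "\<nu> c + 2 \<le> \<nu> (c \<ominus> s \<otimes> s)" using s(2) by (simp add: c_def)
  have ss: "s \<otimes> s \<in> carrier F" "c \<ominus> s \<otimes> s \<in> carrier F" using s cF by auto
  have ssc: "s \<otimes> s = c \<ominus> (c \<ominus> s \<otimes> s)" using s(1) cF by algebra
  obtain k :: int where k: "\<nu> (B x' x') = ereal (of_int k)" using val_int[OF a' x'(3)] by blast
  have "0 \<le> \<nu> (B x' x')" using B'[OF x'(1) x'(1)] by (simp add: vring_def)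
  then have k0: "0 \<le> k" unfolding k by simp
  show ?case
  proof (cases "k = 0")
    case True
    then have v0: "\<nu> (B x' x') = 0" using k by (simp add: zero_ereal_def)
    have "\<exists>u\<in>vring. 2 \<le> \<nu> (q \<ominus> B x' x' \<otimes> (u \<otimes> u))"
      unfolding q_def
    proof (rule Cons.IH[OF bong' L'c B' v0 _ pL'])
      fix i assume "Suc i < length (x' # xs)"
      then show "\<exists>t\<in>carrier F. let c = B ((x' # xs) ! i) ((x' # xs) ! i) \<otimes> B ((x' # xs) ! Suc i) ((x' # xs) ! Suc i)
        in \<nu> c + 2 \<le> \<nu> (c \<ominus> t \<otimes> t)"
        using Cons.prems(5)[of "Suc i"] by simp
    qed
    then obtain u where u: "u \<in> vring" "2 \<le> \<nu> (q \<ominus> B x' x' \<otimes> (u \<otimes> u))" by blast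
    have uF: "u \<in> carrier F" and tF: "t \<in> carrier F" using u t vring_subring(1) by auto
    have s2': "2 \<le> \<nu> (c \<ominus> s \<otimes> s)" using s2 vc v0 by simp
    \<comment> \<open>The root \<open>s\<close> is known only to lie in the field. Its square
      differs from the unit \<open>c\<close> by an element of order at least 2, so \<open>s\<close>
      is integral.\<close>
    have "0 \<le> \<nu> (c \<ominus> (c \<ominus> s \<otimes> s))"
      by (rule val_diff_ge[OF cF ss(2)]) (use vc v0 order_trans[OF _ s2', of 0] in auto)
    then have "0 \<le> \<nu> s + \<nu> s" unfolding ssc[symmetric] val_mult[OF s(1) s(1)] .
    then have "0 \<le> \<nu> s" by (cases "\<nu> s") auto
    then have sv: "s \<in> vring" using s(1) by (simp add: vring_def)
    define w where "w = t \<oplus> inv (B x x) \<otimes> s \<otimes> u"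
    have wv: "w \<in> vring" unfolding w_def by (intro vring_subring t iav sv u)
    have id: "B y y \<ominus> B x x \<otimes> (w \<otimes> w) =
        ((B y y \<ominus> B x x \<otimes> (t \<otimes> t)) \<ominus> B x' x' \<otimes> (u \<otimes> u)) \<oplus>
        (inv (B x x) \<otimes> (u \<otimes> u)) \<otimes> (B x x \<otimes> B x' x' \<ominus> s \<otimes> s) \<ominus> (\<one> \<oplus> \<one>) \<otimes> (t \<otimes> s \<otimes> u)"
      unfolding w_def by (rule square_step_identity[OF a(1) ia(1) a' s(1) tF uF a(3) ia(2)])
    have "inv (B x x) \<otimes> (u \<otimes> u) \<in> vring" "t \<otimes> s \<otimes> u \<in> vring"
      by (intro vring_subring t iav sv u)+
    then have 1: "2 \<le> \<nu> ((inv (B x x) \<otimes> (u \<otimes> u)) \<otimes> (c \<ominus> s \<otimes> s))" "2 \<le> \<nu> ((\<one> \<oplus> \<one>) \<otimes> (t \<otimes> s \<otimes> u))"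
      using val_mult_ge(2)[OF ss(2) _ s2'] val_mult_ge(1)[OF _ _ two] by (auto simp: vring_def)
    have "2 \<le> \<nu> (B y y \<ominus> B x x \<otimes> (w \<otimes> w))"
    proof -
      have E1: "(B y y \<ominus> B x x \<otimes> (t \<otimes> t)) \<ominus> B x' x' \<otimes> (u \<otimes> u) \<in> carrier F"
        by (simp add: a a' tF uF)
      have E2: "(inv (B x x) \<otimes> (u \<otimes> u)) \<otimes> (c \<ominus> s \<otimes> s) \<in> carrier F"
        using ia(1) uF ss(2) by simp
      have E3: "(\<one> \<oplus> \<one>) \<otimes> (t \<otimes> s \<otimes> u) \<in> carrier F" using tF uF s(1) by simp
      show ?thesis
        unfolding id c_def[symmetric]
        by (rule val_diff_ge[OF a_closed[OF E1 E2] E3 val_add_ge[OF E1 E2 u(2)[unfolded q] 1(1)] 1(2)])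
    qed
    then show ?thesis using wv by blast
  next
    case False
    \<comment> \<open>The square of \<open>s\<close> differs from \<open>c\<close> by an element of
      larger order than \<open>c\<close>, so \<open>k\<close>, the order of \<open>c\<close>, is
      twice the order of \<open>s\<close>. A nonzero even \<open>k\<close> with
      \<open>0 \<le> k\<close> is at least 2.\<close>
    have k2: "2 \<le> k"
    proof -
      have lt: "\<nu> c < \<nu> (c \<ominus> s \<otimes> s)"
        using s2 unfolding vc k by (rule less_le_trans[rotated]) simp
      have "\<nu> (s \<otimes> s) = \<nu> c"
      proof (rule antisym)
        have "\<nu> c \<le> \<nu> (c \<ominus> (c \<ominus> s \<otimes> s))" 
          by (rule val_diff_ge[OF cF ss(2)]) (use lt in auto)
        then show "\<nu> c \<le> \<nu> (s \<otimes> s)" unfolding ssc[symmetric] .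
        show "\<nu> (s \<otimes> s) \<le> \<nu> c"
        proof (rule ccontr)
          assume "\<not> \<nu> (s \<otimes> s) \<le> \<nu> c"
          then have "\<nu> c < min (\<nu> (c \<ominus> s \<otimes> s)) (\<nu> (s \<otimes> s))" using lt by simp
          also have "\<dots> \<le> \<nu> ((c \<ominus> s \<otimes> s) \<oplus> s \<otimes> s)" by (rule val_add[OF ss(2,1)])
          also have "(c \<ominus> s \<otimes> s) \<oplus> s \<otimes> s = c" using s(1) cF by algebra
          finally show False by simp
        qed
      qed
      then have eq: "\<nu> s + \<nu> s = ereal (of_int k)" using val_mult[OF s(1) s(1)] vc k by simp
      have "s \<noteq> \<zero>" using eq val_zero by auto
      then obtain j :: int where j: "\<nu> s = ereal (of_int j)" using val_int[OF s(1)] by blast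
      have "of_int (j + j) = (of_int k :: real)" using eq unfolding j by simp
      then have "j + j = k" by (simp only: of_int_eq_iff)
      then show ?thesis using k0 False by presburger
    qed
    \<comment> \<open>By the BONG condition \<open>B x' x'\<close> generates the norm of the
      projected lattice, so it divides the value \<open>q\<close>; the remaining BONG vectors do not
      have to be inspected.\<close>
    have "q \<in> lattice_norm F vring m G L'"
      unfolding q_def using L'c pL' by (intro lattice_norm_base vring_subring) auto
    then have "q \<in> {c \<otimes> B x' x' | c. c \<in> vring}" using bong' by simp
    then obtain r where r: "r \<in> vring" "q = r \<otimes> B x' x'" by blast
    have "2 \<le> \<nu> (B x' x')"
    proof -
      have "(2::real) \<le> of_int k" using k2 by simp
      then show ?thesis unfolding k by (simp add: numeral_eq_ereal)
    qed
    then have "2 \<le> \<nu> q" unfolding r(2) using r(1) a' by (intro val_mult_ge(2)) (auto simp: vring_def)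
    then show ?thesis using t unfolding q by blast
  qed
qed

end

context valued_gram
begin

lemma bong_no_odd_value:
  assumes two: "2 \<le> \<nu> (\<one> \<oplus> \<one>)"
    and bong: "is_bong F vring m G (x # xs) L" and Lc: "L \<subseteq> coords"
    and int: "\<And>y z. y \<in> L \<Longrightarrow> z \<in> L \<Longrightarrow> B y z \<in> vring"
    and approx: "\<And>i. Suc i < length (x # xs) \<Longrightarrow>
      \<exists>t\<in>carrier F. let c = B ((x # xs) ! i) ((x # xs) ! i) \<otimes> B ((x # xs) ! Suc i) ((x # xs) ! Suc i)
        in \<nu> c + 2 \<le> \<nu> (c \<ominus> t \<otimes> t)"
    and one: "z \<in> L" "B z z = \<one>" and y: "y \<in> L"
  shows "\<nu> (B y y) \<noteq> 1"
proof
  assume v1: "\<nu> (B y y) = 1"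
  have x: "x \<in> L" "x \<in> coords" "B x x \<noteq> \<zero>" using bong Lc by auto
  have a: "B x x \<in> carrier F" using bform_closed x by auto
  have yF: "B y y \<in> carrier F" using bform_closed y Lc by auto
  have "\<one> \<in> lattice_norm F vring m G L"
    using lattice_norm_base[of vring z L] vring_subring(3) one Lc by auto
  then have "\<one> \<in> {c \<otimes> B x x | c. c \<in> vring}" using bong by simp
  then obtain c where c: "c \<in> vring" "\<one> = c \<otimes> B x x" by blast
  \<comment> \<open>\<open>\<one>\<close> is an integral multiple of the first BONG value; two
    nonnegative orders with sum 0 both vanish.\<close>
  have "\<nu> c + \<nu> (B x x) = 0"
    using val_mult[of c "B x x"] c a vring_subring(1) val_one by auto
  moreover have "0 \<le> \<nu> c" "0 \<le> \<nu> (B x x)" using c(1) int[OF x(1) x(1)] by (auto simp: vring_def)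
  ultimately have a0: "\<nu> (B x x) = 0" by (cases "\<nu> c"; cases "\<nu> (B x x)") auto
  obtain t where t: "t \<in> vring" "2 \<le> \<nu> (B y y \<ominus> B x x \<otimes> (t \<otimes> t))"
    using bong_values[OF two bong Lc int a0 approx y] by blast
  have tF: "t \<in> carrier F" using t(1) vring_subring(1) by blast
  define w where "w = B x x \<otimes> (t \<otimes> t)"
  define d where "d = B y y \<ominus> w"
  have wF: "w \<in> carrier F" and dF: "d \<in> carrier F" using a tF yF by (simp_all add: w_def d_def)
  have d2: "2 \<le> \<nu> d" using t(2) by (simp add: d_def w_def)
  have d1: "1 < \<nu> d" by (rule less_le_trans[OF _ d2]) (simp add: numeral_eq_ereal one_ereal_def)
  have "1 \<le> \<nu> w"
  proof -
    have e: "w = B y y \<ominus> d" unfolding d_def using wF yF by algebra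
    have "1 \<le> \<nu> (B y y \<ominus> d)"
      by (rule val_diff_ge[OF yF dF]) (use v1 d1 in auto)
    then show ?thesis unfolding e[symmetric] .
  qed
  moreover have "\<nu> w \<le> 1"
  proof (rule ccontr)
    assume "\<not> \<nu> w \<le> 1"
    then have "1 < min (\<nu> d) (\<nu> w)" using d1 by simp
    also have "\<dots> \<le> \<nu> (d \<oplus> w)" by (rule val_add[OF dF wF])
    also have "d \<oplus> w = B y y" unfolding d_def using wF yF by algebra
    finally show False using v1 by simp
  qed
  ultimately have w1: "\<nu> w = 1" by (rule antisym[rotated])
  have "\<nu> w = \<nu> t + \<nu> t"
    using val_mult[OF a, of "t \<otimes> t"] val_mult[OF tF tF] a0 tF by (simp add: w_def)
  then have tt: "\<nu> t + \<nu> t = 1" using w1 by simp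
  then have "t \<noteq> \<zero>" using val_zero by auto
  then obtain j :: int where j: "\<nu> t = ereal (of_int j)" using val_int[OF tF] by blast
  have "of_int (j + j) = (of_int 1 :: real)" using tt unfolding j by (simp add: one_ereal_def)
  then have "j + j = 1" by (simp only: of_int_eq_iff)
  then show False by presburger
qed

end

section \<open>Local completions of a lattice\<close>

context dyadic
begin

sublocale completion: valued_field "completion P" "ord_completion P"
  by (rule completion_valued_field)

lemma completion_vring: "completion.vring = completion_integers P"
  by (simp add: completion.vring_def completion_integers_def)

lemma to_completion_ring_hom: "ring_hom_cring field_rec (completion P) (to_completion P)"
  by (intro ring_hom_cring.intro ring_hom_cring_axioms.intro to_completion_hom completion_cring cring_from_type_algebra)

lemma to_completion_closed: "to_completion P x \<in> carrier (completion P)"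
  using ring_hom_closed[OF to_completion_hom, of x] by simp

abbreviation embed :: "nat \<Rightarrow> (nat \<Rightarrow> 'k) \<Rightarrow> nat \<Rightarrow> (nat \<Rightarrow> 'k) set" where
  "embed m x \<equiv> \<lambda>i\<in>{..<m}. to_completion P (x i)"

lemma bform_completion:
  "bform (completion P) m (local_gram P G) (embed m x) (embed m y) = to_completion P (bform field_rec m G x y)"
proof -
  interpret h: ring_hom_cring field_rec "completion P" "to_completion P" by (rule to_completion_ring_hom)
  have "to_completion P (bform field_rec m G x y) =
      (\<Oplus>\<^bsub>completion P\<^esub>i\<in>{..<m}. \<Oplus>\<^bsub>completion P\<^esub>j\<in>{..<m}.
        to_completion P (x i) \<otimes>\<^bsub>completion P\<^esub> to_completion P (G i j) \<otimes>\<^bsub>completion P\<^esub> to_completion P (y j))"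
    unfolding bform_def by (simp add: h.hom_finsum comp_def h.hom_mult[simplified])
  also have "\<dots> = bform (completion P) m (local_gram P G) (embed m x) (embed m y)"
    unfolding bform_def local_gram_def
    by (intro completion.finsum_cong' refl)
      (auto intro!: completion.finsum_closed Pi_I completion.m_closed to_completion_closed)
  finally show ?thesis by (rule sym)
qed

lemma local_gram_matrix: "gram_matrix field_rec m G \<Longrightarrow> gram_matrix (completion P) m (local_gram P G)"
  by (simp add: gram_matrix_def local_gram_def to_completion_closed)

text \<open>The local contradiction in global terms: besides the BONG, it takes integrality of the
  form on \<open>L\<close>, a vector of value 1 and a vector whose value has order 1. All three pass
  to the completion, where the last one is excluded as soon as 2 has order at least 2.\<close>

lemma ord_2_eq_1:
  assumes G: "gram_matrix field_rec m G" and L: "\<And>x y. x \<in> L \<Longrightarrow> y \<in> L \<Longrightarrow> algebraic_int (bform field_rec m G x y)"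
    and bong: "length as = m" "has_bong_values (completion P) (completion_integers P) m (local_gram P G) (local_lattice P m L) as"
      "\<And>i. Suc i < m \<Longrightarrow> 1 < relative_defect P (as ! i \<otimes>\<^bsub>completion P\<^esub> as ! Suc i)"
    and one: "z \<in> L" "bform field_rec m G z z = 1"
    and y: "y \<in> L" "ord_at P (bform field_rec m G y y) = 1"
    and m: "0 < m"
  shows "ord_at P 2 = 1"
proof (rule ccontr)
  assume n1: "ord_at P 2 \<noteq> 1"
  have v2: "2 \<le> ord_at P 2"
  proof -
    obtain k :: int where k: "ord_at P 2 = ereal (of_int k)" using ord_at_int[of 2] by auto
    have "1 \<le> (of_int k :: real)" "of_int k \<noteq> (1 :: real)"
      using ord_at_prime[OF P_two] n1 unfolding k by (simp_all add: one_ereal_def)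
    then have "(2 :: real) \<le> of_int k" by simp
    then show ?thesis unfolding k by (simp add: numeral_eq_ereal)
  qed
  interpret valued_gram "completion P" "ord_completion P" m "local_gram P G"
    by (intro valued_gram.intro gram.intro coordinates.intro gram_axioms.intro completion_valued_field
      completion_cring local_gram_matrix G)
  let ?F = "completion P"
  have two: "2 \<le> ord_completion P (\<one>\<^bsub>?F\<^esub> \<oplus>\<^bsub>?F\<^esub> \<one>\<^bsub>?F\<^esub>)"
  proof -
    have "\<one>\<^bsub>?F\<^esub> \<oplus>\<^bsub>?F\<^esub> \<one>\<^bsub>?F\<^esub> = to_completion P (1 + 1)"
      using ring_hom_add[OF to_completion_hom, of 1 1] ring_hom_one[OF to_completion_hom] by simp
    then show ?thesis using v2 by (simp add: ord_to_completion)
  qed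
  define S where "S = embed m ` L"
  define L' where "L' = local_lattice P m L"
  have L': "L' = lin_span completion.vring (coord_space ?F m) S"
    by (simp add: L'_def S_def local_lattice_def completion_vring)
  have Sc: "S \<subseteq> coords" unfolding S_def by (auto intro!: coordsI to_completion_closed)
  have SB: "B s t \<in> completion.vring" if st: "s \<in> S" "t \<in> S" for s t
  proof -
    obtain x y where xy: "x \<in> L" "y \<in> L" "s = embed m x" "t = embed m y" using st unfolding S_def by blast
    have "0 \<le> ord_at P (bform field_rec m G x y)" by (rule ord_at_nonneg[OF L[OF xy(1,2)]])
    then show ?thesis unfolding xy(3,4) bform_completion
      by (simp add: completion.vring_def ord_to_completion to_completion_closed)
  qed
  have L'c: "L' \<subseteq> coords" unfolding L' by (rule lin_span_coords[OF completion.vring_subring(1) Sc])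
  have L'B: "B s t \<in> completion.vring" if "s \<in> L'" "t \<in> L'" for s t
    by (rule lin_span_integral[OF completion.vring_subring(1,2) _ _ Sc SB])
      (use that completion.vring_subring(4,5) in \<open>simp_all add: L'\<close>)
  have mem: "embed m x \<in> L'" if "x \<in> L" for x
    unfolding L' using that Sc by (intro lin_span_base completion.vring_subring(3)) (auto simp: S_def)
  obtain xs where xs: "is_bong ?F completion.vring m (local_gram P G) xs L'" "as = map (\<lambda>x. B x x) xs"
    using bong(2) unfolding has_bong_values_def completion_vring L'_def by blast
  have len: "length xs = m" using xs(2) bong(1) by simp
  \<comment> \<open>The test element of order 1 that \<open>square_approximation\<close> asks for in
    order to turn a bound on the relative defect into an approximation by a square.\<close>
  obtain p where p: "p \<in> P" "ord_at P p = 1" using ex_ord_at_1 by blast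
  have approx: "\<exists>t\<in>carrier ?F. let c = B (xs ! i) (xs ! i) \<otimes>\<^bsub>?F\<^esub> B (xs ! Suc i) (xs ! Suc i)
      in ord_completion P c + 2 \<le> ord_completion P (c \<ominus>\<^bsub>?F\<^esub> t \<otimes>\<^bsub>?F\<^esub> t)" if i: "Suc i < length xs" for i
  proof -
    define c where "c = B (xs ! i) (xs ! i) \<otimes>\<^bsub>?F\<^esub> B (xs ! Suc i) (xs ! Suc i)"
    have "xs ! i \<in> set xs" "xs ! Suc i \<in> set xs" using i by auto
    then have e: "xs ! i \<in> coords" "B (xs ! i) (xs ! i) \<noteq> \<zero>\<^bsub>?F\<^esub>"
      "xs ! Suc i \<in> coords" "B (xs ! Suc i) (xs ! Suc i) \<noteq> \<zero>\<^bsub>?F\<^esub>"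
      using bong_anisotropic[OF xs(1) L'c] by blast+
    have eF: "B (xs ! i) (xs ! i) \<in> carrier ?F" "B (xs ! Suc i) (xs ! Suc i) \<in> carrier ?F"
      by (rule bform_closed[OF e(1) e(1)], rule bform_closed[OF e(3) e(3)])
    have c: "c \<in> carrier ?F" "c \<noteq> \<zero>\<^bsub>?F\<^esub>"
      using eF e(2,4) completion.integral_iff[OF eF] by (simp_all add: c_def)
    have "as ! i \<otimes>\<^bsub>?F\<^esub> as ! Suc i = c" using i by (simp add: xs(2) c_def)
    then have "1 < relative_defect P c" using bong(3)[of i] i len by simp
    then have "1 < (INF y\<in>(\<lambda>y. inv\<^bsub>?F\<^esub> c \<otimes>\<^bsub>?F\<^esub> y) `
      (\<Inter>x\<in>carrier ?F. {(c \<ominus>\<^bsub>?F\<^esub> x \<otimes>\<^bsub>?F\<^esub> x) \<otimes>\<^bsub>?F\<^esub> y | y. y \<in> completion.vring}). ord_completion P y)"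
      unfolding relative_defect_def ord_ideal_def quadratic_defect_def completion_vring .
    from completion.square_approximation[OF c to_completion_closed _ this, of p]
    show ?thesis unfolding Let_def c_def[symmetric] by (simp add: ord_to_completion p(2))
  qed
  obtain x xs' where cons: "xs = x # xs'" using len m by (cases xs) auto
  have "ord_completion P (B (embed m y) (embed m y)) \<noteq> 1"
  proof (rule bong_no_odd_value[OF two xs(1)[unfolded cons] L'c L'B approx[unfolded cons]])
    show "B (embed m z) (embed m z) = \<one>\<^bsub>?F\<^esub>"
      unfolding bform_completion one(2) using ring_hom_one[OF to_completion_hom] by simp
  qed (use mem one(1) y(1) in auto)
  then show False unfolding bform_completion ord_to_completion using y(2) by simp
qed

end

section \<open>Multiples of the unit form\<close>

abbreviation embeddings :: "('k::field_char_0 \<Rightarrow> complex) set" where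
  "embeddings \<equiv> ring_hom field_rec field_rec"

lemma
  assumes "\<sigma> \<in> embeddings"
  shows embedding_add: "\<sigma> (x + y) = \<sigma> x + \<sigma> y"
    and embedding_mult: "\<sigma> (x * y) = \<sigma> x * \<sigma> y"
    and embedding_one: "\<sigma> 1 = 1"
  using ring_hom_add[OF assms, of x y] ring_hom_mult[OF assms, of x y] ring_hom_one[OF assms] by simp_all

lemma embedding_zero: "\<sigma> \<in> embeddings \<Longrightarrow> \<sigma> 0 = 0"
  using embedding_add[of \<sigma> 0 0] by simp

lemma embedding_minus: "\<sigma> \<in> embeddings \<Longrightarrow> \<sigma> (- x) = - \<sigma> x"
  using embedding_add[of \<sigma> x "- x"] embedding_zero[of \<sigma>] by (simp add: add_eq_0_iff)

lemma embedding_of_nat: "\<sigma> \<in> embeddings \<Longrightarrow> \<sigma> (of_nat n) = of_nat n"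
  by (induction n) (simp_all add: embedding_zero embedding_one embedding_add)

lemma embedding_of_int: "\<sigma> \<in> embeddings \<Longrightarrow> \<sigma> (of_int n) = of_int n"
  by (cases n) (simp_all add: embedding_of_nat embedding_minus embedding_add embedding_one del: of_nat_Suc)

lemma embedding_sum: "\<sigma> \<in> embeddings \<Longrightarrow> \<sigma> (\<Sum>i\<in>I. f i) = (\<Sum>i\<in>I. \<sigma> (f i))"
  by (induction I rule: infinite_finite_induct) (simp_all add: embedding_zero embedding_add)

lemma embedding_nonzero: "\<sigma> \<in> embeddings \<Longrightarrow> x \<noteq> 0 \<Longrightarrow> \<sigma> x \<noteq> 0"
  using embedding_mult[of \<sigma> x "inverse x"] embedding_one[of \<sigma>] by auto

lemma embedding_poly:
  assumes "\<sigma> \<in> embeddings"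
  shows "\<sigma> (poly (map_poly of_int p) x) = poly (map_poly of_int p) (\<sigma> x)"
  by (induction p)
    (simp_all add: map_poly_pCons embedding_zero[OF assms] embedding_add[OF assms] embedding_mult[OF assms]
      embedding_of_int[OF assms])

text \<open>The images of \<open>x\<close> under all embeddings are among the finitely many complex
  roots of one monic integer polynomial, so a single bound serves every embedding.\<close>

lemma embeddings_bounded:
  fixes x :: "'k::field_char_0"
  assumes "algebraic_int x"
  shows "\<exists>N::nat. \<forall>\<sigma>\<in>embeddings. cmod (\<sigma> x) < real N"
proof -
  obtain p where p: "poly (map_poly of_int p) x = 0" "Polynomial.lead_coeff p = 1"
    using assms by (auto simp: algebraic_int_altdef_ipoly)
  have "(map_poly of_int p :: complex poly) \<noteq> 0"
  proof -
    have "poly.coeff (map_poly of_int p :: complex poly) (Polynomial.degree p) = 1"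
      using p(2) by (simp add: coeff_map_poly)
    then show ?thesis by auto
  qed
  then have fin: "finite {z::complex. poly (map_poly of_int p) z = 0}" by (rule poly_roots_finite)
  obtain N :: nat where N: "Max (insert 0 (cmod ` {z. poly (map_poly of_int p) z = 0})) < real N"
    using reals_Archimedean2 by blast
  have "cmod (\<sigma> x) < real N" if \<sigma>: "\<sigma> \<in> embeddings" for \<sigma>
  proof -
    have "poly (map_poly of_int p) (\<sigma> x) = \<sigma> 0" using embedding_poly[OF \<sigma>, of p x] p(1) by simp
    then have "poly (map_poly of_int p) (\<sigma> x) = 0" using embedding_zero[OF \<sigma>] by simp
    then have "cmod (\<sigma> x) \<le> Max (insert 0 (cmod ` {z. poly (map_poly of_int p) z = 0}))"
      using fin by (intro Max_ge) auto
    then show ?thesis using N by simp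
  qed
  then show ?thesis by blast
qed

section \<open>Coordinate spaces over the number field\<close>

lemma finsum_field_rec: "finite A \<Longrightarrow> (\<Oplus>\<^bsub>field_rec\<^esub>i\<in>A. f i) = (\<Sum>i\<in>A. f i :: 'k::field)"
proof (induction A rule: finite_induct)
  case empty
  interpret cring "field_rec :: 'k ring" by (rule cring_from_type_algebra)
  show ?case by simp
next
  case (insert a A)
  interpret cring "field_rec :: 'k ring" by (rule cring_from_type_algebra)
  show ?case using insert by (subst finsum_insert) auto
qed

lemma bform_field_rec: "bform field_rec m G x y = (\<Sum>i<m. \<Sum>j<m. x i * G i j * y j :: 'k::field)"
  by (simp add: bform_def finsum_field_rec)

interpretation field_coords: coordinates "field_rec :: 'k::field ring" m for m
  by (intro coordinates.intro cring_from_type_algebra)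

lemma coord_space_finsum_component:
  fixes f :: "'i \<Rightarrow> nat \<Rightarrow> 'k::field"
  assumes "finite T" "\<And>s. s \<in> T \<Longrightarrow> f s \<in> carrier (coord_space field_rec m)" "i < m"
  shows "(\<Oplus>\<^bsub>coord_space field_rec m\<^esub>s\<in>T. f s) i = (\<Sum>s\<in>T. f s i)"
  using assms(1,2)
proof (induction T rule: finite_induct)
  case empty
  interpret V: abelian_group "coord_space (field_rec :: 'k ring) m"
    by (rule field_coords.coord_space_abelian_group)
  show ?case using assms(3) by (simp add: field_coords.coord_space_simps(2))
next
  case (insert s T)
  interpret V: abelian_group "coord_space (field_rec :: 'k ring) m"
    by (rule field_coords.coord_space_abelian_group)
  have "(\<Oplus>\<^bsub>coord_space field_rec m\<^esub>s\<in>insert s T. f s) =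
      f s \<oplus>\<^bsub>coord_space field_rec m\<^esub> (\<Oplus>\<^bsub>coord_space field_rec m\<^esub>s\<in>T. f s)"
    using insert.hyps insert.prems by (intro V.finsum_insert) auto
  then show ?case using insert assms(3) by (simp add: field_coords.coord_space_simps(3))
qed

definition unit_coord :: "nat \<Rightarrow> nat \<Rightarrow> nat \<Rightarrow> 'k::field" where
  "unit_coord n k = (\<lambda>i\<in>{..<n}. of_bool (i = k))"

lemma unit_coord_carrier: "unit_coord n k \<in> carrier (coord_space (field_rec :: 'k::field ring) n)"
  unfolding unit_coord_def by (rule field_coords.coordsI) simp

text \<open>The form takes the value \<open>b * b * G 0 0\<close> at \<open>b\<close> times the
  first unit vector. Comparing \<open>b = 1\<close> with \<open>b = a\<close> shows that
  \<open>\<sigma> a\<close> has a positive real square, hence is real.\<close>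

lemma totally_real_if_positive_definite:
  fixes G :: "nat \<Rightarrow> nat \<Rightarrow> 'k::field_char_0" and \<sigma> :: "'k \<Rightarrow> complex"
  assumes pd: "positive_definite m G" and m: "0 < m" and \<sigma>: "\<sigma> \<in> embeddings"
  shows "\<sigma> a \<in> \<real>"
proof (cases "a = 0")
  case True
  then show ?thesis using embedding_zero[OF \<sigma>] by simp
next
  case False
  define e :: "'k \<Rightarrow> nat \<Rightarrow> 'k" where "e b = (\<lambda>i\<in>{..<m}. b * of_bool (i = 0))" for b
  have pos: "\<sigma> (b * b * G 0 0) \<in> \<real> \<and> 0 < Re (\<sigma> (b * b * G 0 0))" if b: "b \<noteq> 0" for b
  proof -
    have "e b \<in> carrier (coord_space field_rec m)" unfolding e_def by (rule field_coords.coordsI) simp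
    moreover have "e b \<noteq> \<zero>\<^bsub>coord_space field_rec m\<^esub>"
    proof
      assume "e b = \<zero>\<^bsub>coord_space field_rec m\<^esub>"
      then have "e b 0 = \<zero>\<^bsub>coord_space field_rec m\<^esub> 0" by simp
      then show False using m b by (simp add: e_def field_coords.coord_space_simps(2))
    qed
    moreover have "qform field_rec m G (e b) = b * b * G 0 0"
    proof -
      have "qform field_rec m G (e b) = (\<Sum>i<m. \<Sum>j<m. if i = 0 then (if j = 0 then b * b * G 0 0 else 0) else 0)"
        unfolding bform_field_rec by (intro sum.cong refl) (auto simp: e_def mult_ac)
      also have "\<dots> = (\<Sum>i<m. if i = 0 then \<Sum>j<m. (if j = 0 then b * b * G 0 0 else 0) else 0)"
        by (intro sum.cong refl) simp
      also have "\<dots> = b * b * G 0 0" using m by simp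
      finally show ?thesis .
    qed
    moreover have "\<forall>x\<in>carrier (coord_space field_rec m) - {\<zero>\<^bsub>coord_space field_rec m\<^esub>}.
        \<sigma> (qform field_rec m G x) \<in> \<real> \<and> 0 < Re (\<sigma> (qform field_rec m G x))"
      using pd \<sigma> unfolding positive_definite_def by blast
    ultimately show ?thesis by (metis DiffI singletonD)
  qed
  define g where "g = Re (\<sigma> (G 0 0))"
  have g: "\<sigma> (G 0 0) = of_real g" "0 < g" using pos[of 1] by (simp_all add: g_def)
  have "\<sigma> (a * a * G 0 0) = \<sigma> a * \<sigma> a * of_real g" by (simp add: embedding_mult[OF \<sigma>] g(1))
  then have s: "\<sigma> a * \<sigma> a * of_real g \<in> \<real>" "0 < Re (\<sigma> a * \<sigma> a * of_real g)" using pos[OF False] by auto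
  then have "Im (\<sigma> a * \<sigma> a) = 0" "0 < Re (\<sigma> a * \<sigma> a)"
    using g(2) by (auto simp: complex_is_Real_iff zero_less_mult_iff)
  \<comment> \<open>The imaginary part of the square is twice the product of the real and imaginary
    parts of \<open>\<sigma> a\<close>; if the real part were 0, the square would have nonpositive
    real part.\<close>
  then have "Im (\<sigma> a) = 0"
    by (cases "Re (\<sigma> a) = 0") (auto simp: zero_less_mult_iff mult_less_0_iff)
  then show ?thesis by (simp add: complex_is_Real_iff)
qed

section \<open>The lattice with form c(x_1^2 + ... + x_n^2)\<close>

definition scalar_gram :: "'k::field \<Rightarrow> nat \<Rightarrow> nat \<Rightarrow> 'k" where
  "scalar_gram c i j = (if i = j then c else 0)"

definition standard_lattice :: "nat \<Rightarrow> (nat \<Rightarrow> 'k::field) set" where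
  "standard_lattice n = lin_span ring_of_integers (coord_space field_rec n) (unit_coord n ` {..<n})"

lemma bform_scalar_gram: "bform field_rec n (scalar_gram c) x y = c * (\<Sum>i<n. x i * y i)"
proof -
  have "bform field_rec n (scalar_gram c) x y = (\<Sum>i<n. \<Sum>j<n. if i = j then c * (x i * y i) else 0)"
    unfolding bform_field_rec by (intro sum.cong refl) (auto simp: scalar_gram_def)
  also have "\<dots> = (\<Sum>i<n. c * (x i * y i))" by (intro sum.cong refl) simp
  finally show ?thesis by (simp add: sum_distrib_left)
qed

lemma standard_lattice_unit_coord:
  "k < n \<Longrightarrow> (unit_coord n k :: nat \<Rightarrow> 'k::field_char_0) \<in> standard_lattice n"
  unfolding standard_lattice_def
  by (intro field_coords.lin_span_base) (auto simp: unit_coord_carrier)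

text \<open>Under an embedding the form becomes the positive number \<open>\<sigma> c\<close> times
  a sum of squares, and these are squares of reals because the field is totally real.\<close>

lemma scalar_lattice:
  fixes c :: "'k::field_char_0"
  assumes c: "algebraic_int c" "\<And>\<sigma>. \<sigma> \<in> embeddings \<Longrightarrow> 0 < Re (\<sigma> c)"
    and real: "\<And>\<sigma> a. \<sigma> \<in> embeddings \<Longrightarrow> \<sigma> (a :: 'k) \<in> \<real>"
  shows "posdef_classic_lattice n (scalar_gram c) (standard_lattice n)"
  unfolding posdef_classic_lattice_def
proof (intro conjI ballI)
  show gm: "gram_matrix field_rec n (scalar_gram c)" by (simp add: gram_matrix_def scalar_gram_def)
  interpret g: gram "field_rec :: 'k ring" n "scalar_gram c"
    by (intro gram.intro gram_axioms.intro gm coordinates.intro cring_from_type_algebra)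
  have U: "unit_coord n ` {..<n} \<subseteq> carrier (coord_space (field_rec :: 'k ring) n)"
    using unit_coord_carrier by blast
  show "positive_definite n (scalar_gram c)"
    unfolding positive_definite_def
  proof (intro allI impI ballI)
    fix \<sigma> :: "'k \<Rightarrow> complex" and x :: "nat \<Rightarrow> 'k"
    assume \<sigma>: "\<sigma> \<in> embeddings" and x: "x \<in> carrier (coord_space field_rec n) - {\<zero>\<^bsub>coord_space field_rec n\<^esub>}"
    define r where "r a = Re (\<sigma> a)" for a
    have r: "\<sigma> a = of_real (r a)" for a using real[OF \<sigma>, of a] by (simp add: r_def)
    have "\<exists>i<n. x i \<noteq> 0"
    proof (rule ccontr)
      assume "\<not> ?thesis"
      then have "x = \<zero>\<^bsub>coord_space field_rec n\<^esub>"
        using x by (intro field_coords.coords_eqI[of x n])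
          (auto simp: field_coords.coord_space_simps(2) intro!: field_coords.coordsI)
      then show False using x by blast
    qed
    then obtain i where i: "i < n" "x i \<noteq> 0" by blast
    have "r (x i) \<noteq> 0" using embedding_nonzero[OF \<sigma> i(2)] r by auto
    then have "0 < (\<Sum>j<n. r (x j) * r (x j))"
      using i(1) by (intro sum_pos2[of _ i]) (auto simp: zero_less_mult_iff)
    then have "0 < r c * (\<Sum>j<n. r (x j) * r (x j))" using c(2)[OF \<sigma>] by (simp add: r_def)
    moreover have "\<sigma> (qform field_rec n (scalar_gram c) x) = \<sigma> c * (\<Sum>j<n. \<sigma> (x j) * \<sigma> (x j))"
      by (simp add: bform_scalar_gram embedding_mult[OF \<sigma>] embedding_sum[OF \<sigma>])
    then have "\<sigma> (qform field_rec n (scalar_gram c) x) = of_real (r c * (\<Sum>j<n. r (x j) * r (x j)))"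
      unfolding r[of c] r[of "x _"] by simp
    ultimately show "\<sigma> (qform field_rec n (scalar_gram c) x) \<in> \<real> \<and> 0 < Re (\<sigma> (qform field_rec n (scalar_gram c) x))"
      by simp
  qed
  show "full_lattice field_rec ring_of_integers n (standard_lattice n :: (nat \<Rightarrow> 'k) set)"
    unfolding full_lattice_def
  proof (intro conjI exI)
    show "standard_lattice n = lin_span ring_of_integers (coord_space (field_rec :: 'k ring) n) (unit_coord n ` {..<n})"
      by (rule standard_lattice_def)
    show "lin_span (carrier field_rec) (coord_space field_rec n) (standard_lattice n) =
        carrier (coord_space (field_rec :: 'k ring) n)"
    proof
      have "standard_lattice n \<subseteq> carrier (coord_space (field_rec :: 'k ring) n)"
        unfolding standard_lattice_def by (rule g.lin_span_coords[OF _ U]) simp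
      then show "lin_span (carrier field_rec) (coord_space field_rec n) (standard_lattice n) \<subseteq>
          carrier (coord_space (field_rec :: 'k ring) n)"
        by (intro g.lin_span_coords) simp_all
      show "carrier (coord_space (field_rec :: 'k ring) n) \<subseteq>
          lin_span (carrier field_rec) (coord_space field_rec n) (standard_lattice n)"
      proof
        fix x :: "nat \<Rightarrow> 'k" assume x: "x \<in> carrier (coord_space field_rec n)"
        \<comment> \<open>\<open>lin_span\<close> takes coefficients as a function of the generator
          rather than of its index; pairing with \<open>x\<close> gives the coordinate
          \<open>x k\<close> at the k-th unit vector.\<close>
        define d where "d s = (\<Sum>j<n. x j * s j)" for s :: "nat \<Rightarrow> 'k"
        define T where "T = (unit_coord n :: nat \<Rightarrow> nat \<Rightarrow> 'k) ` {..<n}"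
        have T: "finite T" "T \<subseteq> standard_lattice n" "T \<subseteq> carrier (coord_space field_rec n)"
          unfolding T_def using standard_lattice_unit_coord U by auto
        have inj: "inj_on (unit_coord n :: nat \<Rightarrow> nat \<Rightarrow> 'k) {..<n}"
        proof (rule inj_onI)
          fix k l assume kl: "k \<in> {..<n}" "l \<in> {..<n}" "(unit_coord n k :: nat \<Rightarrow> 'k) = unit_coord n l"
          then have "(unit_coord n k k :: 'k) = unit_coord n l k" by simp
          then show "k = l" using kl by (simp add: unit_coord_def split: if_splits)
        qed
        have dk: "d (unit_coord n k) = x k" if "k < n" for k
        proof -
          have "d (unit_coord n k) = (\<Sum>j<n. if j = k then x k else 0)"
            unfolding d_def by (intro sum.cong refl) (simp add: unit_coord_def)
          then show ?thesis using that by simp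
        qed
        have Tc: "d s \<odot>\<^bsub>coord_space field_rec n\<^esub> s \<in> carrier (coord_space field_rec n)" if "s \<in> T" for s
          using that T(3) by (intro field_coords.coords_smult) auto
        have "x = (\<Oplus>\<^bsub>coord_space field_rec n\<^esub>s\<in>T. d s \<odot>\<^bsub>coord_space field_rec n\<^esub> s)"
        proof (rule field_coords.coords_eqI[OF x])
          show "(\<Oplus>\<^bsub>coord_space field_rec n\<^esub>s\<in>T. d s \<odot>\<^bsub>coord_space field_rec n\<^esub> s) \<in> carrier (coord_space field_rec n)"
            by (rule g.finsum_smult_coords[OF T(1,3)]) simp
          fix i assume i: "i < n"
          have "(\<Oplus>\<^bsub>coord_space field_rec n\<^esub>s\<in>T. d s \<odot>\<^bsub>coord_space field_rec n\<^esub> s) i =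
              (\<Sum>s\<in>T. (d s \<odot>\<^bsub>coord_space field_rec n\<^esub> s) i)"
            by (rule coord_space_finsum_component[OF T(1) Tc i])
          also have "\<dots> = (\<Sum>s\<in>T. d s * s i)"
            using i by (simp add: field_coords.coord_space_simps(4))
          also have "\<dots> = (\<Sum>k<n. d (unit_coord n k) * unit_coord n k i)"
            unfolding T_def by (subst sum.reindex[OF inj]) (simp add: comp_def)
          also have "\<dots> = (\<Sum>k<n. x k * of_bool (i = k))"
            using i by (intro sum.cong refl) (simp add: dk, simp add: unit_coord_def)
          also have "\<dots> = (\<Sum>k<n. if k = i then x i else 0)" by (intro sum.cong refl) simp
          also have "\<dots> = x i" using i by simp
          finally show "x i = (\<Oplus>\<^bsub>coord_space field_rec n\<^esub>s\<in>T. d s \<odot>\<^bsub>coord_space field_rec n\<^esub> s) i" by (rule sym)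
        qed
        then show "x \<in> lin_span (carrier field_rec) (coord_space field_rec n) (standard_lattice n)"
          unfolding lin_span_def using T by (intro CollectI exI[of _ d] exI[of _ T]) simp
      qed
    qed
  qed (use U in auto)
  fix x y :: "nat \<Rightarrow> 'k" assume xy: "x \<in> standard_lattice n" "y \<in> standard_lattice n"
  have base: "bform field_rec n (scalar_gram c) s t \<in> ring_of_integers"
    if st: "s \<in> unit_coord n ` {..<n}" "t \<in> unit_coord n ` {..<n}" for s t
  proof -
    have unit: "algebraic_int (unit_coord n k i :: 'k)" if "i < n" for i k
      using that by (simp add: unit_coord_def)
    obtain k l where kl: "s = unit_coord n k" "t = unit_coord n l" using st by blast
    have "algebraic_int (\<Sum>i<n. s i * t i)"
      unfolding kl by (rule algebraic_int_sum, rule algebraic_int_mult) (simp_all add: unit)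
    then show ?thesis unfolding bform_scalar_gram by (simp add: algebraic_int_mult c(1))
  qed
  show "bform field_rec n (scalar_gram c) x y \<in> ring_of_integers"
    by (rule g.lin_span_integral[OF _ _ _ _ U base xy[unfolded standard_lattice_def]])
      (simp_all add: algebraic_int_add algebraic_int_mult)
qed

text \<open>The image of the first unit vector under a representation of the scalar lattice has
  value \<open>c\<close>; that vector exists because \<open>1 \<le> n\<close>.\<close>

lemma n_universal_represents_scalar:
  fixes c :: "'k::field_char_0"
  assumes univ: "n_universal n m G L" and n: "1 \<le> n"
    and c: "algebraic_int c" "\<And>\<sigma>. \<sigma> \<in> embeddings \<Longrightarrow> 0 < Re (\<sigma> c)"
    and real: "\<And>\<sigma> a. \<sigma> \<in> embeddings \<Longrightarrow> \<sigma> (a :: 'k) \<in> \<real>"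
  shows "\<exists>x\<in>L. bform field_rec m G x x = c"
proof -
  have "represents m G L n (scalar_gram c) (standard_lattice n)"
  proof -
    have "posdef_classic_lattice n (scalar_gram c) (standard_lattice n)"
      by (rule scalar_lattice) (simp_all add: c real)
    then show ?thesis using univ unfolding n_universal_def by blast
  qed
  then have "\<exists>f. (\<forall>x\<in>carrier (coord_space field_rec n). \<forall>y\<in>carrier (coord_space field_rec n).
        bform field_rec m G (f x) (f y) = bform field_rec n (scalar_gram c) x y) \<and> f ` standard_lattice n \<subseteq> L"
    unfolding represents_def Let_def by (elim bexE conjE) (intro exI conjI)
  then obtain f where f: "\<forall>x\<in>carrier (coord_space field_rec n). \<forall>y\<in>carrier (coord_space field_rec n).
        bform field_rec m G (f x) (f y) = bform field_rec n (scalar_gram c) x y" "f ` standard_lattice n \<subseteq> L"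
    by blast
  define e :: "nat \<Rightarrow> 'k" where "e = unit_coord n 0"
  have "bform field_rec m G (f e) (f e) = c * (\<Sum>i<n. e i * e i)"
    using f(1)[rule_format, of e e] by (simp add: e_def unit_coord_carrier bform_scalar_gram)
  also have "(\<Sum>i<n. e i * e i) = (\<Sum>i<n. if i = 0 then 1 else 0)"
    by (intro sum.cong refl) (simp add: e_def unit_coord_def)
  also have "\<dots> = 1" using n by simp
  finally have "bform field_rec m G (f e) (f e) = c" by simp
  moreover have "f e \<in> L" using f(2) standard_lattice_unit_coord[of 0 n] n unfolding e_def by auto
  ultimately show ?thesis by blast
qed

theorem theorem1p6:
  fixes n m :: nat
    and G :: "nat \<Rightarrow> nat \<Rightarrow> 'k::field_char_0"
    and L :: "(nat \<Rightarrow> 'k) set"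
  assumes "number_field TYPE('k)"
    and "1 \<le> n"
    and "n + 3 \<le> m"
    and "posdef_classic_lattice m G L"
    and "n_universal n m G L"
    and "\<And>P :: 'k set. dyadic_prime P \<Longrightarrow>
           \<exists>as. length as = m \<and>
             has_bong_values (completion P) (completion_integers P) m (local_gram P G)
               (local_lattice P m L) as \<and>
             (\<forall>i. Suc i < m \<longrightarrow>
               1 < relative_defect P (as ! i \<otimes>\<^bsub>completion P\<^esub> as ! Suc i))"
  shows "unramified_in 2 TYPE('k) \<and> odd (discriminant TYPE('k))"
proof -
  note nf = assms(1)
  have m: "0 < m" using assms(3) by simp
  have gm: "gram_matrix field_rec m G" and pd: "positive_definite m G"
    and int: "\<And>x y. x \<in> L \<Longrightarrow> y \<in> L \<Longrightarrow> algebraic_int (bform field_rec m G x y)"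
    using assms(4) unfolding posdef_classic_lattice_def by auto
  have real: "\<sigma> (a :: 'k) \<in> \<real>" if "\<sigma> \<in> embeddings" for \<sigma> a
    using totally_real_if_positive_definite[OF pd m that] .
  have unram: "ord_at P 2 = 1" if dyadic: "dyadic P" for P :: "'k set"
  proof (rule ccontr)
    interpret dyadic P by (rule dyadic)
    assume n1: "ord_at P 2 \<noteq> 1"
    obtain p where p: "p \<in> P" "ord_at P p = 1" using ex_ord_at_1 by blast
    obtain N :: nat where N: "\<And>\<sigma>. \<sigma> \<in> embeddings \<Longrightarrow> cmod (\<sigma> p) < real N"
      using embeddings_bounded[OF P_alg[OF p(1)]] by blast
    \<comment> \<open>\<open>real N\<close> already exceeds every absolute value of
      \<open>p\<close>, which gives positivity with room to spare. The factor 2 keeps the correction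
      from disturbing the order of \<open>p\<close>.\<close>
    define c where "c = p + 2 * of_nat N"
    have c: "algebraic_int c" using P_alg[OF p(1)] by (auto simp: c_def)
    have cpos: "0 < Re (\<sigma> c)" if \<sigma>: "\<sigma> \<in> embeddings" for \<sigma>
    proof -
      have two: "\<sigma> 2 = 2" using embedding_of_nat[OF \<sigma>, of 2] by simp
      have "\<sigma> c = \<sigma> p + 2 * of_nat N"
        by (simp add: c_def embedding_add[OF \<sigma>] embedding_mult[OF \<sigma>] embedding_of_nat[OF \<sigma>] two)
      then have "Re (\<sigma> c) = Re (\<sigma> p) + 2 * real N" by simp
      moreover have "\<bar>Re (\<sigma> p)\<bar> < real N" using abs_Re_le_cmod[of "\<sigma> p"] N[OF \<sigma>] by linarith
      ultimately show ?thesis by linarith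
    qed
    have ord_c: "ord_at P c = 1"
    proof -
      \<comment> \<open>The ramification assumed for contradiction already enters here: it makes the
        order of the correction larger than that of \<open>p\<close>.\<close>
      have "1 < ord_at P 2" using ord_at_prime[OF P_two] n1 by simp
      also have "ord_at P 2 + 0 \<le> ord_at P 2 + ord_at P (of_nat N)"
        by (intro add_left_mono ord_at_nonneg) simp
      then have "ord_at P 2 \<le> ord_at P (2 * of_nat N)" by (simp add: ord_at_mult)
      finally have "ord_at P p < ord_at P (2 * of_nat N)" using p(2) by simp
      then show ?thesis unfolding c_def using v_add_eq p(2) by simp
    qed
    have "\<exists>x\<in>L. bform field_rec m G x x = c"
      by (rule n_universal_represents_scalar[OF assms(5,2) c]) (simp_all add: cpos real)
    then obtain y where y: "y \<in> L" "bform field_rec m G y y = c" by blast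
    have "\<exists>x\<in>L. bform field_rec m G x x = 1"
      by (rule n_universal_represents_scalar[OF assms(5,2)]) (simp_all add: embedding_one real)
    then obtain z where z: "z \<in> L" "bform field_rec m G z z = 1" by blast
    have "dyadic_prime P" using dyadic_iff[OF nf] dyadic by blast
    from assms(6)[OF this] obtain as where as: "length as = m"
      "has_bong_values (completion P) (completion_integers P) m (local_gram P G) (local_lattice P m L) as"
      "\<And>i. Suc i < m \<Longrightarrow> 1 < relative_defect P (as ! i \<otimes>\<^bsub>completion P\<^esub> as ! Suc i)"
      by blast
    have ord_y: "ord_at P (bform field_rec m G y y) = 1" using y(2) ord_c by simp
    have "ord_at P 2 = 1"
      by (rule ord_2_eq_1[where L = L and m = m and G = G and as = as and y = y and z = z])
        (fact gm int as z y(1) ord_y m)+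
    then show False using n1 by blast
  qed
  have "unramified_in 2 TYPE('k)"
    unfolding unramified_in_def
  proof (intro allI impI)
    fix P :: "'k set"
    assume "finite_prime P \<and> of_nat 2 \<in> P"
    then have "dyadic_prime P" by (simp add: dyadic_prime_def)
    then show "ord_at P (of_nat 2) = 1" using unram dyadic_iff[OF nf] by simp
  qed
  moreover have "odd (discriminant TYPE('k))"
    using odd_discriminant_if_unramified[OF nf] unram by blast
  ultimately show ?thesis by blast
qed

end
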